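(* Let $n\ge1$ and let $(\epsilon_1,\ldots,\epsilon_n)\in\{0,1\}^n$ be arbitrary. Let $S(z)$ be $S^{\mathrm{tr}}(z)$ or $S^{s,t}(z)$ with $s,t\in\{1,2\}$, acting on $\mathcal W\otimes\mathcal W$. Then $S$ satisfies the Yang--Baxter equation $$S_{1,2}(x)\,S_{1,3}(xy)\,S_{2,3}(y)=S_{2,3}(y)\,S_{1,3}(xy)\,S_{1,2}(x)$$ in $\mathrm{End}(\mathcal W\otimes\mathcal W\otimes\mathcal W)$, where $S_{a,b}$ denotes $S$ acting on the $a$th and $b$th copies of $\mathcal W$.
   Context: $q$ is generic; $x,y,z$ are indeterminates and matrix elements are regarded as power series in them. $(q^a)_m=\prod_{k=1}^m(1-q^{ak})$ for a positive integer $a$ (so $(q^{s^2})_m$ means $(q)_m$ for $s=1$ and $(q^4)_m$ for $s=2$), $\binom{m}{k}_{q^2}=\frac{(q^2)_m}{(q^2)_k(q^2)_{m-k}}$ (zero unless $0\le k\le m$). $F$ has basis $|m\rangle$, $m\in\mathbb Z_{\ge0}$; $V$ has basis $|0\rangle,|1\rangle$; $W^{(0)}=F$, $W^{(1)}=V$; $\mathcal W=W^{(\epsilon_1)}\otimes\cdots\otimes W^{(\epsilon_n)}$ has basis $|\mathbf m\rangle=|m_1,\ldots,m_n\rangle$ ($m_i\in\mathbb Z_{\ge0}$ if $\epsilon_i=0$, $m_i\in\{0,1\}$ if $\epsilon_i=1$). For nonnegative integer indices $$\mathscr S^{(0)\,a,b,c}_{\ \ \ \,i,j,k}=\delta_{a+b,i+j}\delta_{b+c,j+k}\sum_{\lambda,\mu\ge0,\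 \lambda+\mu=b}(-1)^\lambda q^{i(c-j)+(k+1)\lambda+\mu(\mu-k)}\frac{(q^2)_{c+\mu}}{(q^2)_c}\binom{i}{\mu}_{q^2}\binom{j}{\lambda}_{q^2}.$$ $\mathscr S^{(1)\,a,b,c}_{\ \ \ \,i,j,k}$ ($a,b,i,j\in\{0,1\}$, $c,k\in\mathbb Z_{\ge0}$) is zero except $\mathscr S^{(1)0,0,c}_{\ \ \ 0,0,k}=\mathscr S^{(1)1,1,c}_{\ \ \ 1,1,k}=\delta_{c,k}$, $\mathscr S^{(1)0,1,c}_{\ \ \ 0,1,k}=-\delta_{c,k}q^{k+1}$, $\mathscr S^{(1)1,0,c}_{\ \ \ 1,0,k}=\delta_{c,k}q^k$, $\mathscr S^{(1)0,1,c}_{\ \ \ 1,0,k}=\delta_{c,k-1}(1-q^{2k})$, $\mathscr S^{(1)1,0,c}_{\ \ \ 0,1,k}=\delta_{c,k+1}$. $S(z)(|\mathbf i\rangle\otimes|\mathbf j\rangle)=\sum_{\mathbf a,\mathbf b}S(z)^{\mathbf a,\mathbf b}_{\mathbf i,\mathbf j}|\mathbf a\rangle\otimes|\mathbf b\rangle$ with (sums over nonnegative integers) $$S^{\mathrm{tr}}(z)^{\mathbf a,\mathbf b}_{\mathbf i,\mathbf j}=\varrho(z)\sum_{c_0,\ldots,c_{n-1}}z^{c_0}\prod_{k=1}^n\mathscr S^{(\epsilon_k)\,a_k,b_k,c_{k-1}}_{\ \ \ \ \,i_k,j_k,c_k}\quad(c_n:=c_0),$$ $$S^{s,t}(z)^{\mathbf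 a,\mathbf b}_{\mathbf i,\mathbf j}=\varrho(z)\sum_{c_0,\ldots,c_n}\frac{z^{c_0}(q^2)_{sc_0}}{(q^{s^2})_{c_0}(q^{t^2})_{c_n}}\prod_{k=1}^n\mathscr S^{(\epsilon_k)\,a_k,b_k,c'_{k-1}}_{\ \ \ \ \,i_k,j_k,c''_k},$$ where $c'_0=sc_0$, $c'_k=c_k$ for $1\le k\le n-1$, $c''_k=c_k$ for $1\le k\le n-1$, $c''_n=tc_n$. Here $\varrho(z)$ is a scalar normalization factor. *)

theory Defs
  imports
    "HOL-Computational_Algebra.Formal_Power_Series"
    "HOL-Library.Poly_Mapping"
begin

text \<open>
  Generic \<open>q\<close>: everything below only divides by powers of \<open>q\<close> and by factors \<open>1 - q^m\<close>, \<open>m > 0\<close>.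
  This covers complex \<open>q\<close> that are not roots of unity as well as a transcendental \<open>q\<close>.
\<close>

definition generic :: "'k::field_char_0 \<Rightarrow> bool" where
  "generic q \<longleftrightarrow> q \<noteq> 0 \<and> (\<forall>m>0. q ^ m \<noteq> 1)"

text \<open>\<open>qpoch q a m\<close> is $(q^a)_m$ and \<open>qbinom2 q m k\<close> is the binomial in base $q^2$.\<close>

definition qpoch :: "'k::field_char_0 \<Rightarrow> nat \<Rightarrow> nat \<Rightarrow> 'k" where
  "qpoch q a m = (\<Prod>k=1..m. 1 - q ^ (a * k))"

definition qbinom2 :: "'k::field_char_0 \<Rightarrow> nat \<Rightarrow> nat \<Rightarrow> 'k" where
  "qbinom2 q m k =
     (if k \<le> m then qpoch q 2 m / (qpoch q 2 k * qpoch q 2 (m - k)) else 0)"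


text \<open>The arguments of the three-body weights are ordered \<open>a b c i j k\<close> (upper, then lower indices).\<close>

definition scrS0 :: "'k::field_char_0 \<Rightarrow> nat \<Rightarrow> nat \<Rightarrow> nat \<Rightarrow> nat \<Rightarrow> nat \<Rightarrow> nat \<Rightarrow> 'k" where
  "scrS0 q a b c i j k =
     (if a + b = i + j \<and> b + c = j + k then
        (\<Sum>l\<le>b. let m = b - l in
           (-1) ^ l
           * q powi (int i * (int c - int j) + (int k + 1) * int l + int m * (int m - int k))
           * (qpoch q 2 (c + m) / qpoch q 2 c) * qbinom2 q i m * qbinom2 q j l)
      else 0)"

definition scrS1 :: "'k::field_char_0 \<Rightarrow> nat \<Rightarrow> nat \<Rightarrow> nat \<Rightarrow> nat \<Rightarrow> nat \<Rightarrow> nat \<Rightarrow> 'k" where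
  "scrS1 q a b c i j k =
     (if (a, b, i, j) = (0, 0, 0, 0) then (if c = k then 1 else 0)
      else if (a, b, i, j) = (1, 1, 1, 1) then (if c = k then 1 else 0)
      else if (a, b, i, j) = (0, 1, 0, 1) then (if c = k then - (q ^ (k + 1)) else 0)
      else if (a, b, i, j) = (1, 0, 1, 0) then (if c = k then q ^ k else 0)
      else if (a, b, i, j) = (0, 1, 1, 0) then (if c + 1 = k then 1 - q ^ (2 * k) else 0)
      else if (a, b, i, j) = (1, 0, 0, 1) then (if c = k + 1 then 1 else 0)
      else 0)"

definition scrS :: "'k::field_char_0 \<Rightarrow> nat \<Rightarrow> nat \<Rightarrow> nat \<Rightarrow> nat \<Rightarrow> nat \<Rightarrow> nat \<Rightarrow> nat \<Rightarrow> 'k" where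
  "scrS q e = (if e = 0 then scrS0 q else scrS1 q)"


text \<open>
  A sequence $(\epsilon_1,\ldots,\epsilon_n)$ and a basis label $(m_1,\ldots,m_n)$ are lists of length
  \<open>n\<close>, so that $\epsilon_k$ is \<open>eps ! (k - 1)\<close>. A family of matrix elements
  $M^{\mathbf a,\mathbf b}_{\mathbf i,\mathbf j}$ is a function \<open>M a b i j\<close>.
\<close>

type_synonym label = "nat list"
type_synonym 'r mat = "label \<Rightarrow> label \<Rightarrow> label \<Rightarrow> label \<Rightarrow> 'r"

definition labels :: "nat list \<Rightarrow> label set" where
  "labels eps = {m. length m = length eps \<and> (\<forall>k<length eps. eps ! k = 1 \<longrightarrow> m ! k \<le> 1)}"

text \<open>
  Matrix elements of $S^{\mathrm{tr}}(z)$ and $S^{s,t}(z)$ as formal power series in \<open>z\<close>, with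
  normalization factor \<open>rho\<close>. The summation variables $(c_0,c_1,\ldots)$ form the list \<open>c\<close>; the
  coefficient of $z^m$ collects the terms with $c_0 = m$. By \<open>finite_support_tr\<close> and
  \<open>finite_support_st\<close> below only finitely many of these are nonzero.
\<close>

definition weight_tr :: "'k::field_char_0 \<Rightarrow> nat list \<Rightarrow> label \<Rightarrow> label \<Rightarrow> label \<Rightarrow> label \<Rightarrow> nat list \<Rightarrow> 'k" where
  "weight_tr q eps a b i j c =
     (let n = length eps in
      \<Prod>k<n. scrS q (eps ! k) (a ! k) (b ! k) (c ! k) (i ! k) (j ! k) (c ! (Suc k mod n)))"

definition S_tr :: "'k::field_char_0 \<Rightarrow> 'k fps \<Rightarrow> nat list \<Rightarrow> 'k fps mat" where
  "S_tr q rho eps a b i j =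
     rho * Abs_fps (\<lambda>m. Sum_any (\<lambda>c. weight_tr q eps a b i j c
                                   when length c = length eps \<and> c ! 0 = m))"

definition weight_st ::
  "'k::field_char_0 \<Rightarrow> nat \<Rightarrow> nat \<Rightarrow> nat list \<Rightarrow> label \<Rightarrow> label \<Rightarrow> label \<Rightarrow> label \<Rightarrow> nat list \<Rightarrow> 'k" where
  "weight_st q s t eps a b i j c =
     (let n = length eps;
          c' = (\<lambda>k. if k = 0 then s * c ! 0 else c ! k);
          c'' = (\<lambda>k. if k = n then t * c ! n else c ! k)
      in qpoch q 2 (s * c ! 0) / (qpoch q (s\<^sup>2) (c ! 0) * qpoch q (t\<^sup>2) (c ! n))
         * (\<Prod>k<n. scrS q (eps ! k) (a ! k) (b ! k) (c' k) (i ! k) (j ! k) (c'' (Suc k))))"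

definition S_st :: "'k::field_char_0 \<Rightarrow> 'k fps \<Rightarrow> nat \<Rightarrow> nat \<Rightarrow> nat list \<Rightarrow> 'k fps mat" where
  "S_st q rho s t eps a b i j =
     rho * Abs_fps (\<lambda>m. Sum_any (\<lambda>c. weight_st q s t eps a b i j c
                                   when length c = length eps + 1 \<and> c ! 0 = m))"


text \<open>
  The ring of power series in \<open>x\<close> and \<open>y\<close> is \<open>'k fps fps\<close>, with \<open>x\<close> the outer and \<open>y\<close> the inner
  indeterminate: \<open>x = fps_X\<close> and \<open>y = fps_const fps_X\<close>. The next three maps substitute
  \<open>x\<close>, \<open>y\<close> and \<open>x y\<close> for \<open>z\<close> in a power series in \<open>z\<close>.
\<close>

definition at_x :: "'k::field_char_0 fps \<Rightarrow> 'k fps fps" where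
  "at_x f = Abs_fps (\<lambda>m. fps_const (fps_nth f m))"

definition at_y :: "'k::field_char_0 fps \<Rightarrow> 'k fps fps" where
  "at_y f = fps_const f"

definition at_xy :: "'k::field_char_0 fps \<Rightarrow> 'k fps fps" where
  "at_xy f = Abs_fps (\<lambda>m. fps_const (fps_nth f m) * fps_X ^ m)"

definition subst_mat :: "('a \<Rightarrow> 'b) \<Rightarrow> 'a mat \<Rightarrow> 'b mat" where
  "subst_mat h M a b i j = h (M a b i j)"


text \<open>
  $\mathcal W\otimes\mathcal W\otimes\mathcal W$, with scalars extended to \<open>'r\<close>, is the free module
  on triples of labels: the finitely supported functions whose support lies in
  \<open>labels eps \<times> labels eps \<times> labels eps\<close>.
\<close>

type_synonym 'r vec3 = "(label \<times> label \<times> label) \<Rightarrow>\<^sub>0 'r"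

definition WWW :: "nat list \<Rightarrow> 'r::comm_ring_1 vec3 set" where
  "WWW eps = {v. Poly_Mapping.keys v \<subseteq> labels eps \<times> labels eps \<times> labels eps}"

text \<open>The linear map with prescribed values on the basis.\<close>

definition linext :: "('b \<Rightarrow> ('c \<Rightarrow>\<^sub>0 'r)) \<Rightarrow> ('b \<Rightarrow>\<^sub>0 'r::comm_ring_1) \<Rightarrow> ('c \<Rightarrow>\<^sub>0 'r)" where
  "linext T v = (\<Sum>b\<in>Poly_Mapping.keys v.
                   Poly_Mapping.map ((*) (Poly_Mapping.lookup v b)) (T b))"

text \<open>
  \<open>column eps M i j f\<close> is the sum of $M^{\mathbf a,\mathbf b}_{\mathbf i,\mathbf j}\,f(\mathbf a,\mathbf b)$ over
  all labels \<open>a\<close>, \<open>b\<close>, where \<open>f\<close> puts the labels into two of the three tensor factors. For the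
  matrices considered here this is a finite sum, see \<open>finite_column_tr\<close> and
  \<open>finite_column_st\<close>.
\<close>

definition column ::
  "nat list \<Rightarrow> 'r::comm_ring_1 mat \<Rightarrow> label \<Rightarrow> label \<Rightarrow>
   (label \<Rightarrow> label \<Rightarrow> label \<times> label \<times> label) \<Rightarrow> 'r vec3" where
  "column eps M i j f =
     Sum_any (\<lambda>(a, b). Poly_Mapping.single (f a b) (M a b i j)
                        when a \<in> labels eps \<and> b \<in> labels eps)"

definition act12 :: "nat list \<Rightarrow> 'r::comm_ring_1 mat \<Rightarrow> 'r vec3 \<Rightarrow> 'r vec3" where
  "act12 eps M = linext (\<lambda>(i, j, k). column eps M i j (\<lambda>a b. (a, b, k)))"

definition act13 :: "nat list \<Rightarrow> 'r::comm_ring_1 mat \<Rightarrow> 'r vec3 \<Rightarrow> 'r vec3" where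
  "act13 eps M = linext (\<lambda>(i, j, k). column eps M i k (\<lambda>a b. (a, j, b)))"

definition act23 :: "nat list \<Rightarrow> 'r::comm_ring_1 mat \<Rightarrow> 'r vec3 \<Rightarrow> 'r vec3" where
  "act23 eps M = linext (\<lambda>(i, j, k). column eps M j k (\<lambda>a b. (i, a, b)))"


lemma scrS_conservation:
  assumes "scrS q e a b c i j k \<noteq> 0"
  shows "a + b = i + j" "b + c = j + k"
  using assms by (auto simp: scrS_def scrS0_def scrS1_def split: if_splits)

lemma chain_bound:
  fixes b j f g :: "nat \<Rightarrow> nat"
  assumes "\<And>k. k < n \<Longrightarrow> b k + f k = j k + g k"
    and "\<And>k. Suc k < n \<Longrightarrow> g k = f (Suc k)"
    and "k < n"
  shows "g k \<le> f 0 + (\<Sum>l<n. b l)"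
proof -
  have "g k \<le> f 0 + (\<Sum>l<Suc k. b l)" using assms(3)
  proof (induction k)
    case 0
    then show ?case using assms(1)[of 0] by simp
  next
    case (Suc k)
    then show ?case using assms(1)[of "Suc k"] assms(2)[of k] by simp
  qed
  also have "(\<Sum>l<Suc k. b l) \<le> (\<Sum>l<n. b l)"
    using assms(3) by (intro sum_mono2) auto
  finally show ?thesis by simp
qed

lemma finite_bounded_lists: "finite {c :: nat list. length c = n \<and> (\<forall>k<n. c ! k \<le> N)}"
proof (rule finite_subset)
  show "{c :: nat list. length c = n \<and> (\<forall>k<n. c ! k \<le> N)} \<subseteq> {c. set c \<subseteq> {..N} \<and> length c = n}"
    by (auto simp: in_set_conv_nth)
  show "finite {c :: nat list. set c \<subseteq> {..N} \<and> length c = n}"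
    by (rule finite_lists_length_eq) simp
qed

lemma finite_support_tr:
  "finite {c. (weight_tr q eps a b i j c when length c = length eps \<and> c ! 0 = m) \<noteq> 0}"
proof (rule finite_subset)
  let ?n = "length eps"
  let ?N = "m + (\<Sum>l<?n. b ! l)"
  show "{c. (weight_tr q eps a b i j c when length c = ?n \<and> c ! 0 = m) \<noteq> 0}
          \<subseteq> {c. length c = ?n \<and> (\<forall>k<?n. c ! k \<le> ?N)}"
  proof safe
    fix c assume "(weight_tr q eps a b i j c when length c = ?n \<and> c ! 0 = m) \<noteq> 0"
    then have c: "length c = ?n" "c ! 0 = m" and w: "weight_tr q eps a b i j c \<noteq> 0"
      by (auto simp: when_def split: if_splits)
    show "length c = ?n" by fact
    have e: "b ! k + c ! k = j ! k + c ! (Suc k mod ?n)" if "k < ?n" for k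
      using w that by (auto simp: weight_tr_def Let_def dest: scrS_conservation(2))
    fix k assume k: "k < ?n"
    show "c ! k \<le> ?N"
    proof (cases k)
      case 0
      then show ?thesis using c by simp
    next
      case (Suc l)
      have "c ! (Suc l mod ?n) \<le> c ! 0 + (\<Sum>l<?n. b ! l)"
        by (rule chain_bound[where f = "\<lambda>k. c ! k" and g = "\<lambda>k. c ! (Suc k mod ?n)"])
           (use e k Suc in auto)
      then show ?thesis using Suc k c by simp
    qed
  qed
  show "finite {c :: nat list. length c = ?n \<and> (\<forall>k<?n. c ! k \<le> ?N)}"
    by (rule finite_bounded_lists)
qed

lemma finite_support_st:
  assumes "t > 0" and "eps \<noteq> []"
  shows "finite {c. (weight_st q s t eps a b i j c when length c = length eps + 1 \<and> c ! 0 = m) \<noteq> 0}"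
proof (rule finite_subset)
  let ?n = "length eps"
  let ?N = "m + s * m + (\<Sum>l<?n. b ! l)"
  show "{c. (weight_st q s t eps a b i j c when length c = ?n + 1 \<and> c ! 0 = m) \<noteq> 0}
          \<subseteq> {c. length c = ?n + 1 \<and> (\<forall>k<?n + 1. c ! k \<le> ?N)}"
  proof safe
    fix c assume "(weight_st q s t eps a b i j c when length c = ?n + 1 \<and> c ! 0 = m) \<noteq> 0"
    then have c: "length c = ?n + 1" "c ! 0 = m" and w: "weight_st q s t eps a b i j c \<noteq> 0"
      by (auto simp: when_def split: if_splits)
    show "length c = ?n + 1" by fact
    define f where "f k = (if k = 0 then s * c ! 0 else c ! k)" for k
    define g where "g k = (if Suc k = ?n then t * c ! ?n else c ! Suc k)" for k
    have e: "b ! k + f k = j ! k + g k" if "k < ?n" for k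
    proof -
      have "scrS q (eps ! k) (a ! k) (b ! k) (f k) (i ! k) (j ! k) (g k) \<noteq> 0"
        using w that unfolding weight_st_def Let_def f_def g_def by auto
      then show ?thesis by (rule scrS_conservation)
    qed
    fix k assume k: "k < ?n + 1"
    show "c ! k \<le> ?N"
    proof (cases k)
      case 0
      then show ?thesis using c by simp
    next
      case (Suc l)
      have "g l \<le> f 0 + (\<Sum>l<?n. b ! l)"
        by (rule chain_bound[where j = "\<lambda>k. j ! k"]) (use e k Suc in \<open>auto simp: f_def g_def\<close>)
      moreover have "c ! k \<le> g l" using assms(1) Suc by (auto simp: g_def)
      moreover have "f 0 = s * m" using c by (simp add: f_def)
      ultimately show ?thesis by linarith
    qed
  qed
  show "finite {c :: nat list. length c = ?n + 1 \<and> (\<forall>k<?n + 1. c ! k \<le> ?N)}"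
    by (rule finite_bounded_lists)
qed

lemma finite_label_pairs:
  "finite {(a, b). a \<in> labels eps \<and> b \<in> labels eps \<and>
             (\<forall>k<length eps. a ! k + b ! k = i ! k + (j :: label) ! k)}"
proof (rule finite_subset)
  let ?n = "length eps"
  let ?B = "{c :: nat list. length c = ?n \<and> (\<forall>k<?n. c ! k \<le> (\<Sum>l<?n. i ! l + j ! l))}"
  show "finite (?B \<times> ?B)" using finite_bounded_lists by blast
  have "i ! k + j ! k \<le> (\<Sum>l<?n. i ! l + j ! l)" if "k < ?n" for k
    by (rule member_le_sum) (use that in auto)
  then have *: "x \<le> (\<Sum>l<?n. i ! l + j ! l)" if "k < ?n" "x \<le> i ! k + j ! k" for k x
    using that le_trans by blast
  show "{(a, b). a \<in> labels eps \<and> b \<in> labels eps \<and>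
             (\<forall>k<?n. a ! k + b ! k = i ! k + j ! k)} \<subseteq> ?B \<times> ?B"
    by (auto simp: labels_def intro!: *)
qed

lemma finite_column_tr:
  "finite {(a, b). a \<in> labels eps \<and> b \<in> labels eps \<and> S_tr q rho eps a b i j \<noteq> 0}"
proof (rule finite_subset[OF _ finite_label_pairs[of eps i j]], safe)
  fix a b k
  assume nz: "S_tr q rho eps a b i j \<noteq> 0" and k: "k < length eps"
  have "\<exists>c. weight_tr q eps a b i j c \<noteq> 0"
  proof (rule ccontr)
    assume "\<not> ?thesis"
    then have "S_tr q rho eps a b i j = 0" by (simp add: S_tr_def fps_zero_def[symmetric])
    then show False using nz by simp
  qed
  then obtain c where "weight_tr q eps a b i j c \<noteq> 0" ..
  then have "scrS q (eps ! k) (a ! k) (b ! k) (c ! k) (i ! k) (j ! k) (c ! (Suc k mod length eps)) \<noteq> 0"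
    using k by (auto simp: weight_tr_def Let_def)
  then show "a ! k + b ! k = i ! k + j ! k" by (rule scrS_conservation)
qed

lemma finite_column_st:
  "finite {(a, b). a \<in> labels eps \<and> b \<in> labels eps \<and> S_st q rho s t eps a b i j \<noteq> 0}"
proof (rule finite_subset[OF _ finite_label_pairs[of eps i j]], safe)
  fix a b k
  assume nz: "S_st q rho s t eps a b i j \<noteq> 0" and k: "k < length eps"
  have "\<exists>c. weight_st q s t eps a b i j c \<noteq> 0"
  proof (rule ccontr)
    assume "\<not> ?thesis"
    then have "S_st q rho s t eps a b i j = 0" by (simp add: S_st_def fps_zero_def[symmetric])
    then show False using nz by simp
  qed
  then obtain c where c: "weight_st q s t eps a b i j c \<noteq> 0" ..
  have "\<exists>c1 c2. scrS q (eps ! k) (a ! k) (b ! k) c1 (i ! k) (j ! k) c2 \<noteq> 0"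
    using c k unfolding weight_st_def Let_def by (metis (no_types, lifting) finite_lessThan
      lessThan_iff mult_zero_right prod_zero)
  then show "a ! k + b ! k = i ! k + j ! k" using scrS_conservation by blast
qed


lemma WWW_sum: "(\<And>x. x \<in> A \<Longrightarrow> f x \<in> WWW eps) \<Longrightarrow> sum f A \<in> WWW eps"
  by (induction A rule: infinite_finite_induct)
     (auto simp: WWW_def dest!: subsetD[OF keys_add])

lemma column_in_WWW:
  assumes "\<And>a b. a \<in> labels eps \<Longrightarrow> b \<in> labels eps \<Longrightarrow>
             f a b \<in> labels eps \<times> labels eps \<times> labels eps"
  shows "column eps M i j f \<in> WWW eps"
  unfolding column_def Sum_any.expand_set
proof (rule WWW_sum, clarify)
  fix a b
  show "(Poly_Mapping.single (f a b) (M a b i j) when a \<in> labels eps \<and> b \<in> labels eps) \<in> WWW eps"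
    using assms[of a b] by (simp add: WWW_def when_def)
qed

lemma linext_in_WWW:
  assumes "v \<in> WWW eps" "\<And>b. b \<in> labels eps \<times> labels eps \<times> labels eps \<Longrightarrow> T b \<in> WWW eps"
  shows "linext T v \<in> WWW eps"
  unfolding linext_def
proof (rule WWW_sum)
  fix b assume "b \<in> Poly_Mapping.keys v"
  then have "b \<in> labels eps \<times> labels eps \<times> labels eps" using assms(1) unfolding WWW_def by blast
  then have "T b \<in> WWW eps" by (rule assms(2))
  moreover have "Poly_Mapping.keys (Poly_Mapping.map ((*) r) (T b)) \<subseteq> Poly_Mapping.keys (T b)" for r
    by (auto simp: in_keys_iff map.rep_eq when_def)
  ultimately show "Poly_Mapping.map ((*) (Poly_Mapping.lookup v b)) (T b) \<in> WWW eps"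
    unfolding WWW_def by blast
qed

lemma act_in_WWW:
  assumes "v \<in> WWW eps"
  shows "act12 eps M v \<in> WWW eps" "act13 eps M v \<in> WWW eps" "act23 eps M v \<in> WWW eps"
  unfolding act12_def act13_def act23_def
  by (rule linext_in_WWW[OF assms], auto intro!: column_in_WWW)+

end

theory Submission
  imports Defs "HOL-Library.Function_Algebras"
begin

text \<open>
  The Yang--Baxter equation is the shadow of a three-dimensional one. Write \<open>R\<close> for the operator on
  \<open>F \<otimes> F \<otimes> F\<close> with matrix elements \<open>scrS0\<close>, and let \<open>S\<close> stand for either of the two three-body
  weights. They satisfy the tetrahedron equation
  \<open>S_124 S_135 S_236 R_456 = R_456 S_236 S_135 S_124\<close>, where \<open>1,2,3\<close> carry the spaces \<open>W\<close> of
  one site and \<open>4,5,6\<close> are auxiliary oscillators. A matrix element of \<open>S_12(x) S_13(xy) S_23(y)\<close> is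
  a product over the sites of the left-hand operators, closed up on the auxiliary spaces either by
  a trace or by two boundary vectors. Moving \<open>R_456\<close> through this product site by site reverses
  the order of the three factors at each site, and \<open>R_456\<close> itself disappears at the ends: it
  conserves \<open>c4 + c5\<close> and \<open>c5 + c6\<close>, which are the exponents of \<open>x\<close> and \<open>y\<close>; it is an involution
  (\<open>R_R\<close>), which settles the trace; and it fixes the boundary vectors (\<open>R_chi3\<close> on the right,
  \<open>bra_RD\<close> on the left), which settles the other case.

  Everything about \<open>R\<close> comes from its intertwining relations with the \<open>q\<close>-oscillator algebra, the
  two three-fold products of \<open>L\<close>-operators attached to the reduced words 121 and 212 of the longest
  permutation of three letters. Three of these relations say how \<open>R\<close> acts after a creation operator; they are
  recurrences of the explicit sum (\<open>scrS0_rec_i\<close>, \<open>scrS0_rec_j\<close>) and they determine \<open>R\<close>, because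
  \<open>G1\<close>, \<open>G2\<close>, \<open>G3\<close> generate the whole Fock space from the vacuum. Any further relation therefore
  follows from commutation relations and a check on the vacuum (\<open>intertwine\<close>). The same principle
  proves that \<open>R\<close> is an involution, that it is symmetric for the form in which \<open>|m>\<close> has norm
  \<open>(q^2)_m\<close> (\<open>R_sym\<close>), and, with six oscillators and six creation-type operators, the tetrahedron
  equation for four copies of \<open>R\<close> (\<open>RRRR\<close>). The tetrahedron equation with the six-vertex weight is
  the list of intertwining relations itself (\<open>site_1\<close>).

  Vectors are arbitrary functions on occupation numbers and not only finitely supported ones.
  All operators in use are row-finite, so that they act on such functions and are determined by
  their action on basis vectors (\<open>row_fin_eqI\<close>); this makes the boundary vectors,
  which have infinite support, legitimate arguments.
\<close>

section \<open>Recurrences of the oscillator weight\<close>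

locale q_fock =
  fixes q :: "'k::field_char_0"
  assumes generic: "generic q"
begin

lemma q_nz [simp]: "q \<noteq> 0"
  using generic by (simp add: generic_def)

lemma q_pow_ne_1: "m > 0 \<Longrightarrow> q ^ m \<noteq> 1"
  using generic by (simp add: generic_def)

lemma q_power_powi:
  "q ^ n * q powi z = q powi (int n + z)" "q powi z * q ^ n = q powi (int n + z)"
  by (simp_all add: power_int_add add.commute)

lemma qpoch_0 [simp]: "qpoch q a 0 = 1"
  by (simp add: qpoch_def)

lemma qpoch_Suc: "qpoch q a (Suc m) = qpoch q a m * (1 - q ^ (a * Suc m))"
  by (simp add: qpoch_def)

lemma qpoch_nz [simp]: "a > 0 \<Longrightarrow> qpoch q a m \<noteq> 0"
proof -
  assume "a > 0"
  then have "1 - q ^ (a * k) \<noteq> 0" if "k \<in> {1..m}" for k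
    using q_pow_ne_1[of "a * k"] that by auto
  then show ?thesis by (simp add: qpoch_def)
qed

lemma qbinom2_0 [simp]: "qbinom2 q m 0 = 1"
  by (simp add: qbinom2_def)

lemma qbinom2_0_left: "qbinom2 q 0 m = (if m = 0 then 1 else 0)"
  by (simp add: qbinom2_def)

lemma qbinom2_eq_0: "k > m \<Longrightarrow> qbinom2 q m k = 0"
  by (simp add: qbinom2_def)

lemma qbinom2_pascal:
  assumes "k \<le> m"
  shows "qbinom2 q (Suc m) (Suc k) = qbinom2 q m (Suc k) + q ^ (2 * (m - k)) * qbinom2 q m k"
proof (cases "k = m")
  case True
  then show ?thesis by (simp add: qbinom2_def)
next
  case False
  then obtain d where d: "m = Suc (k + d)" using assms
    by (metis add_Suc_right le_neq_implies_less less_imp_Suc_add)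
  have nz: "1 - q ^ (2 * Suc k) \<noteq> 0" "1 - q ^ (2 * Suc d) \<noteq> 0"
    using q_pow_ne_1[of "2 * Suc k"] q_pow_ne_1[of "2 * Suc d"] by auto
  define A where "A = q ^ (2 * Suc k)"
  define B where "B = q ^ (2 * Suc d)"
  have e: "q ^ (2 * Suc m) = A * B"
    by (simp add: A_def B_def d power_add[symmetric])
  have nz': "1 - A \<noteq> 0" "1 - B \<noteq> 0" using nz by (auto simp: A_def B_def)
  have mk: "Suc m - Suc k = Suc d" "m - Suc k = d" "m - k = Suc d" by (auto simp: d)
  have l: "Suc k \<le> Suc m" "Suc k \<le> m" "k \<le> m" using d by auto
  have p: "qpoch q 2 (Suc m) = qpoch q 2 m * (1 - A * B)" 
     "qpoch q 2 (Suc k) = qpoch q 2 k * (1 - A)" "qpoch q 2 (Suc d) = qpoch q 2 d * (1 - B)"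
    using qpoch_Suc[of 2 m] qpoch_Suc[of 2 k] qpoch_Suc[of 2 d] e by (auto simp: A_def B_def)
  have g: "P * (1 - A * B) / (K * (1 - A) * (D * (1 - B))) = P / (K * (1 - A) * D) + B * (P / (K * (D * (1 - B))))"
    if "K \<noteq> 0" "D \<noteq> 0" for P K D :: 'k
    using that nz' by (simp add: divide_simps) (simp add: algebra_simps)
  show ?thesis unfolding qbinom2_def mk using l p g[of "qpoch q 2 k" "qpoch q 2 d" "qpoch q 2 m"] qpoch_nz[of 2 k] qpoch_nz[of 2 d]
    by (simp only: B_def[symmetric] if_True zero_less_numeral not_False_eq_True)
qed

lemma scrS0_eq_0: "\<not> (a + b = i + j \<and> b + c = j + k) \<Longrightarrow> scrS0 q a b c i j k = 0"
  unfolding scrS0_def by (rule if_not_P)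

lemma scrS0_sum:
  assumes "a + b = i + j" "b + c = j + k"
  shows "scrS0 q a b c i j k = (\<Sum>m\<le>b. (-1) ^ (b - m)
     * q powi (int i * (int c - int j) + (int k + 1) * int (b - m) + int m * (int m - int k))
     * (qpoch q 2 (c + m) / qpoch q 2 c) * qbinom2 q i m * qbinom2 q j (b - m))"
proof -
  have "scrS0 q a b c i j k = (\<Sum>m\<in>{0..b}. (-1) ^ (b - m)
     * q powi (int i * (int c - int j) + (int k + 1) * int (b - m) + int (b - (b - m)) * (int (b - (b - m)) - int k))
     * (qpoch q 2 (c + (b - (b - m))) / qpoch q 2 c) * qbinom2 q i (b - (b - m)) * qbinom2 q j (b - m))"
    unfolding scrS0_def Let_def using assms
    by (subst sum.atLeastAtMost_rev) (simp add: atLeast0AtMost)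
  also have "\<dots> = (\<Sum>m\<in>{0..b}. (-1) ^ (b - m)
     * q powi (int i * (int c - int j) + (int k + 1) * int (b - m) + int m * (int m - int k))
     * (qpoch q 2 (c + m) / qpoch q 2 c) * qbinom2 q i m * qbinom2 q j (b - m))"
    by (rule sum.cong) (simp_all only: atLeastAtMost_iff diff_diff_cancel)
  finally show ?thesis unfolding atLeast0AtMost .
qed

lemma scrS0_0:
  "scrS0 q a b c 0 j k = (if a + b = j \<and> b + c = j + k then (-1) ^ b * q ^ ((k + 1) * b) * qbinom2 q j b else 0)"
proof (cases "a + b = j \<and> b + c = j + k")
  case True
  have "(\<Sum>m\<le>b. (-1) ^ (b - m)
     * q powi (int 0 * (int c - int j) + (int k + 1) * int (b - m) + int m * (int m - int k))
     * (qpoch q 2 (c + m) / qpoch q 2 c) * qbinom2 q 0 m * qbinom2 q j (b - m)) 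
   = (\<Sum>m\<le>b. if m = 0 then (-1) ^ b * q powi ((int k + 1) * int b) * qbinom2 q j b else 0)"
    by (rule sum.cong) (auto simp: qbinom2_0_left)
  also have "\<dots> = (-1) ^ b * q powi ((int k + 1) * int b) * qbinom2 q j b" by simp
  also have "(int k + 1) * int b = int ((k + 1) * b)" by (simp add: algebra_simps)
  finally show ?thesis using True by (simp add: scrS0_sum del: of_nat_mult of_nat_add)
next
  case False
  then show ?thesis by (auto simp: scrS0_def)
qed

lemma scrS0_00: "scrS0 q a b c 0 0 k = (if a = 0 \<and> b = 0 \<and> c = k then 1 else 0)"
  by (auto simp: scrS0_0)

text \<open>
  At \<open>i = 0\<close> only the term with \<open>\<mu> = 0\<close> survives, and this is the \<open>q\<close>-Pascal rule for the remaining
  binomial. In terms of the operator \<open>R\<close> it is the relation \<open>R_G2\<close> on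
  basis vectors that are empty in the first factor.
\<close>
lemma scrS0_rec_j:
  "scrS0 q a b c 0 (Suc j) k =
     (if a = 0 \<or> c = 0 then 0 else scrS0 q (a - 1) b (c - 1) 0 j k)
     - (if b = 0 then 0 else q ^ (1 + a + c) * scrS0 q a (b - 1) c 0 j k)"
proof (cases "a + b = Suc j \<and> b + c = Suc j + k")
  case True
  show ?thesis
  proof (cases b)
    case 0
    then show ?thesis using True by (auto simp: scrS0_0)
  next
    case (Suc d)
    have 1: "d \<le> j" "a = j - d" using True Suc by auto
    have 2: "c = a + k" using True by simp
    have e: "q ^ ((k + 1) * Suc d) * q ^ (2 * (j - d)) = q ^ (1 + a + c) * q ^ ((k + 1) * d)"
    proof -
      obtain e where "j = d + e" using 1 le_Suc_ex by blast
      then show ?thesis unfolding power_add[symmetric] using 1 2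
        by (intro arg_cong[where f = "(^) q"]) (simp add: algebra_simps)
    qed
    show ?thesis
    proof (cases "a = 0")
      case True
      then have "j = d" using 1 by simp
      then show ?thesis using True Suc 2 e
        by (simp add: scrS0_0 qbinom2_pascal qbinom2_eq_0 algebra_simps)
    next
      case False
      have "scrS0 q a b c 0 (Suc j) k = (-1) ^ Suc d * q ^ ((k + 1) * Suc d) * 
         (qbinom2 q j (Suc d) + q ^ (2 * (j - d)) * qbinom2 q j d)"
        using True Suc 1 by (simp add: scrS0_0 qbinom2_pascal del: power_Suc mult_Suc_right)
      also have "\<dots> = (-1) ^ Suc d * q ^ ((k + 1) * Suc d) * qbinom2 q j (Suc d)
         - (q ^ ((k + 1) * Suc d) * q ^ (2 * (j - d))) * (-1) ^ d * qbinom2 q j d"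
        by (simp add: algebra_simps del: mult_Suc_right)
      also note e
      finally show ?thesis using True Suc False 2
        by (simp add: scrS0_0 del: power_Suc mult_Suc_right power_add)
    qed
  qed
next
  case False
  then have "scrS0 q a b c 0 (Suc j) k = 0" by (intro scrS0_eq_0) simp
  moreover have "scrS0 q (a - 1) b (c - 1) 0 j k = 0" if "a \<noteq> 0" "c \<noteq> 0"
    using False that by (intro scrS0_eq_0) linarith
  moreover have "scrS0 q a (b - 1) c 0 j k = 0" if "b \<noteq> 0"
    using False that by (intro scrS0_eq_0) linarith
  ultimately show ?thesis by auto
qed

text \<open>
  The \<open>q\<close>-Pascal rule, applied to the binomial of \<open>Suc i\<close>, splits each term of the defining sum into
  one term of either sum on the right; the conservation laws make the powers of \<open>q\<close> agree.
\<close>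
lemma scrS0_rec_i:
  "q ^ j * scrS0 q a b c (Suc i) j k =
     (if a = 0 then 0 else q ^ c * scrS0 q (a - 1) b c i j k)
     + (if b = 0 then 0 else q ^ a * (1 - q ^ (2 * (c + 1))) * scrS0 q a (b - 1) (c + 1) i j k)"
proof (cases "a + b = Suc i + j \<and> b + c = j + k")
  case False
  then have "scrS0 q a b c (Suc i) j k = 0" by (intro scrS0_eq_0) simp
  moreover have "scrS0 q (a - 1) b c i j k = 0" if "a \<noteq> 0"
    using False that by (intro scrS0_eq_0) linarith
  moreover have "scrS0 q a (b - 1) (c + 1) i j k = 0" if "b \<noteq> 0"
    using False that by (intro scrS0_eq_0) linarith
  ultimately show ?thesis by auto
next
  case True
  let ?T = "\<lambda>i b c m. (-1) ^ (b - m)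
     * q powi (int i * (int c - int j) + (int k + 1) * int (b - m) + int m * (int m - int k))
     * (qpoch q 2 (c + m) / qpoch q 2 c) * qbinom2 q i m * qbinom2 q j (b - m)"
  have L: "scrS0 q a b c (Suc i) j k = (\<Sum>m\<le>b. ?T (Suc i) b c m)"
    using True by (subst scrS0_sum) auto
  have R1: "(if a = 0 then 0 else scrS0 q (a - 1) b c i j k) = (\<Sum>m\<le>b. ?T i b c m)"
  proof (cases "a = 0")
    case True
    \<comment> \<open>here the natural-number difference would falsify the sum formula, but both sides vanish\<close>
    then have "m > i \<or> b - m > j" if "m \<le> b" for m
      using \<open>a + b = Suc i + j \<and> b + c = j + k\<close> that by linarith
    then have "qbinom2 q i m * qbinom2 q j (b - m) = 0" if "m \<le> b" for m
      using that qbinom2_eq_0 by auto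
    then have "(\<Sum>m\<le>b. ?T i b c m) = 0"
      by (intro sum.neutral) (simp add: mult.assoc)
    then show ?thesis using True by simp
  next
    case False
    then show ?thesis using True by (subst scrS0_sum) auto
  qed
  have R2: "scrS0 q a d (c + 1) i j k = (\<Sum>m\<le>d. ?T i d (c + 1) m)" if "b = Suc d" for d
    using True that by (subst scrS0_sum) auto
  have t0: "q ^ j * ?T (Suc i) b c 0 = q ^ c * ?T i b c 0"
  proof -
    have "q ^ j * q powi (int (Suc i) * (int c - int j) + (int k + 1) * int b)
       = q ^ c * q powi (int i * (int c - int j) + (int k + 1) * int b)"
      unfolding q_power_powi by (rule arg_cong[where f = "(powi) q"]) (simp add: algebra_simps)
    then show ?thesis by simp
  qed
  have t1: "q ^ j * ?T (Suc i) (Suc d) c (Suc m) = q ^ c * ?T i (Suc d) c (Suc m)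
      + q ^ a * (1 - q ^ (2 * (c + 1))) * ?T i d (c + 1) m" if b: "b = Suc d" and m: "m \<le> d" for d m
  proof (cases "m \<le> i")
    case False
    then show ?thesis by (simp add: qbinom2_eq_0)
  next
    case le: True
    have 1: "q ^ j * q powi (int (Suc i) * (int c - int j) + (int k + 1) * int (d - m) + int (Suc m) * (int (Suc m) - int k))
       = q ^ c * q powi (int i * (int c - int j) + (int k + 1) * int (d - m) + int (Suc m) * (int (Suc m) - int k))"
      unfolding q_power_powi by (rule arg_cong[where f = "(powi) q"]) (simp add: algebra_simps)
    have ai: "int a = int i + int j - int d" using True b by simp
    have ck: "int c = int j + int k - int d - 1" using True b by simp
    have 2: "q ^ j * q powi (int (Suc i) * (int c - int j) + (int k + 1) * int (d - m) + int (Suc m) * (int (Suc m) - int k)) * q ^ (2 * (i - m))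
       = q ^ a * q powi (int i * (int (c + 1) - int j) + (int k + 1) * int (d - m) + int m * (int m - int k))"
      unfolding q_power_powi using le ai ck
      by (intro arg_cong[where f = "(powi) q"]) (simp add: of_nat_diff algebra_simps)
    have pc: "(1 - q ^ (2 * (c + 1))) * (qpoch q 2 (c + 1 + m) / qpoch q 2 (c + 1)) = qpoch q 2 (c + Suc m) / qpoch q 2 c"
    proof -
      define w where "w = 1 - q ^ (2 * (c + 1))"
      have "w \<noteq> 0" "qpoch q 2 (c + 1) = qpoch q 2 c * w" 
        using q_pow_ne_1[of "2 * (c + 1)"] qpoch_Suc[of 2 c] by (auto simp: w_def)
      then show ?thesis unfolding w_def[symmetric] by simp
    qed
    have alg: "qj * (s * E1 * pq * (B1 + u * B2) * Bj) = qc * (s * E2 * pq * B1 * Bj) + qa * w * (s * E3 * pr * B2 * Bj)"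
      if "qj * E1 = qc * E2" "qj * E1 * u = qa * E3" "w * pr = pq" for qj s E1 pq B1 u B2 Bj qc E2 qa w E3 pr :: 'k
    proof -
      have "qj * (s * E1 * pq * (B1 + u * B2) * Bj) = (qj * E1) * s * pq * B1 * Bj + (qj * E1 * u) * s * pq * B2 * Bj"
        by (simp add: algebra_simps)
      also have "\<dots> = (qc * E2) * s * pq * B1 * Bj + (qa * E3) * s * (w * pr) * B2 * Bj"
        using that by simp
      finally show ?thesis by (simp add: algebra_simps)
    qed
    show ?thesis unfolding diff_Suc_Suc qbinom2_pascal[OF le]
      by (rule alg[OF 1 2 pc])
  qed
  show ?thesis
  proof (cases b)
    case 0
    have "q ^ j * scrS0 q a b c (Suc i) j k = q ^ c * (\<Sum>m\<le>b. ?T i b c m)"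
      unfolding L using t0 by (simp only: 0 atMost_0 sum.insert_if finite.emptyI empty_iff if_False sum.empty add_0_right)
    also have "\<dots> = (if a = 0 then 0 else q ^ c * scrS0 q (a - 1) b c i j k)"
      unfolding R1[symmetric] by (cases "a = 0") auto
    finally show ?thesis by (simp only: 0 refl if_True add_0_right)
  next
    case (Suc d)
    have sp: "(\<Sum>m\<le>b. F m) = F 0 + (\<Sum>m\<le>d. F (Suc m))" for F :: "nat \<Rightarrow> 'k"
      unfolding Suc by (rule sum.atMost_Suc_shift)
    have "q ^ j * scrS0 q a b c (Suc i) j k = q ^ j * ?T (Suc i) b c 0 + (\<Sum>m\<le>d. q ^ j * ?T (Suc i) b c (Suc m))"
      unfolding L sp by (simp only: distrib_left sum_distrib_left)
    also have "\<dots> = q ^ c * ?T i b c 0 + (\<Sum>m\<le>d. q ^ c * ?T i b c (Suc m) + q ^ a * (1 - q ^ (2 * (c + 1))) * ?T i d (c + 1) m)"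
      unfolding t0 by (intro arg_cong2[where f="(+)"] sum.cong refl) (use t1[OF Suc] Suc in \<open>simp only: atMost_iff\<close>)
    also have "\<dots> = q ^ c * (\<Sum>m\<le>b. ?T i b c m) + q ^ a * (1 - q ^ (2 * (c + 1))) * scrS0 q a d (c + 1) i j k"
      unfolding R2[OF Suc] sp by (simp only: distrib_left sum_distrib_left sum.distrib add.assoc)
    finally show ?thesis unfolding R1[symmetric] using Suc by (cases "a = 0") auto
  qed
qed

end

section \<open>Oscillators and row-finite operators\<close>

type_synonym 'a vec = "(nat \<Rightarrow> nat) \<Rightarrow> 'a"

context q_fock begin

text \<open>
  A vector is a function of the occupation numbers at all positions. The operators \<open>ap p\<close>, \<open>am p\<close> and
  \<open>kk p\<close> are the \<open>q\<close>-oscillator generators (creation, annihilation, and \<open>q\<close> to the power of the number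
  operator) at position \<open>p\<close>, written as they act on coefficient functions, so creation shifts the
  argument down. \<open>R3\<close> reads its matrix elements along a row: by conservation one summation
  variable is left.
\<close>
definition sc :: "'k \<Rightarrow> 'k vec \<Rightarrow> 'k vec" where
  "sc r f = (\<lambda>\<sigma>. r * f \<sigma>)"

definition ap :: "nat \<Rightarrow> 'k vec \<Rightarrow> 'k vec" where
  "ap p f = (\<lambda>\<sigma>. if \<sigma> p = 0 then 0 else f (\<sigma>(p := \<sigma> p - 1)))"

definition am :: "nat \<Rightarrow> 'k vec \<Rightarrow> 'k vec" where
  "am p f = (\<lambda>\<sigma>. (1 - q ^ (2 * (\<sigma> p + 1))) * f (\<sigma>(p := \<sigma> p + 1)))"

definition kk :: "nat \<Rightarrow> 'k vec \<Rightarrow> 'k vec" where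
  "kk p f = (\<lambda>\<sigma>. q ^ \<sigma> p * f \<sigma>)"

definition delta :: "(nat \<Rightarrow> nat) \<Rightarrow> 'k vec" where
  "delta \<tau> = (\<lambda>\<sigma>. if \<sigma> = \<tau> then 1 else 0)"

definition R3 :: "nat \<Rightarrow> nat \<Rightarrow> nat \<Rightarrow> 'k vec \<Rightarrow> 'k vec" where
  "R3 x y z f = (\<lambda>\<sigma>. \<Sum>j\<le>\<sigma> y + min (\<sigma> x) (\<sigma> z).
     scrS0 q (\<sigma> x) (\<sigma> y) (\<sigma> z) (\<sigma> x + \<sigma> y - j) j (\<sigma> y + \<sigma> z - j)
       * f (\<sigma>(x := \<sigma> x + \<sigma> y - j, y := j, z := \<sigma> y + \<sigma> z - j)))"

named_theorems lin

lemma sc_lin [lin]: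
  "sc r (f + g) = sc r f + sc r g" "sc r (f - g) = sc r f - sc r g" "sc r 0 = 0" "sc r (sc s f) = sc (r * s) f"
  "sc 1 f = f" "sc r (- f) = - sc r f"
  by (auto simp: sc_def algebra_simps fun_eq_iff)

lemma ap_lin [lin]:
  "ap p (f + g) = ap p f + ap p g" "ap p (f - g) = ap p f - ap p g" "ap p (sc r f) = sc r (ap p f)" "ap p 0 = 0"
  by (auto simp: sc_def ap_def algebra_simps fun_eq_iff)

lemma am_lin [lin]:
  "am p (f + g) = am p f + am p g" "am p (f - g) = am p f - am p g" "am p (sc r f) = sc r (am p f)" "am p 0 = 0"
  by (auto simp: sc_def am_def algebra_simps fun_eq_iff)

lemma kk_lin [lin]:
  "kk p (f + g) = kk p f + kk p g" "kk p (f - g) = kk p f - kk p g" "kk p (sc r f) = sc r (kk p f)" "kk p 0 = 0"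
  by (auto simp: sc_def kk_def algebra_simps fun_eq_iff)

lemma R3_lin [lin]:
  "R3 x y z (f + g) = R3 x y z f + R3 x y z g" "R3 x y z (f - g) = R3 x y z f - R3 x y z g"
  "R3 x y z (sc r f) = sc r (R3 x y z f)" "R3 x y z 0 = 0"
  by (auto simp: sc_def R3_def algebra_simps fun_eq_iff sum.distrib sum_subtractf sum_distrib_left intro!: sum.cong)

text \<open>
  Together with \<open>kk_kk\<close> and \<open>osc_comm\<close> these rewrite every word in the generators to a normal form
  in which \<open>kk\<close> stands left of \<open>ap\<close>, and \<open>ap\<close> left of \<open>am\<close>, with no square of \<open>kk\<close>; identities between
  words are decided in this way.
\<close>
lemma osc_same:
  "ap p (kk p f) = sc (1 / q) (kk p (ap p f))"
  "am p (kk p f) = sc q (kk p (am p f))"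
  "am p (ap p f) = ap p (am p f) + sc (1 - q\<^sup>2) (kk p (kk p f))"
  by (auto simp: sc_def ap_def am_def kk_def fun_eq_iff algebra_simps power2_eq_square power_add
     power_Suc2[symmetric] split: if_splits) (auto simp: gr0_conv_Suc algebra_simps power_add mult_2_right power2_eq_square)

lemma kk_kk: "kk p (kk p f) = f - ap p (am p f)"
  by (auto simp: sc_def ap_def am_def kk_def fun_eq_iff algebra_simps power2_eq_square power_add
     split: if_splits) (auto simp: gr0_conv_Suc algebra_simps power_add mult_2_right power2_eq_square)

lemma osc_comm:
  "ap p (ap r f) = ap r (ap p f)"
  "kk p (kk r f) = kk r (kk p f)"
  "am p (am r f) = am r (am p f)"
  "p \<noteq> r \<Longrightarrow> ap p (kk r f) = kk r (ap p f)"
  "p \<noteq> r \<Longrightarrow> am p (kk r f) = kk r (am p f)"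
  "p \<noteq> r \<Longrightarrow> am p (ap r f) = ap r (am p f)"
  by (cases "p = r"; auto simp: ap_def am_def kk_def fun_eq_iff fun_upd_twist algebra_simps)+

lemmas osc = osc_same kk_kk osc_comm

text \<open>
  Each coefficient of the image is a finite linear combination of coefficients of the argument. For a
  linear operator this is continuity for pointwise convergence with discrete scalars.
\<close>
definition row_fin :: "('k vec \<Rightarrow> 'k vec) \<Rightarrow> bool" where
  "row_fin X \<longleftrightarrow> (\<forall>\<sigma>. \<exists>S K. finite S \<and> (\<forall>f. X f \<sigma> = (\<Sum>\<tau>\<in>S. K \<tau> * f \<tau>)))"

lemma row_finI:
  assumes "\<And>\<sigma>. \<exists>J c h. finite (J :: nat set) \<and> (\<forall>f. X f \<sigma> = (\<Sum>j\<in>J. c j * f (h j)))"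
  shows "row_fin X"
  unfolding row_fin_def
proof
  fix \<sigma>
  obtain J c h where J: "finite (J :: nat set)" and X: "\<And>f. X f \<sigma> = (\<Sum>j\<in>J. c j * f (h j))"
    using assms by meson
  have "X f \<sigma> = (\<Sum>\<tau>\<in>h ` J. (\<Sum>j | j \<in> J \<and> h j = \<tau>. c j) * f \<tau>)" for f
    unfolding X sum.image_gen[OF J, of _ h] by (auto simp: sum_distrib_right intro!: sum.cong)
  then show "\<exists>S K. finite S \<and> (\<forall>f. X f \<sigma> = (\<Sum>\<tau>\<in>S. K \<tau> * f \<tau>))"
    using J by (intro exI[of _ "h ` J"] exI[of _ "\<lambda>\<tau>. \<Sum>j | j \<in> J \<and> h j = \<tau>. c j"]) auto
qed

lemma row_fin_delta:
  assumes "row_fin X"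
  shows "\<exists>S. finite S \<and> (\<forall>T f. finite T \<longrightarrow> S \<subseteq> T \<longrightarrow> X f \<sigma> = (\<Sum>\<tau>\<in>T. X (delta \<tau>) \<sigma> * f \<tau>))"
proof -
  obtain S K where S: "finite S" and X: "\<And>f. X f \<sigma> = (\<Sum>\<tau>\<in>S. K \<tau> * f \<tau>)"
    using assms unfolding row_fin_def by meson
  have d: "X (delta \<tau>) \<sigma> = (if \<tau> \<in> S then K \<tau> else 0)" for \<tau>
  proof -
    have "X (delta \<tau>) \<sigma> = (\<Sum>\<tau>'\<in>S. if \<tau>' = \<tau> then K \<tau>' else 0)"
      unfolding X delta_def by (rule sum.cong) auto
    then show ?thesis using S by simp
  qed
  have "X f \<sigma> = (\<Sum>\<tau>\<in>T. X (delta \<tau>) \<sigma> * f \<tau>)" if "finite T" "S \<subseteq> T" for T f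
  proof -
    have "(\<Sum>\<tau>\<in>S. K \<tau> * f \<tau>) = (\<Sum>\<tau>\<in>T. X (delta \<tau>) \<sigma> * f \<tau>)"
      unfolding d using that by (intro sum.mono_neutral_cong_left) auto
    then show ?thesis using X[of f] by simp
  qed
  then show ?thesis using S by blast
qed

lemma row_fin_superset:
  assumes "row_fin X"
  shows "\<exists>S K. finite S \<and> (\<forall>T f. finite T \<longrightarrow> S \<subseteq> T \<longrightarrow> X f \<sigma> = (\<Sum>\<tau>\<in>T. K \<tau> * f \<tau>))"
proof -
  obtain S where "finite S \<and> (\<forall>T f. finite T \<longrightarrow> S \<subseteq> T \<longrightarrow> X f \<sigma> = (\<Sum>\<tau>\<in>T. X (delta \<tau>) \<sigma> * f \<tau>))"
    using row_fin_delta[OF assms, of \<sigma>] by (elim exE)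
  then show ?thesis by - (rule exI[of _ S], rule exI[of _ "\<lambda>\<tau>. X (delta \<tau>) \<sigma>"])
qed

text \<open>
  On the union of two finite supports both operators are given by their values on basis vectors.
\<close>
lemma row_fin_eqI:
  assumes "row_fin X" "row_fin Y" "\<And>\<tau>. X (delta \<tau>) = Y (delta \<tau>)"
  shows "X f = Y f"
proof
  fix \<sigma>
  obtain S where S: "finite S" "\<And>T f. finite T \<Longrightarrow> S \<subseteq> T \<Longrightarrow> X f \<sigma> = (\<Sum>\<tau>\<in>T. X (delta \<tau>) \<sigma> * f \<tau>)"
    using row_fin_delta[OF assms(1), of \<sigma>] by meson
  obtain S' where S': "finite S'" "\<And>T f. finite T \<Longrightarrow> S' \<subseteq> T \<Longrightarrow> Y f \<sigma> = (\<Sum>\<tau>\<in>T. Y (delta \<tau>) \<sigma> * f \<tau>)"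
    using row_fin_delta[OF assms(2), of \<sigma>] by meson
  show "X f \<sigma> = Y f \<sigma>"
    using S(2)[of "S \<union> S'" f] S'(2)[of "S \<union> S'" f] S(1) S'(1) by (simp only: assms(3) finite_Un Un_upper1 Un_upper2)
qed

lemma row_fin_comp:
  assumes "row_fin X" "row_fin Y"
  shows "row_fin (\<lambda>f. X (Y f))"
  unfolding row_fin_def
proof
  fix \<sigma>
  obtain S K where S: "finite S" and X: "\<And>f. X f \<sigma> = (\<Sum>\<tau>\<in>S. K \<tau> * f \<tau>)"
    using assms(1) unfolding row_fin_def by meson
  have "\<forall>\<tau>. \<exists>S K. finite S \<and> (\<forall>f. Y f \<tau> = (\<Sum>\<rho>\<in>S. K \<rho> * f \<rho>))"
    using assms(2) unfolding row_fin_def by blast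
  then obtain S' K' where S': "\<And>\<tau>. finite (S' \<tau>)" and Y: "\<And>\<tau> f. Y f \<tau> = (\<Sum>\<rho>\<in>S' \<tau>. K' \<tau> \<rho> * f \<rho>)"
    by metis
  let ?U = "\<Union>\<tau>\<in>S. S' \<tau>" and ?K = "\<lambda>\<rho>. \<Sum>\<tau>\<in>S. K \<tau> * (if \<rho> \<in> S' \<tau> then K' \<tau> \<rho> else 0)"
  have "X (Y f) \<sigma> = (\<Sum>\<rho>\<in>?U. ?K \<rho> * f \<rho>)" for f
  proof -
    have "X (Y f) \<sigma> = (\<Sum>\<tau>\<in>S. K \<tau> * (\<Sum>\<rho>\<in>?U. (if \<rho> \<in> S' \<tau> then K' \<tau> \<rho> else 0) * f \<rho>))"
      unfolding X Y using S S'
      by (intro sum.cong refl arg_cong2[where f = "(*)"] sum.mono_neutral_cong_left) auto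
    also have "\<dots> = (\<Sum>\<tau>\<in>S. \<Sum>\<rho>\<in>?U. K \<tau> * (if \<rho> \<in> S' \<tau> then K' \<tau> \<rho> else 0) * f \<rho>)"
      by (simp add: sum_distrib_left mult.assoc)
    finally show ?thesis by (subst (asm) sum.swap) (simp add: sum_distrib_right)
  qed
  then show "\<exists>S K. finite S \<and> (\<forall>f. X (Y f) \<sigma> = (\<Sum>\<tau>\<in>S. K \<tau> * f \<tau>))"
    using S S' by (intro exI[of _ ?U] exI[of _ ?K]) auto
qed

lemma row_fin_id: "row_fin (\<lambda>f. f)"
  by (rule row_finI, rule exI[of _ "{0}"], rule exI[of _ "\<lambda>_. 1"]) auto

lemma row_fin_sc: "row_fin X \<Longrightarrow> row_fin (\<lambda>f. sc r (X f))"
proof -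
  have "row_fin (sc r)"
    by (rule row_finI, rule exI[of _ "{0}"], rule exI[of _ "\<lambda>_. r"]) (auto simp: sc_def)
  then show "row_fin X \<Longrightarrow> row_fin (\<lambda>f. sc r (X f))" by (rule row_fin_comp)
qed

lemma row_fin_ap: "row_fin (ap p)"
proof (rule row_finI)
  fix \<sigma>
  show "\<exists>J c h. finite (J :: nat set) \<and> (\<forall>f. ap p f \<sigma> = (\<Sum>j\<in>J. c j * f (h j)))"
    by (rule exI[of _ "{0}"], rule exI[of _ "\<lambda>_. if \<sigma> p = 0 then 0 else 1"]) (auto simp: ap_def)
qed

lemma row_fin_am: "row_fin (am p)"
proof (rule row_finI)
  fix \<sigma>
  show "\<exists>J c h. finite (J :: nat set) \<and> (\<forall>f. am p f \<sigma> = (\<Sum>j\<in>J. c j * f (h j)))"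
    by (rule exI[of _ "{0}"], rule exI[of _ "\<lambda>_. 1 - q ^ (2 * (\<sigma> p + 1))"]) (auto simp: am_def)
qed

lemma row_fin_kk: "row_fin (kk p)"
proof (rule row_finI)
  fix \<sigma>
  show "\<exists>J c h. finite (J :: nat set) \<and> (\<forall>f. kk p f \<sigma> = (\<Sum>j\<in>J. c j * f (h j)))"
    by (rule exI[of _ "{0}"], rule exI[of _ "\<lambda>_. q ^ \<sigma> p"]) (auto simp: kk_def)
qed

lemma row_fin_R3: "row_fin (R3 x y z)"
proof (rule row_finI)
  fix \<sigma>
  show "\<exists>J c h. finite (J :: nat set) \<and> (\<forall>f. R3 x y z f \<sigma> = (\<Sum>j\<in>J. c j * f (h j)))"
    unfolding R3_def
    by (rule exI[of _ "{..\<sigma> y + min (\<sigma> x) (\<sigma> z)}"], 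
        rule exI[of _ "\<lambda>j. scrS0 q (\<sigma> x) (\<sigma> y) (\<sigma> z) (\<sigma> x + \<sigma> y - j) j (\<sigma> y + \<sigma> z - j)"],
        rule exI[of _ "\<lambda>j. \<sigma>(x := \<sigma> x + \<sigma> y - j, y := j, z := \<sigma> y + \<sigma> z - j)"]) simp
qed

lemma row_fin_add:
  assumes "row_fin X" "row_fin Y"
  shows "row_fin (\<lambda>f. X f + Y f)"
  unfolding row_fin_def
proof
  fix \<sigma>
  obtain S K where S: "finite S" "\<And>T f. finite T \<Longrightarrow> S \<subseteq> T \<Longrightarrow> X f \<sigma> = (\<Sum>\<tau>\<in>T. K \<tau> * f \<tau>)"
    using row_fin_superset[OF assms(1), of \<sigma>] by meson
  obtain S' K' where S': "finite S'" "\<And>T f. finite T \<Longrightarrow> S' \<subseteq> T \<Longrightarrow> Y f \<sigma> = (\<Sum>\<tau>\<in>T. K' \<tau> * f \<tau>)"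
    using row_fin_superset[OF assms(2), of \<sigma>] by meson
  have "(X f + Y f) \<sigma> = (\<Sum>\<tau>\<in>S \<union> S'. (K \<tau> + K' \<tau>) * f \<tau>)" for f
    using S(2)[of "S \<union> S'" f] S'(2)[of "S \<union> S'" f] S(1) S'(1)
    by (simp add: distrib_right sum.distrib)
  then show "\<exists>S K. finite S \<and> (\<forall>f. (X f + Y f) \<sigma> = (\<Sum>\<tau>\<in>S. K \<tau> * f \<tau>))"
    using S(1) S'(1) by (intro exI[of _ "S \<union> S'"] exI[of _ "\<lambda>\<tau>. K \<tau> + K' \<tau>"]) simp
qed

lemma row_fin_diff:
  assumes "row_fin X" "row_fin Y"
  shows "row_fin (\<lambda>f. X f - Y f)"
proof -
  have "row_fin (\<lambda>f. X f + sc (- 1) (Y f))" by (intro row_fin_add row_fin_sc assms)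
  also have "(\<lambda>f. X f + sc (- 1) (Y f)) = (\<lambda>f. X f - Y f)" by (auto simp: sc_def fun_eq_iff)
  finally show ?thesis .
qed

lemmas row_fin_intros = row_fin_id row_fin_sc row_fin_add row_fin_diff row_fin_comp[OF row_fin_ap] row_fin_comp[OF row_fin_am] row_fin_comp[OF row_fin_kk] row_fin_comp[OF row_fin_R3]

lemma row_fin_linear:
  assumes "row_fin X"
  shows "X (f + g) = X f + X g" "X (sc r f) = sc r (X f)" "X 0 = 0"
proof -
  have "X (f + g) \<sigma> = X f \<sigma> + X g \<sigma> \<and> X (sc r f) \<sigma> = sc r (X f) \<sigma> \<and> X 0 \<sigma> = 0" for \<sigma>
  proof -
    obtain S K where "\<And>f. X f \<sigma> = (\<Sum>\<tau>\<in>S. K \<tau> * f \<tau>)"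
      using assms unfolding row_fin_def by meson
    then show ?thesis by (simp add: sc_def algebra_simps sum.distrib sum_distrib_left)
  qed
  then show "X (f + g) = X f + X g" "X (sc r f) = sc r (X f)" "X 0 = 0"
    by (auto simp: fun_eq_iff)
qed

lemma ap_delta: "ap p (delta \<tau>) = delta (\<tau>(p := Suc (\<tau> p)))"
  by (auto simp: ap_def delta_def fun_eq_iff gr0_conv_Suc split: if_splits)

lemma kk_delta: "kk p (delta \<tau>) = sc (q ^ \<tau> p) (delta \<tau>)"
  by (auto simp: kk_def sc_def delta_def)

lemma am_delta_0: "\<tau> p = 0 \<Longrightarrow> am p (delta \<tau>) = 0"
  by (auto simp: am_def delta_def fun_eq_iff)

end

section \<open>Intertwining relations of the three-body operator\<close>

locale triple = q_fock q for q :: "'k::field_char_0" +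
  fixes x y z :: nat
  assumes dist [simp]: "x \<noteq> y" "y \<noteq> z" "x \<noteq> z" "y \<noteq> x" "z \<noteq> y" "z \<noteq> x"
begin

abbreviation "R \<equiv> R3 x y z"

text \<open>
  An unprimed operator and its primed partner are entries of the same place in the two products of
  three \<open>L\<close>-operators for the reduced words 121 and 212; \<open>R\<close> exchanges them in both directions. The \<open>G\<close>
  create on the vacuum, the \<open>D\<close> annihilate it, and \<open>E\<close> is the middle entry.
\<close>
definition "G1 f = kk y (ap x f)"
definition "G2 f = ap y f"
definition "G3 f = kk y (ap z f)"
definition "G1' f = kk z (ap x f) + kk x (ap y (am z f))"
definition "G2' f = ap x (ap z f) - sc q (kk x (kk z (ap y f)))"
definition "G3' f = kk x (ap z f) + kk z (ap y (am x f))"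

definition "D1 f = kk y (am x f)"
definition "D2 f = am y f"
definition "D3 f = kk y (am z f)"
definition "D1' f = kk z (am x f) + kk x (ap z (am y f))"
definition "D2' f = am x (am z f) - sc q (kk x (kk z (am y f)))"
definition "D3' f = kk x (am z f) + kk z (ap x (am y f))"
definition "E f = ap x (ap z (am y f)) - sc q (kk x (kk z f))"
definition "E' f = ap y (am x (am z f)) - sc q (kk x (kk z f))"

lemmas D_defs = D1_def D2_def D3_def D1'_def D2'_def D3'_def E_def E'_def

lemmas G_defs = G1_def G2_def G3_def G1'_def G2'_def G3'_def

lemma row_fin_G: "row_fin G1" "row_fin G2" "row_fin G3" "row_fin G1'" "row_fin G2'" "row_fin G3'" "row_fin R"
  unfolding G_defs[abs_def] by (intro row_fin_intros row_fin_R3)+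

lemma row_fin_D: "row_fin D1" "row_fin D2" "row_fin D3" "row_fin D1'" "row_fin D2'" "row_fin D3'" "row_fin E" "row_fin E'"
  unfolding D_defs[abs_def] by (intro row_fin_intros row_fin_R3)+

lemmas row_fin_rules = row_fin_G row_fin_G[THEN row_fin_comp] row_fin_intros

lemma R_delta:
  "R (delta \<tau>) \<sigma> = (if \<forall>p. p \<notin> {x, y, z} \<longrightarrow> \<sigma> p = \<tau> p
     then scrS0 q (\<sigma> x) (\<sigma> y) (\<sigma> z) (\<tau> x) (\<tau> y) (\<tau> z) else 0)"
proof (cases "(\<forall>p. p \<notin> {x, y, z} \<longrightarrow> \<sigma> p = \<tau> p) \<and> \<sigma> x + \<sigma> y = \<tau> x + \<tau> y \<and> \<sigma> y + \<sigma> z = \<tau> y + \<tau> z")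
  case True
  let ?u = "\<lambda>j. \<sigma>(x := \<sigma> x + \<sigma> y - j, y := j, z := \<sigma> y + \<sigma> z - j)"
  have "?u (\<tau> y) = \<tau>" using True by (auto simp: fun_eq_iff)
  moreover have "?u j \<noteq> \<tau>" if "j \<noteq> \<tau> y" for j
    using that by (metis dist(2) fun_upd_other fun_upd_same)
  ultimately have "delta \<tau> (?u j) = (if j = \<tau> y then 1 else 0)" for j
    by (auto simp: delta_def)
  moreover have "\<tau> y \<le> \<sigma> y + min (\<sigma> x) (\<sigma> z)" using True by linarith
  ultimately show ?thesis using True unfolding R3_def
    by (simp add: if_distrib[of "(*) _"] cong: if_cong)
next
  case False
  have "delta \<tau> (\<sigma>(x := \<sigma> x + \<sigma> y - j, y := j, z := \<sigma> y + \<sigma> z - j)) = 0" if "j \<le> \<sigma> y + min (\<sigma> x) (\<sigma> z)" for j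
  proof (rule ccontr)
    assume "delta \<tau> (\<sigma>(x := \<sigma> x + \<sigma> y - j, y := j, z := \<sigma> y + \<sigma> z - j)) \<noteq> 0"
    then have "\<tau> = \<sigma>(x := \<sigma> x + \<sigma> y - j, y := j, z := \<sigma> y + \<sigma> z - j)"
      by (auto simp: delta_def split: if_splits)
    then show False using False that by auto
  qed
  then have "R (delta \<tau>) \<sigma> = 0" unfolding R3_def by (intro sum.neutral) auto
  then show ?thesis using False scrS0_eq_0 by auto
qed

lemma R_K: "R (kk x (kk y f)) = kk x (kk y (R f))" "R (kk y (kk z f)) = kk y (kk z (R f))"
  by (auto simp: R3_def kk_def fun_eq_iff sum_distrib_left power_add[symmetric] intro!: sum.cong)

lemma R_vac: "\<tau> x = 0 \<Longrightarrow> \<tau> y = 0 \<Longrightarrow> R (delta \<tau>) = delta \<tau>"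
proof
  fix \<sigma> assume 0: "\<tau> x = 0" "\<tau> y = 0"
  define Q where "Q \<longleftrightarrow> (\<forall>p. p \<notin> {x, y, z} \<longrightarrow> \<sigma> p = \<tau> p)"
  have "\<sigma> = \<tau> \<longleftrightarrow> Q \<and> \<sigma> x = 0 \<and> \<sigma> y = 0 \<and> \<sigma> z = \<tau> z"
    unfolding Q_def using 0 by (auto simp: fun_eq_iff) metis
  then show "R (delta \<tau>) \<sigma> = delta \<tau> \<sigma>"
    unfolding R_delta Q_def[symmetric] 0 by (simp add: scrS0_00 delta_def)
qed

lemma G_delta:
  "G1 (delta \<tau>) = sc (q ^ \<tau> y) (delta (\<tau>(x := Suc (\<tau> x))))"
  "G2 (delta \<tau>) = delta (\<tau>(y := Suc (\<tau> y)))"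
  "G3 (delta \<tau>) = sc (q ^ \<tau> y) (delta (\<tau>(z := Suc (\<tau> z))))"
  by (auto simp: G_defs ap_delta kk_delta)

lemma delta_G:
  "delta (\<tau>(x := Suc (\<tau> x))) = sc (1 / q ^ \<tau> y) (G1 (delta \<tau>))"
  "delta (\<tau>(y := Suc (\<tau> y))) = G2 (delta \<tau>)"
  "delta (\<tau>(z := Suc (\<tau> z))) = sc (1 / q ^ \<tau> y) (G3 (delta \<tau>))"
  by (simp_all add: G_delta lin)

text \<open>
  Up to nonzero scalars \<open>G1\<close>, \<open>G2\<close>, \<open>G3\<close> map basis vectors to basis vectors, so a linear property of
  basis vectors need only be checked on vacua and propagated along the three creation steps.
\<close>
lemma creation_induct [case_names vac 1 2 3]:
  assumes "\<And>\<tau>. \<tau> x = 0 \<Longrightarrow> \<tau> y = 0 \<Longrightarrow> \<tau> z = 0 \<Longrightarrow> P \<tau>"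
    and "\<And>\<tau>. P \<tau> \<Longrightarrow> P (\<tau>(x := Suc (\<tau> x)))"
    and "\<And>\<tau>. P \<tau> \<Longrightarrow> P (\<tau>(y := Suc (\<tau> y)))"
    and "\<And>\<tau>. P \<tau> \<Longrightarrow> P (\<tau>(z := Suc (\<tau> z)))"
  shows "P \<tau>"
proof (induction "\<tau> x + \<tau> y + \<tau> z" arbitrary: \<tau>)
  case 0
  then show ?case using assms(1) by simp
next
  case (Suc n)
  have dec: "P \<tau>" if p: "p \<in> {x, y, z}" "\<tau> p \<noteq> 0" and st: "\<And>\<tau>. P \<tau> \<Longrightarrow> P (\<tau>(p := Suc (\<tau> p)))" for p
  proof -
    have "P (\<tau>(p := \<tau> p - 1))"
      by (rule Suc.hyps) (use Suc(2) p in auto)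
    from st[OF this] show ?thesis using p by simp
  qed
  from Suc(2) consider "\<tau> x \<noteq> 0" | "\<tau> y \<noteq> 0" | "\<tau> z \<noteq> 0" by linarith
  then show ?case by cases (use dec assms(2-4) in auto)
qed

lemma R_G1_delta: "R (G1 (delta \<tau>)) = G1' (R (delta \<tau>))"
proof
  fix \<sigma>
  show "R (G1 (delta \<tau>)) \<sigma> = G1' (R (delta \<tau>)) \<sigma>"
    unfolding G_delta lin sc_def[of _ "R _"] R_delta
    using scrS0_rec_i[of "\<tau> y" "\<sigma> x" "\<sigma> y" "\<sigma> z" "\<tau> x" "\<tau> z"]
    by (auto simp: G1'_def kk_def ap_def am_def R_delta)
qed

lemma R_G1: "R (G1 f) = G1' (R f)"
proof (rule row_fin_eqI[of "\<lambda>f. R (G1 f)" "\<lambda>f. G1' (R f)"])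
  show "row_fin (\<lambda>f. R (G1 f))" "row_fin (\<lambda>f. G1' (R f))" by (intro row_fin_rules)+
qed (rule R_G1_delta)

lemma A2_dl0: "\<tau> x = 0 \<Longrightarrow> R (G2 (delta \<tau>)) = G2' (R (delta \<tau>))"
proof
  fix \<sigma>
  assume "\<tau> x = 0"
  then show "R (G2 (delta \<tau>)) \<sigma> = G2' (R (delta \<tau>)) \<sigma>"
    unfolding G_delta R_delta
    using scrS0_rec_j[of "\<sigma> x" "\<sigma> y" "\<sigma> z" "\<tau> y" "\<tau> z"]
    by (auto simp: G2'_def kk_def ap_def sc_def R_delta power_add)
qed

lemma intertwine_step:
  assumes "\<And>f. R (G f) = G' (R f)" "row_fin X" "row_fin X'" "row_fin G'"
    and "\<And>f. X (G f) = sc \<alpha> (G (X f)) + Y f" "\<And>f. X' (G' f) = sc \<alpha> (G' (X' f)) + Y' f"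
    and "\<And>f. R (Y f) = Y' (R f)" "R (X f) = X' (R f)"
  shows "R (X (sc r (G f))) = X' (R (sc r (G f)))"
  by (simp only: row_fin_linear[OF assms(2)] row_fin_linear[OF assms(3)] row_fin_linear[OF assms(4)] R3_lin assms)

lemma R_sc0: "R (sc 0 f) = sc 0 (R f)"
  by (rule lin)

lemma sc_app [simp]: "sc r f \<sigma> = r * f \<sigma>"
  by (simp add: sc_def)

text \<open>
  Rules moving \<open>kk\<close> and \<open>am\<close> to the right, where a vacuum absorbs them.
\<close>
lemma osc_in:
  "kk p (ap p f) = sc q (ap p (kk p f))" "p \<noteq> r \<Longrightarrow> kk p (ap r f) = ap r (kk p f)"
  "am p (ap p f) = sc (q\<^sup>2) (ap p (am p f)) + sc (1 - q\<^sup>2) f" "p \<noteq> r \<Longrightarrow> am p (ap r f) = ap r (am p f)"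
  "ap p (ap r f) = ap r (ap p f)"
  by (rule ext, (simp add: lin osc; simp add: field_simps power2_eq_square))+

text \<open>
  The recurrence covers only vacua in the first factor. Since \<open>G1\<close> and \<open>G2\<close> commute up to a scalar, and
  so do their partners with the same scalar, the relation propagates along \<open>G1\<close>.
\<close>
lemma R_G2: "R (G2 f) = G2' (R f)"
proof (rule row_fin_eqI[of "\<lambda>f. R (G2 f)" "\<lambda>f. G2' (R f)"])
  show "row_fin (\<lambda>f. R (G2 f))" "row_fin (\<lambda>f. G2' (R f))" by (intro row_fin_rules)+
  have c: "G2 (G1 f) = sc (1 / q) (G1 (G2 f)) + sc 0 f" for f
    by (rule ext) (simp add: G_defs lin osc; simp add: field_simps power2_eq_square)
  have c': "G2' (G1' f) = sc (1 / q) (G1' (G2' f)) + sc 0 f" for f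
    by (rule ext) (simp add: G_defs lin osc; simp add: field_simps power2_eq_square)
  fix \<tau>
  show "R (G2 (delta \<tau>)) = G2' (R (delta \<tau>))"
  proof (induction "\<tau> x" arbitrary: \<tau>)
    case 0
    then show ?case by (simp add: A2_dl0)
  next
    case (Suc n)
    define \<rho> where "\<rho> = \<tau>(x := n)"
    have t: "\<tau> = \<rho>(x := Suc (\<rho> x))" using Suc by (simp add: \<rho>_def)
    have IH: "R (G2 (delta \<rho>)) = G2' (R (delta \<rho>))" using Suc(1)[of \<rho>] by (simp add: \<rho>_def)
    show ?case unfolding t delta_G
      by (rule intertwine_step[of G1 G1' G2 G2' "1 / q" "sc 0" "sc 0", OF R_G1 row_fin_G(2) row_fin_G(5) row_fin_G(4) c c' R_sc0 IH])
  qed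
qed

lemma R_G3: "R (G3 f) = G3' (R f)"
proof (rule row_fin_eqI[of "\<lambda>f. R (G3 f)" "\<lambda>f. G3' (R f)"])
  show "row_fin (\<lambda>f. R (G3 f))" "row_fin (\<lambda>f. G3' (R f))" by (intro row_fin_rules)+
  have c1: "G3 (G1 f) = sc 1 (G1 (G3 f)) + sc 0 f" for f
    by (rule ext) (simp add: G_defs lin osc; simp add: field_simps power2_eq_square)
  have c1': "G3' (G1' f) = sc 1 (G1' (G3' f)) + sc 0 f" for f
    by (rule ext) (simp add: G_defs lin osc; simp add: field_simps power2_eq_square)
  have c2: "G3 (G2 f) = sc q (G2 (G3 f)) + sc 0 f" for f
    by (rule ext) (simp add: G_defs lin osc; simp add: field_simps power2_eq_square)
  have c2': "G3' (G2' f) = sc q (G2' (G3' f)) + sc 0 f" for f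
    by (rule ext) (simp add: G_defs lin osc; simp add: field_simps power2_eq_square)
  fix \<tau>
  show "R (G3 (delta \<tau>)) = G3' (R (delta \<tau>))"
  proof (induction "\<tau> x + \<tau> y" arbitrary: \<tau>)
    case 0
    then have "R (delta \<tau>) = delta \<tau>" "R (G3 (delta \<tau>)) = G3 (delta \<tau>)"
      by (simp_all add: R_vac G_delta R3_lin)
    then show ?case using 0 by (simp add: G3_def G3'_def am_delta_0 kk_delta ap_delta lin)
  next
    case (Suc n)
    show ?case
    proof (cases "\<tau> x = 0")
      case False
      define \<rho> where "\<rho> = \<tau>(x := \<tau> x - 1)"
      have t: "\<tau> = \<rho>(x := Suc (\<rho> x))" using False by (simp add: \<rho>_def)
      have IH: "R (G3 (delta \<rho>)) = G3' (R (delta \<rho>))" using Suc(1)[of \<rho>] Suc(2) False by (simp add: \<rho>_def)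
      show ?thesis unfolding t delta_G
        by (rule intertwine_step[of G1 G1' G3 G3' 1 "sc 0" "sc 0", OF R_G1 row_fin_G(3) row_fin_G(6) row_fin_G(4) c1 c1' R_sc0 IH])
    next
      case True
      define \<rho> where "\<rho> = \<tau>(y := \<tau> y - 1)"
      have t: "\<tau> = \<rho>(y := Suc (\<rho> y))" using Suc True by (simp add: \<rho>_def)
      have IH: "R (G3 (delta \<rho>)) = G3' (R (delta \<rho>))" using Suc(1)[of \<rho>] Suc(2) True by (simp add: \<rho>_def)
      show ?thesis unfolding t delta_G
        using intertwine_step[of G2 G2' G3 G3' q "sc 0" "sc 0", OF R_G2 row_fin_G(3) row_fin_G(6) row_fin_G(5) c2 c2' R_sc0 IH, of 1]
        by (simp add: lin)
    qed
  qed
qed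

text \<open>
  Suppose \<open>X\<close> commutes with each creation generator up to a scalar and an operator \<open>Y\<close> that is already
  known to be intertwined, and \<open>X'\<close> does so with the primed generators and the same scalars. Then the
  relation between \<open>X\<close> and \<open>X'\<close> spreads from the vacuum to all basis vectors.
\<close>
lemma intertwine:
  assumes "row_fin X" "row_fin X'"
    and vac: "\<And>v. \<lbrakk>am x v = 0; am y v = 0; am z v = 0; kk x v = v; kk y v = v; kk z v = v; R v = v\<rbrakk>
      \<Longrightarrow> R (X v) = X' v"
    and 1: "\<And>f. X (G1 f) = sc a1 (G1 (X f)) + Y1 f" "\<And>f. X' (G1' f) = sc a1 (G1' (X' f)) + Y1' f"
      "\<And>f. R (Y1 f) = Y1' (R f)"
    and 2: "\<And>f. X (G2 f) = sc a2 (G2 (X f)) + Y2 f" "\<And>f. X' (G2' f) = sc a2 (G2' (X' f)) + Y2' f"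
      "\<And>f. R (Y2 f) = Y2' (R f)"
    and 3: "\<And>f. X (G3 f) = sc a3 (G3 (X f)) + Y3 f" "\<And>f. X' (G3' f) = sc a3 (G3' (X' f)) + Y3' f"
      "\<And>f. R (Y3 f) = Y3' (R f)"
  shows "R (X f) = X' (R f)"
proof (rule row_fin_eqI[of "\<lambda>f. R (X f)" "\<lambda>f. X' (R f)"])
  show "row_fin (\<lambda>f. R (X f))" by (rule row_fin_comp[OF row_fin_G(7) assms(1)])
  show "row_fin (\<lambda>f. X' (R f))" by (rule row_fin_comp[OF assms(2) row_fin_G(7)])
  show "R (X (delta \<tau>)) = X' (R (delta \<tau>))" for \<tau>
  proof (induction \<tau> rule: creation_induct)
    case (vac \<tau>)
    then have "R (delta \<tau>) = delta \<tau>" by (simp add: R_vac)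
    moreover have "R (X (delta \<tau>)) = X' (delta \<tau>)"
      by (rule assms(3)) (use vac in \<open>auto simp: am_delta_0 kk_delta R_vac lin\<close>)
    ultimately show ?case by simp
  next
    case (1 \<tau>)
    show ?case unfolding delta_G by (rule intertwine_step[of G1 G1' X X' a1 Y1 Y1', OF R_G1 assms(1,2) row_fin_G(4) assms(4,5,6) 1])
  next
    case (2 \<tau>)
    show ?case unfolding delta_G using intertwine_step[of G2 G2' X X' a2 Y2 Y2', OF R_G2 assms(1,2) row_fin_G(5) assms(7,8,9) 2, of 1] by (simp add: lin)
  next
    case (3 \<tau>)
    show ?case unfolding delta_G by (rule intertwine_step[of G3 G3' X X' a3 Y3 Y3', OF R_G3 assms(1,2) row_fin_G(6) assms(10,11,12) 3])
  qed
qed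

lemma R_G2': "R (G2' f) = G2 (R f)"
proof (rule intertwine[where X = G2' and X' = G2
    and ?a1.0 = "1" and ?a2.0 = "1" and ?a3.0 = "1" and ?Y1.0 = "sc 0" and ?Y2.0 = "sc 0" and ?Y3.0 = "sc 0" and ?Y1'.0 = "sc 0" and ?Y2'.0 = "sc 0" and ?Y3'.0 = "sc 0"])
  fix v
  assume v: "am x v = 0" "am y v = 0" "am z v = 0" "kk x v = v" "kk y v = v" "kk z v = v" "R v = v"
  have "G2' v = G1 (G3 v) - sc q (G2 v)"
    by (rule ext) (simp add: G_defs lin osc_in v; simp add: field_simps power2_eq_square)
  then have "R (G2' v) = G1' (G3' v) - sc q (G2' v)"
    by (simp add: lin R_G1 R_G2 R_G3 v)
  also have "\<dots> = G2 v"
    by (rule ext) (simp add: G_defs lin osc_in v; simp add: field_simps power2_eq_square)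
  finally show "R (G2' v) = G2 v" .
qed (rule row_fin_rules row_fin_D R_sc0 | (rule ext, (simp add: G_defs D_defs lin osc; simp add: field_simps power2_eq_square)))+

lemma R_Y:
  "R (sc r (kk x (kk y (G2 f)))) = sc r (kk x (kk y (G2' (R f))))"
  "R (sc r (kk y (kk z (G2 f)))) = sc r (kk y (kk z (G2' (R f))))"
  "R (sc r (kk x (kk y (kk x (kk y f))))) = sc r (kk x (kk y (kk x (kk y (R f)))))"
  "R (sc r (kk y (kk z (kk y (kk z f))))) = sc r (kk y (kk z (kk y (kk z (R f)))))"
  "R (sc r (G1 (G3 f))) = sc r (G1' (G3' (R f)))"
  "R (sc r f) = sc r (R f)"
  by (simp_all only: R3_lin R_K R_G1 R_G2 R_G3)

lemma R_G1': "R (G1' f) = G1 (R f)"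
proof (rule intertwine[where X = G1' and X' = G1
    and ?a1.0 = "1" and ?a2.0 = "1" and ?a3.0 = "q" and ?Y1.0 = "sc 0" and ?Y2.0 = "sc 0" and ?Y3.0 = "\<lambda>f. sc (1 / q - q) (kk x (kk y (G2 f)))" and ?Y1'.0 = "sc 0" and ?Y2'.0 = "sc 0" and ?Y3'.0 = "\<lambda>f. sc (1 / q - q) (kk x (kk y (G2' f)))"])
  fix v
  assume v: "am x v = 0" "am y v = 0" "am z v = 0" "kk x v = v" "kk y v = v" "kk z v = v" "R v = v"
  have "G1' v = G1 v"
    by (rule ext) (simp add: G_defs lin osc_in v)
  then have "R (G1' v) = G1' v"
    by (simp only: R_G1 v)
  also have "\<dots> = G1 v"
    by (rule ext) (simp add: G_defs lin osc_in v)
  finally show "R (G1' v) = G1 v" .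
qed (rule row_fin_rules row_fin_D R_sc0 R_Y | (rule ext, (simp add: G_defs D_defs lin osc; simp add: field_simps power2_eq_square)))+

lemma R_G3': "R (G3' f) = G3 (R f)"
proof (rule intertwine[where X = G3' and X' = G3
    and ?a1.0 = "q" and ?a2.0 = "1" and ?a3.0 = "1" and ?Y1.0 = "\<lambda>f. sc (1 / q - q) (kk y (kk z (G2 f)))" and ?Y2.0 = "sc 0" and ?Y3.0 = "sc 0" and ?Y1'.0 = "\<lambda>f. sc (1 / q - q) (kk y (kk z (G2' f)))" and ?Y2'.0 = "sc 0" and ?Y3'.0 = "sc 0"])
  fix v
  assume v: "am x v = 0" "am y v = 0" "am z v = 0" "kk x v = v" "kk y v = v" "kk z v = v" "R v = v"
  have "G3' v = G3 v"
    by (rule ext) (simp add: G_defs lin osc_in v)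
  then have "R (G3' v) = G3' v"
    by (simp only: R_G3 v)
  also have "\<dots> = G3 v"
    by (rule ext) (simp add: G_defs lin osc_in v)
  finally show "R (G3' v) = G3 v" .
qed (rule row_fin_rules row_fin_D R_sc0 R_Y | (rule ext, (simp add: G_defs D_defs lin osc; simp add: field_simps power2_eq_square)))+

text \<open>
  With \<open>R_G1\<close> and its companions, the relations in the reverse direction show that \<open>R\<close> composed with
  itself commutes with the creation generators; it fixes the vacuum.
\<close>
lemma R_R: "R (R f) = f"
proof (rule row_fin_eqI[of "\<lambda>f. R (R f)" "\<lambda>f. f"])
  show "row_fin (\<lambda>f. R (R f))" "row_fin (\<lambda>f. f)" by (intro row_fin_rules)+
  show "R (R (delta \<tau>)) = delta \<tau>" for \<tau>
    by (induction \<tau> rule: creation_induct) (simp add: R_vac, (simp only: delta_G R_G1 R_G2 R_G3 R_G1' R_G2' R_G3' R3_lin)+)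
qed

lemma R_D2: "R (D2 f) = D2' (R f)"
proof (rule intertwine[where X = D2 and X' = D2'
    and ?a1.0 = "q" and ?a2.0 = "q\<^sup>2" and ?a3.0 = "q" and ?Y1.0 = "sc 0" and ?Y2.0 = "sc (1 - q\<^sup>2)" and ?Y3.0 = "sc 0" and ?Y1'.0 = "sc 0" and ?Y2'.0 = "sc (1 - q\<^sup>2)" and ?Y3'.0 = "sc 0"])
  fix v
  assume v: "am x v = 0" "am y v = 0" "am z v = 0" "kk x v = v" "kk y v = v" "kk z v = v" "R v = v"
  have "D2 v = D2' v" "R (D2 v) = D2 v"
    by (simp_all add: G_defs D_defs v lin)
  then show "R (D2 v) = D2' v" by simp
qed (rule row_fin_rules row_fin_D R_sc0 R_Y | (rule ext, (simp add: G_defs D_defs lin osc; simp add: field_simps power2_eq_square)))+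

lemma R_D1: "R (D1 f) = D1' (R f)"
proof (rule intertwine[where X = D1 and X' = D1'
    and ?a1.0 = "1" and ?a2.0 = "q" and ?a3.0 = "1" and ?Y1.0 = "\<lambda>f. sc (1 - q\<^sup>2) (kk x (kk y (kk x (kk y f))))" and ?Y2.0 = "sc 0" and ?Y3.0 = "sc 0" and ?Y1'.0 = "\<lambda>f. sc (1 - q\<^sup>2) (kk x (kk y (kk x (kk y f))))" and ?Y2'.0 = "sc 0" and ?Y3'.0 = "sc 0"])
  fix v
  assume v: "am x v = 0" "am y v = 0" "am z v = 0" "kk x v = v" "kk y v = v" "kk z v = v" "R v = v"
  have "D1 v = D1' v" "R (D1 v) = D1 v"
    by (simp_all add: G_defs D_defs v lin)
  then show "R (D1 v) = D1' v" by simp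
qed (rule row_fin_rules row_fin_D R_sc0 R_Y | (rule ext, (simp add: G_defs D_defs lin osc; simp add: field_simps power2_eq_square)))+

lemma R_D3: "R (D3 f) = D3' (R f)"
proof (rule intertwine[where X = D3 and X' = D3'
    and ?a1.0 = "1" and ?a2.0 = "q" and ?a3.0 = "1" and ?Y1.0 = "sc 0" and ?Y2.0 = "sc 0" and ?Y3.0 = "\<lambda>f. sc (1 - q\<^sup>2) (kk y (kk z (kk y (kk z f))))" and ?Y1'.0 = "sc 0" and ?Y2'.0 = "sc 0" and ?Y3'.0 = "\<lambda>f. sc (1 - q\<^sup>2) (kk y (kk z (kk y (kk z f))))"])
  fix v
  assume v: "am x v = 0" "am y v = 0" "am z v = 0" "kk x v = v" "kk y v = v" "kk z v = v" "R v = v"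
  have "D3 v = D3' v" "R (D3 v) = D3 v"
    by (simp_all add: G_defs D_defs v lin)
  then show "R (D3 v) = D3' v" by simp
qed (rule row_fin_rules row_fin_D R_sc0 R_Y | (rule ext, (simp add: G_defs D_defs lin osc; simp add: field_simps power2_eq_square)))+

lemma E'_G2': "E' (G2' f) = sc 1 (G2' (E' f)) + sc (1 - q\<^sup>2) (G1' (G3' f))"
  by (simp only: G_defs D_defs lin osc dist simp_thms, rule ext, simp add: field_simps power2_eq_square)

lemma R_E: "R (E f) = E' (R f)"
proof (rule intertwine[where X = E and X' = E'
    and ?a1.0 = "q" and ?a2.0 = "1" and ?a3.0 = "q" and ?Y1.0 = "sc 0" and ?Y2.0 = "\<lambda>f. sc (1 - q\<^sup>2) (G1 (G3 f))" and ?Y3.0 = "sc 0" and ?Y1'.0 = "sc 0" and ?Y2'.0 = "\<lambda>f. sc (1 - q\<^sup>2) (G1' (G3' f))" and ?Y3'.0 = "sc 0"])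
  fix v
  assume v: "am x v = 0" "am y v = 0" "am z v = 0" "kk x v = v" "kk y v = v" "kk z v = v" "R v = v"
  have "E v = sc (- q) v" "E' v = sc (- q) v"
    by (rule ext, simp add: D_defs v lin)+
  then show "R (E v) = E' v" by (simp add: lin v)
qed (rule row_fin_rules row_fin_D R_sc0 R_Y E'_G2' | (rule ext, (simp add: G_defs D_defs lin osc; simp add: field_simps power2_eq_square)))+

text \<open>
  \<open>R\<close> is an involution, so each relation can be read backwards.
\<close>
lemma R_D_primed:
  "R (D1' f) = D1 (R f)" "R (D2' f) = D2 (R f)" "R (D3' f) = D3 (R f)" "R (E' f) = E (R f)"
  using R_D1[of "R f"] R_D2[of "R f"] R_D3[of "R f"] R_E[of "R f"] by (simp_all add: R_R) (metis R_R)+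

end

context triple
begin

section \<open>Symmetry and boundary vectors\<close>

definition "weight \<sigma> = qpoch q 2 (\<sigma> x) * qpoch q 2 (\<sigma> y) * qpoch q 2 (\<sigma> z)" for \<sigma> :: "nat \<Rightarrow> nat"

lemma weight_nz: "weight \<sigma> \<noteq> 0" by (simp add: weight_def)

lemma weight_Suc: "p \<in> {x, y, z} \<Longrightarrow> weight (\<sigma>(p := Suc (\<sigma> p))) = weight \<sigma> * (1 - q ^ (2 * (\<sigma> p + 1)))"
  by (auto simp: weight_def qpoch_Suc)

text \<open>
  The vector that represents a functional for the form in which \<open>|m>\<close> has norm \<open>(q^2)_m\<close>. For this
  form \<open>ap\<close> and \<open>am\<close> are adjoint and \<open>kk\<close> is self-adjoint.
\<close>
definition dual_vec :: "('k vec \<Rightarrow> 'k) \<Rightarrow> 'k vec" where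
  "dual_vec \<phi> \<sigma> = \<phi> (delta \<sigma>) / weight \<sigma>"

lemma dual_vec_kk: "(\<And>r f. \<phi> (sc r f) = r * \<phi> f) \<Longrightarrow> kk p (dual_vec \<phi>) = dual_vec (\<lambda>f. \<phi> (kk p f))"
  by (rule ext) (simp add: dual_vec_def kk_def[of _ "dual_vec _"] kk_delta)

lemma am_delta_Suc: "am p (delta (\<sigma>(p := Suc (\<sigma> p)))) = sc (1 - q ^ (2 * (\<sigma> p + 1))) (delta \<sigma>)"
  by (auto simp: am_def delta_def fun_eq_iff split: if_splits)

lemma one_minus_nz: "1 - q ^ (2 * (m + 1)) \<noteq> 0"
  using q_pow_ne_1[of "2 * (m + 1)"] by simp

lemma dual_vec_ap:
  assumes lin: "\<And>r f. \<phi> (sc r f) = r * \<phi> f" "\<phi> 0 = 0" and p: "p \<in> {x, y, z}"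
  shows "ap p (dual_vec \<phi>) = dual_vec (\<lambda>f. \<phi> (am p f))"
proof
  fix \<sigma>
  show "ap p (dual_vec \<phi>) \<sigma> = dual_vec (\<lambda>f. \<phi> (am p f)) \<sigma>"
  proof (cases "\<sigma> p")
    case 0
    then show ?thesis using lin by (simp add: ap_def dual_vec_def am_delta_0)
  next
    case (Suc m)
    define \<rho> where "\<rho> = \<sigma>(p := m)"
    have t: "\<sigma> = \<rho>(p := Suc (\<rho> p))" using Suc by (simp add: \<rho>_def fun_upd_idem)
    have "\<sigma>(p := \<sigma> p - 1) = \<rho>" using Suc by (simp add: \<rho>_def)
    then have "ap p (dual_vec \<phi>) \<sigma> = \<phi> (delta \<rho>) / weight \<rho>" using Suc by (simp add: ap_def dual_vec_def)
    also have "\<dots> = dual_vec (\<lambda>f. \<phi> (am p f)) \<sigma>"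
      unfolding dual_vec_def t am_delta_Suc weight_Suc[OF p] lin using one_minus_nz[of "\<rho> p"] by simp
    finally show ?thesis .
  qed
qed

lemma dual_vec_am:
  assumes p: "p \<in> {x, y, z}"
  shows "am p (dual_vec \<phi>) = dual_vec (\<lambda>f. \<phi> (ap p f))"
proof
  fix \<sigma>
  show "am p (dual_vec \<phi>) \<sigma> = dual_vec (\<lambda>f. \<phi> (ap p f)) \<sigma>"
    using one_minus_nz[of "\<sigma> p"] weight_Suc[OF p, of \<sigma>] by (simp add: am_def dual_vec_def ap_delta)
qed

lemma dual_vec_add: "dual_vec \<phi> + dual_vec \<psi> = dual_vec (\<lambda>f. \<phi> f + \<psi> f)"
  "dual_vec \<phi> - dual_vec \<psi> = dual_vec (\<lambda>f. \<phi> f - \<psi> f)" "sc r (dual_vec \<phi>) = dual_vec (\<lambda>f. r * \<phi> f)"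
  by (auto simp: dual_vec_def fun_eq_iff add_divide_distrib diff_divide_distrib)

lemma R_delta_vac:
  assumes "\<tau> x = 0" "\<tau> y = 0" "\<tau> z = 0"
  shows "R (delta \<sigma>) \<tau> = delta \<tau> \<sigma>"
proof -
  define Q where "Q \<longleftrightarrow> (\<forall>p. p \<notin> {x, y, z} \<longrightarrow> \<tau> p = \<sigma> p)"
  have *: "\<sigma> = \<tau> \<longleftrightarrow> Q \<and> \<sigma> x = 0 \<and> \<sigma> y = 0 \<and> \<sigma> z = 0"
    unfolding Q_def using assms by (auto simp: fun_eq_iff) metis
  show ?thesis
  proof (cases "\<sigma> x = 0 \<and> \<sigma> y = 0 \<and> \<sigma> z = 0")
    case True
    then show ?thesis unfolding R_delta Q_def[symmetric] assms using * by (simp add: scrS0_00 delta_def)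
  next
    case False
    then have "scrS0 q 0 0 0 (\<sigma> x) (\<sigma> y) (\<sigma> z) = 0" by (intro scrS0_eq_0) auto
    then show ?thesis unfolding R_delta Q_def[symmetric] assms using * False by (simp add: delta_def)
  qed
qed

lemma delta_same: "delta \<tau> \<tau> = 1" and delta_other: "\<sigma> \<noteq> \<tau> \<Longrightarrow> delta \<tau> \<sigma> = 0"
  by (auto simp: delta_def)

text \<open>
  The row of \<open>R\<close> at \<open>\<tau>\<close>, turned into a vector by the form, obeys the creation recursion of the column
  at \<open>\<tau>\<close>: the adjoints of \<open>G1'\<close>, \<open>G2'\<close>, \<open>G3'\<close> are \<open>D1'\<close>, \<open>D2'\<close>, \<open>D3'\<close>, which \<open>R\<close> turns into annihilation
  operators, and these read off the next row.
\<close>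
lemma R_sym: "weight \<sigma> * R (delta \<tau>) \<sigma> = weight \<tau> * R (delta \<sigma>) \<tau>"
proof -
  define \<phi> where "\<phi> \<tau> f = weight \<tau> * R f \<tau>" for \<tau> f
  have \<phi>_lin: "\<phi> \<tau> (f + g) = \<phi> \<tau> f + \<phi> \<tau> g" "\<phi> \<tau> (f - g) = \<phi> \<tau> f - \<phi> \<tau> g"
    "\<phi> \<tau> (sc r f) = r * \<phi> \<tau> f" "\<phi> \<tau> 0 = 0" for \<tau> f g r
    by (simp_all add: \<phi>_def lin algebra_simps)
  have \<phi>: "\<phi> (\<tau>(x := Suc (\<tau> x))) f = \<phi> \<tau> (D1' f) / q ^ \<tau> y"
    "\<phi> (\<tau>(y := Suc (\<tau> y))) f = \<phi> \<tau> (D2' f)"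
    "\<phi> (\<tau>(z := Suc (\<tau> z))) f = \<phi> \<tau> (D3' f) / q ^ \<tau> y" for \<tau> f
    unfolding \<phi>_def R_D_primed by (simp_all add: weight_Suc D_defs kk_def am_def mult.assoc)
  have "R (delta \<tau>) = dual_vec (\<phi> \<tau>)"
  proof (induction \<tau> rule: creation_induct)
    case (vac \<tau>)
    then have "dual_vec (\<phi> \<tau>) \<sigma> = delta \<tau> \<sigma>" for \<sigma>
      using weight_nz[of \<sigma>] by (cases "\<sigma> = \<tau>") (simp_all add: dual_vec_def \<phi>_def R_delta_vac delta_same delta_other)
    then show ?case using vac by (simp add: R_vac fun_eq_iff)
  next
    case (1 \<tau>)
    have "G1' (dual_vec (\<phi> \<tau>)) = dual_vec (\<lambda>f. \<phi> \<tau> (D1' f))"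
      by (simp add: G_defs D_defs dual_vec_ap dual_vec_am dual_vec_kk dual_vec_add \<phi>_lin lin osc_comm)
    then have "R (delta (\<tau>(x := Suc (\<tau> x)))) = sc (1 / q ^ \<tau> y) (dual_vec (\<lambda>f. \<phi> \<tau> (D1' f)))"
      by (simp only: delta_G R3_lin R_G1 1)
    also have "\<dots> = dual_vec (\<phi> (\<tau>(x := Suc (\<tau> x))))"
      by (rule ext) (simp add: dual_vec_def \<phi>)
    finally show ?case .
  next
    case (2 \<tau>)
    have "G2' (dual_vec (\<phi> \<tau>)) = dual_vec (\<lambda>f. \<phi> \<tau> (D2' f))"
      by (simp add: G_defs D_defs dual_vec_ap dual_vec_am dual_vec_kk dual_vec_add \<phi>_lin lin osc_comm)
    then have "R (delta (\<tau>(y := Suc (\<tau> y)))) = dual_vec (\<lambda>f. \<phi> \<tau> (D2' f))"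
      by (simp only: delta_G R3_lin R_G2 2)
    also have "\<dots> = dual_vec (\<phi> (\<tau>(y := Suc (\<tau> y))))"
      by (rule ext) (simp add: dual_vec_def \<phi>)
    finally show ?case .
  next
    case (3 \<tau>)
    have "G3' (dual_vec (\<phi> \<tau>)) = dual_vec (\<lambda>f. \<phi> \<tau> (D3' f))"
      by (simp add: G_defs D_defs dual_vec_ap dual_vec_am dual_vec_kk dual_vec_add \<phi>_lin lin osc_comm)
    then have "R (delta (\<tau>(z := Suc (\<tau> z)))) = sc (1 / q ^ \<tau> y) (dual_vec (\<lambda>f. \<phi> \<tau> (D3' f)))"
      by (simp only: delta_G R3_lin R_G3 3)
    also have "\<dots> = dual_vec (\<phi> (\<tau>(z := Suc (\<tau> z))))"
      by (rule ext) (simp add: dual_vec_def \<phi>)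
    finally show ?case .
  qed
  then show ?thesis using weight_nz[of \<sigma>] by (simp add: dual_vec_def \<phi>_def)
qed

end

context q_fock begin

text \<open>
  The boundary vector of the \<open>s,t\<close> weights: its \<open>t m\<close>-th coefficient is \<open>1 / (q^(t^2))_m\<close>.
\<close>
definition chi :: "nat \<Rightarrow> nat \<Rightarrow> 'k" where
  "chi t m = (if t dvd m then 1 / qpoch q (t\<^sup>2) (m div t) else 0)"

lemma chi_0 [simp]: "chi t 0 = 1" by (simp add: chi_def)

lemma chi_1: "chi (Suc 0) m = 1 / qpoch q (Suc 0) m" by (simp add: chi_def)

lemma chi_1_Suc: "chi (Suc 0) (Suc m) * (1 - q ^ Suc m) = chi (Suc 0) m"
  using q_pow_ne_1[of "Suc m"] by (simp add: chi_1 qpoch_Suc del: power_Suc)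

lemma chi_2_Suc: "chi 2 (m + 2) * (1 - q ^ (2 * (m + 2))) = chi 2 m"
proof (cases "even m")
  case True
  then obtain k where k: "m = 2 * k" by blast
  have e: "2 * (m + 2) = 4 * Suc k" using k by simp
  have "qpoch q 4 (Suc k) = qpoch q 4 k * (1 - q ^ (2 * (m + 2)))"
    using qpoch_Suc[of 4 k] by (simp only: e)
  moreover have "1 - q ^ (2 * (m + 2)) \<noteq> 0" using q_pow_ne_1[of "2 * (m + 2)"] by simp
  ultimately show ?thesis by (simp add: chi_def k)
qed (simp add: chi_def)

lemma chi_2_1: "chi 2 (Suc 0) = 0" by (simp add: chi_def)

end

context triple begin

definition chi3 :: "nat \<Rightarrow> 'k vec" where
  "chi3 t \<sigma> = chi t (\<sigma> x) * chi t (\<sigma> y) * chi t (\<sigma> z)"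

lemma R_at_vac: "\<sigma> x = 0 \<Longrightarrow> \<sigma> y = 0 \<Longrightarrow> \<sigma> z = 0 \<Longrightarrow> R f \<sigma> = f \<sigma>"
proof -
  assume "\<sigma> x = 0" "\<sigma> y = 0" "\<sigma> z = 0"
  moreover from this have "\<sigma>(x := 0, y := 0, z := 0) = \<sigma>" by auto
  ultimately show ?thesis by (simp add: R3_def scrS0_00)
qed

lemma chi3_1:
  assumes "p \<in> {x, y, z}"
  shows "ap p (chi3 1) = chi3 1 - kk p (chi3 1)" "am p (chi3 1) = chi3 1 + sc q (kk p (chi3 1))"
proof -
  have a: "chi (Suc 0) (m - Suc 0) = (1 - q ^ m) * chi (Suc 0) m" if "m > 0" for m
    using chi_1_Suc[of "m - 1"] that by (auto simp: mult.commute simp del: power_Suc)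
  have b: "(1 - q ^ (2 * (m + 1))) * chi 1 (m + 1) = (1 + q ^ Suc m) * chi 1 m" for m
  proof -
    have "1 - q ^ (2 * (m + 1)) = (1 - q ^ Suc m) * (1 + q ^ Suc m)"
      by (simp add: algebra_simps power_add[symmetric] mult_2_right)
    then show ?thesis using chi_1_Suc[of m] by (simp del: power_Suc add: mult_ac)
  qed
  show "ap p (chi3 1) = chi3 1 - kk p (chi3 1)"
  proof
    fix \<sigma>
    show "ap p (chi3 1) \<sigma> = (chi3 1 - kk p (chi3 1)) \<sigma>"
      using assms by (cases "\<sigma> p = 0") (auto simp: ap_def kk_def chi3_def a, simp_all add: algebra_simps)
  qed
  show "am p (chi3 1) = chi3 1 + sc q (kk p (chi3 1))"
  proof
    fix \<sigma>
    have "am p (chi3 1) \<sigma> = chi3 1 \<sigma> * (1 + q ^ Suc (\<sigma> p))"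
      using assms b[of "\<sigma> p"] by (auto simp: am_def chi3_def mult_ac)
    then show "am p (chi3 1) \<sigma> = (chi3 1 + sc q (kk p (chi3 1))) \<sigma>"
      by (simp add: kk_def algebra_simps)
  qed
qed

lemma chi3_2:
  assumes "p \<in> {x, y, z}"
  shows "am p (chi3 2) = ap p (chi3 2)"
proof
  fix \<sigma>
  have "(1 - q ^ (2 * (m + 1))) * chi 2 (m + 1) = (if m = 0 then 0 else chi 2 (m - 1))" for m
    using chi_2_Suc[of "m - 1"] by (cases m) (auto simp: chi_2_1 mult.commute)
  from this[of "\<sigma> p"] show "am p (chi3 2) \<sigma> = ap p (chi3 2) \<sigma>"
    using assms by (cases "\<sigma> p = 0") (auto simp: am_def ap_def chi3_def chi_2_1)
qed

text \<open>
  The first equation expresses \<open>f\<close> through smaller arguments unless the first two occupation numbers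
  vanish, and then the second equation does; the factors to divide by are \<open>1 - q^m\<close> with \<open>m > 0\<close>.
\<close>
lemma uniq1:
  assumes "\<And>\<sigma>. \<sigma> x = 0 \<Longrightarrow> \<sigma> y = 0 \<Longrightarrow> \<sigma> z = 0 \<Longrightarrow> f \<sigma> = 0"
    and 1: "G2' f + G1' f + kk x (kk y f) = f" and 3: "G2' f + G3' f + kk y (kk z f) = f"
  shows "f \<sigma> = 0"
proof (induction "2 * (\<sigma> x + \<sigma> y) + \<sigma> z" arbitrary: \<sigma> rule: less_induct)
  case less
  have nz: "m > 0 \<Longrightarrow> q ^ m * f \<sigma> = f \<sigma> \<Longrightarrow> f \<sigma> = 0" for m
    using q_pow_ne_1[of m] by simp
  consider "\<sigma> x + \<sigma> y \<noteq> 0" | "\<sigma> x = 0" "\<sigma> y = 0" "\<sigma> z \<noteq> 0" | "\<sigma> x = 0" "\<sigma> y = 0" "\<sigma> z = 0" by linarith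
  then show ?case
  proof cases
    case a: 1
    have "(G2' f + G1' f + kk x (kk y f)) \<sigma> = q ^ (\<sigma> x + \<sigma> y) * f \<sigma>"
      by (auto simp: G_defs ap_def am_def kk_def power_add less)
    then show ?thesis using nz[of "\<sigma> x + \<sigma> y"] a unfolding 1 by simp
  next
    case 2
    then have "(G2' f + G3' f + kk y (kk z f)) \<sigma> = q ^ (\<sigma> z) * f \<sigma>"
      by (auto simp: G_defs ap_def am_def kk_def power_add less)
    then show ?thesis using nz[of "\<sigma> z"] 2 unfolding 3 by simp
  qed (rule assms(1))
qed

lemma uniq2:
  assumes "\<And>\<sigma>. \<sigma> x = 0 \<Longrightarrow> \<sigma> y = 0 \<Longrightarrow> \<sigma> z = 0 \<Longrightarrow> f \<sigma> = 0"
    and "\<And>p. p \<in> {x, y, z} \<Longrightarrow> am p f = ap p f"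
  shows "f \<sigma> = 0"
proof (induction "\<sigma> x + \<sigma> y + \<sigma> z" arbitrary: \<sigma> rule: less_induct)
  case less
  have *: "f \<sigma> = 0" if p: "p \<in> {x, y, z}" "\<sigma> p \<noteq> 0" for p
  proof -
    obtain m where m: "\<sigma> p = Suc m" using p by (cases "\<sigma> p") auto
    define \<rho> where "\<rho> = \<sigma>(p := m)"
    have "am p f \<rho> = (1 - q ^ (2 * (\<rho> p + 1))) * f \<sigma>" using m by (simp add: am_def \<rho>_def fun_upd_idem)
    moreover have "ap p f \<rho> = 0" using p m less by (auto simp: ap_def \<rho>_def)
    ultimately show ?thesis using assms(2)[OF p(1)] one_minus_nz[of "\<rho> p"] by simp
  qed
  show ?case
    using *[of x] *[of y] *[of z] assms(1)[of \<sigma>] by fastforce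
qed

lemma kk_inj: "kk p f = kk p g \<Longrightarrow> f = g"
  by (auto simp: kk_def fun_eq_iff)

text \<open>
  For \<open>t = 1\<close> the relations \<open>a^+ chi = (1 - k) chi\<close> and \<open>a^- chi = (1 + q k) chi\<close> combine to two linear
  equations for \<open>chi3\<close> with intertwined operators only, the same for both words; for \<open>t = 2\<close> one has
  \<open>a^- chi = a^+ chi\<close>, which exchanges the \<open>D'\<close> with the \<open>G'\<close>. In both cases \<open>R chi3\<close> solves the same
  system, and the solution is fixed by its value on the vacuum.
\<close>
theorem R_chi3:
  assumes "t \<in> {1, 2}"
  shows "R (chi3 t) = chi3 t"
proof -
  define f where "f = R (chi3 t) - chi3 t"
  have vac: "\<And>\<sigma>. \<sigma> x = 0 \<Longrightarrow> \<sigma> y = 0 \<Longrightarrow> \<sigma> z = 0 \<Longrightarrow> f \<sigma> = 0"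
    by (simp add: f_def R_at_vac)
  have "f \<sigma> = 0" for \<sigma>
  proof (cases "t = 1")
    case True
    note X = chi3_1[of x, unfolded One_nat_def] chi3_1[of y, unfolded One_nat_def] chi3_1[of z, unfolded One_nat_def]
    \<comment> \<open>the terms with kk y cancel against those of G2, which leaves only conserved products of kk\<close>
    have "G2 (chi3 1) + G1 (chi3 1) + kk x (kk y (chi3 1)) = chi3 1" "G2 (chi3 1) + G3 (chi3 1) + kk y (kk z (chi3 1)) = chi3 1"
      by (simp_all add: G_defs X lin osc_comm)
    from this[THEN arg_cong[where f = R]]
    have 1: "G2' (R (chi3 1)) + G1' (R (chi3 1)) + kk x (kk y (R (chi3 1))) = R (chi3 1)"
        "G2' (R (chi3 1)) + G3' (R (chi3 1)) + kk y (kk z (R (chi3 1))) = R (chi3 1)"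
      by (simp_all add: lin R_G1 R_G2 R_G3 R_K)
    have 2: "G2' (chi3 1) + G1' (chi3 1) + kk x (kk y (chi3 1)) = chi3 1" "G2' (chi3 1) + G3' (chi3 1) + kk y (kk z (chi3 1)) = chi3 1"
      by (rule ext, (simp add: G_defs X lin osc_comm; simp add: algebra_simps))+
    have f: "f = R (chi3 1) - chi3 1" by (simp add: f_def True)
    have "G2' f + G1' f + kk x (kk y f) = (G2' (R (chi3 1)) + G1' (R (chi3 1)) + kk x (kk y (R (chi3 1))))
        - (G2' (chi3 1) + G1' (chi3 1) + kk x (kk y (chi3 1)))"
      "G2' f + G3' f + kk y (kk z f) = (G2' (R (chi3 1)) + G3' (R (chi3 1)) + kk y (kk z (R (chi3 1))))
        - (G2' (chi3 1) + G3' (chi3 1) + kk y (kk z (chi3 1)))"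
      unfolding f by (simp_all only: G_defs lin) (simp_all only: algebra_simps)
    then have "G2' f + G1' f + kk x (kk y f) = f" "G2' f + G3' f + kk y (kk z f) = f"
      by (simp_all only: 1 2 f)
    with vac show ?thesis by (rule uniq1)
  next
    case False
    then have t: "t = 2" using assms by simp
    note X = chi3_2[of x] chi3_2[of y] chi3_2[of z]
    have "D1' (chi3 2) = G1' (chi3 2)" "D2' (chi3 2) = G2' (chi3 2)" "D3' (chi3 2) = G3' (chi3 2)"
      by (simp_all add: G_defs D_defs X osc_comm)
    from this[THEN arg_cong[where f = R]]
    have "D1 (R (chi3 2)) = G1 (R (chi3 2))" "D2 (R (chi3 2)) = G2 (R (chi3 2))" "D3 (R (chi3 2)) = G3 (R (chi3 2))"
      by (simp_all only: R_D_primed R_G1' R_G2' R_G3')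
    then have "am p (R (chi3 2)) = ap p (R (chi3 2))" if "p \<in> {x, y, z}" for p
      using that by (auto simp: D_defs G_defs dest: kk_inj)
    then have "am p f = ap p f" if "p \<in> {x, y, z}" for p
      using that chi3_2[of p] by (simp add: f_def t lin)
    with vac show ?thesis by (rule uniq2)
  qed
  then show ?thesis by (auto simp: f_def fun_eq_iff)
qed

end

context q_fock begin

section \<open>The tetrahedron equation for four oscillator operators\<close>

lemma upd4:
  "p \<noteq> x \<Longrightarrow> p \<noteq> y \<Longrightarrow> p \<noteq> z \<Longrightarrow> \<sigma>(x := a, y := b, z := c, p := d) = \<sigma>(p := d, x := a, y := b, z := c)"
  by auto

lemma stage: "v = v' \<Longrightarrow> X v' = w \<Longrightarrow> X v = w"
  by simp

lemma R3_ap: "p \<noteq> x \<Longrightarrow> p \<noteq> y \<Longrightarrow> p \<noteq> z \<Longrightarrow> R3 x y z (ap p f) = ap p (R3 x y z f)"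
  by (rule ext) (auto simp: R3_def ap_def upd4)

lemma R3_am: "p \<noteq> x \<Longrightarrow> p \<noteq> y \<Longrightarrow> p \<noteq> z \<Longrightarrow> R3 x y z (am p f) = am p (R3 x y z f)"
  by (rule ext) (auto simp: R3_def am_def upd4 sum_distrib_left mult_ac)

lemma R3_kk: "p \<noteq> x \<Longrightarrow> p \<noteq> y \<Longrightarrow> p \<noteq> z \<Longrightarrow> R3 x y z (kk p f) = kk p (R3 x y z f)"
  by (rule ext) (auto simp: R3_def kk_def sum_distrib_left mult_ac)

lemmas R3_pass = R3_ap R3_am R3_kk

lemma triple_I: "x \<noteq> y \<Longrightarrow> y \<noteq> z \<Longrightarrow> x \<noteq> z \<Longrightarrow> triple q x y z"
  using q_fock_axioms by (simp add: triple_def triple_axioms_def)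

interpretation A: triple q 11 12 14 by (rule triple_I) auto
interpretation B: triple q 11 13 15 by (rule triple_I) auto
interpretation C: triple q 12 13 16 by (rule triple_I) auto
interpretation D: triple q 14 15 16 by (rule triple_I) auto

lemmas As = A.R_G1 A.R_G2 A.R_G3 A.R_D_primed A.R_E A.R_K
lemmas Bs = B.R_G1 B.R_G2 B.R_G3 B.R_D_primed B.R_E B.R_K
lemmas Cs = C.R_G1 C.R_G2 C.R_G3 C.R_D_primed C.R_E C.R_K
lemmas Ds = D.R_G1 D.R_G2 D.R_G3 D.R_D_primed D.R_E D.R_K

lemmas GD = A.G_defs A.D_defs B.G_defs B.D_defs C.G_defs C.D_defs D.G_defs D.D_defs

lemmas words = GD sc_lin ap_lin am_lin kk_lin R3_lin osc_comm

text \<open>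
  The spaces \<open>1,...,6\<close> of the tetrahedron equation are the positions \<open>11,...,16\<close>. Any six
  distinct positions would do.
\<close>
definition "RX f = R3 11 12 14 (R3 11 13 15 (R3 12 13 16 (R3 14 15 16 f)))"
definition "RY f = R3 14 15 16 (R3 12 13 16 (R3 11 13 15 (R3 11 12 14 f)))"

text \<open>
  The six operators in this and the following five lemmas are entries of the product of six
  \<open>L\<close>-operators for a reduced word of the longest permutation of four letters. Both sides of the
  tetrahedron equation carry such an entry to the entry for the opposite word. Each stage groups the current
  word into operators of one triple, with everything else commuting past the \<open>R\<close> of that triple, and
  then applies the intertwining relations.
\<close>
lemma RX_RY_create_11:
  assumes "RX f = RY f"
  shows "RX (kk 12 (kk 13 (ap 11 f))) = RY (kk 12 (kk 13 (ap 11 f)))"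
proof -
  define x1 where "x1 = R3 14 15 16 f"
  have xs0: "R3 14 15 16 (kk 12 (kk 13 (ap 11 f))) = kk 12 (kk 13 (ap 11 x1))"
    by (simp add: lin R3_pass Ds x1_def)
  define x2 where "x2 = R3 12 13 16 x1"
  have xs1: "R3 12 13 16 (kk 12 (kk 13 (ap 11 x1))) = ap 11 (kk 12 (kk 13 x2))"
    by (rule stage[of _ "ap 11 (kk 12 (kk 13 x1))" "R3 12 13 16"], rule ext, (simp add: words; simp add: algebra_simps), simp add: lin R3_pass Cs x2_def)
  define x3 where "x3 = R3 11 13 15 x2"
  have xs2: "R3 11 13 15 (ap 11 (kk 12 (kk 13 x2))) = kk 12 (B.G1' x3)"
    by (rule stage[of _ "kk 12 (B.G1 x2)" "R3 11 13 15"], rule ext, (simp add: words; simp add: algebra_simps), simp add: lin R3_pass Bs x3_def)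
  define x4 where "x4 = R3 11 12 14 x3"
  have xs3: "R3 11 12 14 (kk 12 (B.G1' x3)) = kk 15 (A.G1' x4) + ap 13 (am 15 (kk 11 (kk 12 x4)))"
    by (rule stage[of _ "kk 15 (A.G1 x3) + ap 13 (am 15 (kk 11 (kk 12 x3)))" "R3 11 12 14"], rule ext, (simp add: words; simp add: algebra_simps), simp add: lin R3_pass As x4_def)
  define y1 where "y1 = R3 11 12 14 f"
  have ys0: "R3 11 12 14 (kk 12 (kk 13 (ap 11 f))) = kk 13 (A.G1' y1)"
    by (rule stage[of _ "kk 13 (A.G1 f)" "R3 11 12 14"], rule ext, (simp add: words; simp add: algebra_simps), simp add: lin R3_pass As y1_def)
  define y2 where "y2 = R3 11 13 15 y1"
  have ys1: "R3 11 13 15 (kk 13 (A.G1' y1)) = kk 14 (B.G1' y2) + ap 12 (am 14 (kk 11 (kk 13 y2)))"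
    by (rule stage[of _ "kk 14 (B.G1 y1) + ap 12 (am 14 (kk 11 (kk 13 y1)))" "R3 11 13 15"], rule ext, (simp add: words; simp add: algebra_simps), simp add: lin R3_pass Bs y2_def)
  define y3 where "y3 = R3 12 13 16 y2"
  have ys2: "R3 12 13 16 (kk 14 (B.G1' y2) + ap 12 (am 14 (kk 11 (kk 13 y2)))) = kk 14 (kk 15 (ap 11 y3)) + kk 11 (kk 14 (am 15 (C.G2' y3))) + kk 11 (am 14 (C.G1' y3))"
    by (rule stage[of _ "kk 14 (kk 15 (ap 11 y2)) + kk 11 (kk 14 (am 15 (C.G2 y2))) + kk 11 (am 14 (C.G1 y2))" "R3 12 13 16"], rule ext, (simp add: words; simp add: algebra_simps), simp add: lin R3_pass Cs y3_def)
  define y4 where "y4 = R3 14 15 16 y3"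
  have ys3: "R3 14 15 16 (kk 14 (kk 15 (ap 11 y3)) + kk 11 (kk 14 (am 15 (C.G2' y3))) + kk 11 (am 14 (C.G1' y3))) = ap 11 (kk 14 (kk 15 y4)) + kk 11 (ap 12 (D.D1 y4)) + kk 11 (kk 12 (ap 13 (D.D2 y4)))"
    by (rule stage[of _ "ap 11 (kk 14 (kk 15 y3)) + kk 11 (ap 12 (D.D1' y3)) + kk 11 (kk 12 (ap 13 (D.D2' y3)))" "R3 14 15 16"], rule ext, (simp add: words; simp add: algebra_simps), simp add: lin R3_pass Ds y4_def)
  have e: "x4 = y4" using assms by (simp only: RX_def RY_def x1_def x2_def x3_def x4_def y1_def y2_def y3_def y4_def)
  have "RX (kk 12 (kk 13 (ap 11 f))) = kk 15 (A.G1' x4) + ap 13 (am 15 (kk 11 (kk 12 x4)))"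
    by (simp only: RX_def xs0 xs1 xs2 xs3)
  also have "\<dots> = ap 11 (kk 14 (kk 15 y4)) + kk 11 (ap 12 (D.D1 y4)) + kk 11 (kk 12 (ap 13 (D.D2 y4)))" unfolding e
    by (rule ext) (simp add: words; simp add: algebra_simps)
  also have "\<dots> = RY (kk 12 (kk 13 (ap 11 f)))"
    by (simp only: RY_def ys0 ys1 ys2 ys3)
  finally show ?thesis .
qed

lemma RX_RY_create_12:
  assumes "RX f = RY f"
  shows "RX (kk 13 (ap 12 f)) = RY (kk 13 (ap 12 f))"
proof -
  define x1 where "x1 = R3 14 15 16 f"
  have xs0: "R3 14 15 16 (kk 13 (ap 12 f)) = kk 13 (ap 12 x1)"
    by (simp add: lin R3_pass Ds x1_def)
  define x2 where "x2 = R3 12 13 16 x1"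
  have xs1: "R3 12 13 16 (kk 13 (ap 12 x1)) = C.G1' x2"
    by (rule stage[of _ "C.G1 x1" "R3 12 13 16"], rule ext, (simp add: words; simp add: algebra_simps), simp add: lin R3_pass Cs x2_def)
  define x3 where "x3 = R3 11 13 15 x2"
  have xs2: "R3 11 13 15 (C.G1' x2) = kk 16 (ap 12 x3) + kk 12 (am 16 (B.G2' x3))"
    by (rule stage[of _ "kk 16 (ap 12 x2) + kk 12 (am 16 (B.G2 x2))" "R3 11 13 15"], rule ext, (simp add: words; simp add: algebra_simps), simp add: lin R3_pass Bs x3_def)
  define x4 where "x4 = R3 11 12 14 x3"
  have xs3: "R3 11 12 14 (kk 16 (ap 12 x3) + kk 12 (am 16 (B.G2' x3))) = kk 16 (A.G2' x4) + ap 15 (am 16 (A.G1' x4)) + sc (- q) (kk 15 (ap 13 (am 16 (kk 11 (kk 12 x4)))))"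
    by (rule stage[of _ "kk 16 (A.G2 x3) + ap 15 (am 16 (A.G1 x3)) + sc (- q) (kk 15 (ap 13 (am 16 (kk 11 (kk 12 x3)))))" "R3 11 12 14"], rule ext, (simp add: words; simp add: algebra_simps), simp add: lin R3_pass As x4_def)
  define y1 where "y1 = R3 11 12 14 f"
  have ys0: "R3 11 12 14 (kk 13 (ap 12 f)) = kk 13 (A.G2' y1)"
    by (rule stage[of _ "kk 13 (A.G2 f)" "R3 11 12 14"], rule ext, (simp add: words; simp add: algebra_simps), simp add: lin R3_pass As y1_def)
  define y2 where "y2 = R3 11 13 15 y1"
  have ys1: "R3 11 13 15 (kk 13 (A.G2' y1)) = ap 14 (B.G1' y2) + sc (- q) (kk 14 (ap 12 (kk 11 (kk 13 y2))))"
    by (rule stage[of _ "ap 14 (B.G1 y1) + sc (- q) (kk 14 (ap 12 (kk 11 (kk 13 y1))))" "R3 11 13 15"], rule ext, (simp add: words; simp add: algebra_simps), simp add: lin R3_pass Bs y2_def)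
  define y3 where "y3 = R3 12 13 16 y2"
  have ys2: "R3 12 13 16 (ap 14 (B.G1' y2) + sc (- q) (kk 14 (ap 12 (kk 11 (kk 13 y2))))) = kk 15 (ap 11 (ap 14 y3)) + kk 11 (ap 14 (am 15 (C.G2' y3))) + sc (- q) (kk 11 (kk 14 (C.G1' y3)))"
    by (rule stage[of _ "kk 15 (ap 11 (ap 14 y2)) + kk 11 (ap 14 (am 15 (C.G2 y2))) + sc (- q) (kk 11 (kk 14 (C.G1 y2)))" "R3 12 13 16"], rule ext, (simp add: words; simp add: algebra_simps), simp add: lin R3_pass Cs y3_def)
  define y4 where "y4 = R3 14 15 16 y3"
  have ys3: "R3 14 15 16 (kk 15 (ap 11 (ap 14 y3)) + kk 11 (ap 14 (am 15 (C.G2' y3))) + sc (- q) (kk 11 (kk 14 (C.G1' y3)))) = ap 11 (D.G1' y4) + kk 11 (ap 12 (D.E' y4)) + sc (- q) (kk 11 (kk 12 (ap 13 (D.D3 y4))))"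
    by (rule stage[of _ "ap 11 (D.G1 y3) + kk 11 (ap 12 (D.E y3)) + sc (- q) (kk 11 (kk 12 (ap 13 (D.D3' y3))))" "R3 14 15 16"], rule ext, (simp add: words; simp add: algebra_simps), simp add: lin R3_pass Ds y4_def)
  have e: "x4 = y4" using assms by (simp only: RX_def RY_def x1_def x2_def x3_def x4_def y1_def y2_def y3_def y4_def)
  have "RX (kk 13 (ap 12 f)) = kk 16 (A.G2' x4) + ap 15 (am 16 (A.G1' x4)) + sc (- q) (kk 15 (ap 13 (am 16 (kk 11 (kk 12 x4)))))"
    by (simp only: RX_def xs0 xs1 xs2 xs3)
  also have "\<dots> = ap 11 (D.G1' y4) + kk 11 (ap 12 (D.E' y4)) + sc (- q) (kk 11 (kk 12 (ap 13 (D.D3 y4))))" unfolding e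
    by (rule ext) (simp add: words; simp add: algebra_simps)
  also have "\<dots> = RY (kk 13 (ap 12 f))"
    by (simp only: RY_def ys0 ys1 ys2 ys3)
  finally show ?thesis .
qed

lemma RX_RY_create_13:
  assumes "RX f = RY f"
  shows "RX (ap 13 f) = RY (ap 13 f)"
proof -
  define x1 where "x1 = R3 14 15 16 f"
  have xs0: "R3 14 15 16 (ap 13 f) = ap 13 x1"
    by (simp add: lin R3_pass Ds x1_def)
  define x2 where "x2 = R3 12 13 16 x1"
  have xs1: "R3 12 13 16 (ap 13 x1) = C.G2' x2"
    by (rule stage[of _ "C.G2 x1" "R3 12 13 16"], rule ext, (simp add: words; simp add: algebra_simps), simp add: lin R3_pass Cs x2_def)
  define x3 where "x3 = R3 11 13 15 x2"
  have xs2: "R3 11 13 15 (C.G2' x2) = ap 12 (ap 16 x3) + sc (- q) (kk 12 (kk 16 (B.G2' x3)))"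
    by (rule stage[of _ "ap 12 (ap 16 x2) + sc (- q) (kk 12 (kk 16 (B.G2 x2)))" "R3 11 13 15"], rule ext, (simp add: words; simp add: algebra_simps), simp add: lin R3_pass Bs x3_def)
  define x4 where "x4 = R3 11 12 14 x3"
  have xs3: "R3 11 12 14 (ap 12 (ap 16 x3) + sc (- q) (kk 12 (kk 16 (B.G2' x3)))) = ap 16 (A.G2' x4) + sc (- q) (kk 16 (ap 15 (A.G1' x4))) + sc (q * q) (kk 15 (kk 16 (ap 13 (kk 11 (kk 12 x4)))))"
    by (rule stage[of _ "ap 16 (A.G2 x3) + sc (- q) (kk 16 (ap 15 (A.G1 x3))) + sc (q * q) (kk 15 (kk 16 (ap 13 (kk 11 (kk 12 x3)))))" "R3 11 12 14"], rule ext, (simp add: words; simp add: algebra_simps), simp add: lin R3_pass As x4_def)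
  define y1 where "y1 = R3 11 12 14 f"
  have ys0: "R3 11 12 14 (ap 13 f) = ap 13 y1"
    by (simp add: lin R3_pass As y1_def)
  define y2 where "y2 = R3 11 13 15 y1"
  have ys1: "R3 11 13 15 (ap 13 y1) = B.G2' y2"
    by (rule stage[of _ "B.G2 y1" "R3 11 13 15"], rule ext, (simp add: words; simp add: algebra_simps), simp add: lin R3_pass Bs y2_def)
  define y3 where "y3 = R3 12 13 16 y2"
  have ys2: "R3 12 13 16 (B.G2' y2) = ap 11 (ap 15 y3) + sc (- q) (kk 11 (kk 15 (C.G2' y3)))"
    by (rule stage[of _ "ap 11 (ap 15 y2) + sc (- q) (kk 11 (kk 15 (C.G2 y2)))" "R3 12 13 16"], rule ext, (simp add: words; simp add: algebra_simps), simp add: lin R3_pass Cs y3_def)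
  define y4 where "y4 = R3 14 15 16 y3"
  have ys3: "R3 14 15 16 (ap 11 (ap 15 y3) + sc (- q) (kk 11 (kk 15 (C.G2' y3)))) = ap 11 (D.G2' y4) + sc (- q) (kk 11 (ap 12 (D.G3' y4))) + sc (q * q) (kk 11 (kk 12 (ap 13 (kk 15 (kk 16 y4)))))"
    by (rule stage[of _ "ap 11 (D.G2 y3) + sc (- q) (kk 11 (ap 12 (D.G3 y3))) + sc (q * q) (kk 11 (kk 12 (ap 13 (kk 15 (kk 16 y3)))))" "R3 14 15 16"], rule ext, (simp add: words; simp add: algebra_simps), simp add: lin R3_pass Ds y4_def)
  have e: "x4 = y4" using assms by (simp only: RX_def RY_def x1_def x2_def x3_def x4_def y1_def y2_def y3_def y4_def)
  have "RX (ap 13 f) = ap 16 (A.G2' x4) + sc (- q) (kk 16 (ap 15 (A.G1' x4))) + sc (q * q) (kk 15 (kk 16 (ap 13 (kk 11 (kk 12 x4)))))"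
    by (simp only: RX_def xs0 xs1 xs2 xs3)
  also have "\<dots> = ap 11 (D.G2' y4) + sc (- q) (kk 11 (ap 12 (D.G3' y4))) + sc (q * q) (kk 11 (kk 12 (ap 13 (kk 15 (kk 16 y4)))))" unfolding e
    by (rule ext) (simp add: words; simp add: algebra_simps)
  also have "\<dots> = RY (ap 13 f)"
    by (simp only: RY_def ys0 ys1 ys2 ys3)
  finally show ?thesis .
qed

lemma RX_RY_create_14:
  assumes "RX f = RY f"
  shows "RX (sc (- q) (kk 12 (kk 15 (ap 14 f))) + ap 12 (am 13 (ap 15 f))) = RY (sc (- q) (kk 12 (kk 15 (ap 14 f))) + ap 12 (am 13 (ap 15 f)))"
proof -
  define x1 where "x1 = R3 14 15 16 f"
  have xs0: "R3 14 15 16 (sc (- q) (kk 12 (kk 15 (ap 14 f))) + ap 12 (am 13 (ap 15 f))) = sc (- q) (kk 12 (D.G1' x1)) + ap 12 (am 13 (D.G2' x1))"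
    by (rule stage[of _ "sc (- q) (kk 12 (D.G1 f)) + ap 12 (am 13 (D.G2 f))" "R3 14 15 16"], rule ext, (simp add: words; simp add: algebra_simps), simp add: lin R3_pass Ds x1_def)
  define x2 where "x2 = R3 12 13 16 x1"
  have xs1: "R3 12 13 16 (sc (- q) (kk 12 (D.G1' x1)) + ap 12 (am 13 (D.G2' x1))) = ap 14 (C.E' x2) + sc (- q) (kk 14 (ap 15 (C.D3 x2)))"
    by (rule stage[of _ "ap 14 (C.E x1) + sc (- q) (kk 14 (ap 15 (C.D3' x1)))" "R3 12 13 16"], rule ext, (simp add: words; simp add: algebra_simps), simp add: lin R3_pass Cs x2_def)
  define x3 where "x3 = R3 11 13 15 x2"
  have xs2: "R3 11 13 15 (ap 14 (C.E' x2) + sc (- q) (kk 14 (ap 15 (C.D3 x2)))) = ap 14 (am 12 (am 16 (B.G2' x3))) + sc (- q) (kk 12 (kk 16 (ap 14 x3))) + sc (- q) (kk 14 (am 16 (B.G3' x3)))"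
    by (rule stage[of _ "ap 14 (am 12 (am 16 (B.G2 x2))) + sc (- q) (kk 12 (kk 16 (ap 14 x2))) + sc (- q) (kk 14 (am 16 (B.G3 x2)))" "R3 11 13 15"], rule ext, (simp add: words; simp add: algebra_simps), simp add: lin R3_pass Bs x3_def)
  define x4 where "x4 = R3 11 12 14 x3"
  have xs3: "R3 11 12 14 (ap 14 (am 12 (am 16 (B.G2' x3))) + sc (- q) (kk 12 (kk 16 (ap 14 x3))) + sc (- q) (kk 14 (am 16 (B.G3' x3)))) = ap 15 (am 16 (A.E' x4)) + sc (- q) (kk 15 (ap 13 (am 16 (A.D1 x4)))) + sc (- q) (kk 16 (A.G3' x4))"
    by (rule stage[of _ "ap 15 (am 16 (A.E x3)) + sc (- q) (kk 15 (ap 13 (am 16 (A.D1' x3)))) + sc (- q) (kk 16 (A.G3 x3))" "R3 11 12 14"], rule ext, (simp add: words; simp add: algebra_simps), simp add: lin R3_pass As x4_def)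
  define y1 where "y1 = R3 11 12 14 f"
  have ys0: "R3 11 12 14 (sc (- q) (kk 12 (kk 15 (ap 14 f))) + ap 12 (am 13 (ap 15 f))) = sc (- q) (kk 15 (A.G3' y1)) + ap 15 (am 13 (A.G2' y1))"
    by (rule stage[of _ "sc (- q) (kk 15 (A.G3 f)) + ap 15 (am 13 (A.G2 f))" "R3 11 12 14"], rule ext, (simp add: words; simp add: algebra_simps), simp add: lin R3_pass As y1_def)
  define y2 where "y2 = R3 11 13 15 y1"
  have ys1: "R3 11 13 15 (sc (- q) (kk 15 (A.G3' y1)) + ap 15 (am 13 (A.G2' y1))) = ap 14 (B.E' y2) + sc (- q) (kk 14 (ap 12 (B.D1 y2)))"
    by (rule stage[of _ "ap 14 (B.E y1) + sc (- q) (kk 14 (ap 12 (B.D1' y1)))" "R3 11 13 15"], rule ext, (simp add: words; simp add: algebra_simps), simp add: lin R3_pass Bs y2_def)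
  define y3 where "y3 = R3 12 13 16 y2"
  have ys2: "R3 12 13 16 (ap 14 (B.E' y2) + sc (- q) (kk 14 (ap 12 (B.D1 y2)))) = ap 14 (am 11 (am 15 (C.G2' y3))) + sc (- q) (kk 11 (kk 15 (ap 14 y3))) + sc (- q) (kk 14 (am 11 (C.G1' y3)))"
    by (rule stage[of _ "ap 14 (am 11 (am 15 (C.G2 y2))) + sc (- q) (kk 11 (kk 15 (ap 14 y2))) + sc (- q) (kk 14 (am 11 (C.G1 y2)))" "R3 12 13 16"], rule ext, (simp add: words; simp add: algebra_simps), simp add: lin R3_pass Cs y3_def)
  define y4 where "y4 = R3 14 15 16 y3"
  have ys3: "R3 14 15 16 (ap 14 (am 11 (am 15 (C.G2' y3))) + sc (- q) (kk 11 (kk 15 (ap 14 y3))) + sc (- q) (kk 14 (am 11 (C.G1' y3)))) = ap 12 (am 11 (D.E' y4)) + sc (- q) (kk 12 (ap 13 (am 11 (D.D3 y4)))) + sc (- q) (kk 11 (D.G1' y4))"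
    by (rule stage[of _ "ap 12 (am 11 (D.E y3)) + sc (- q) (kk 12 (ap 13 (am 11 (D.D3' y3)))) + sc (- q) (kk 11 (D.G1 y3))" "R3 14 15 16"], rule ext, (simp add: words; simp add: algebra_simps), simp add: lin R3_pass Ds y4_def)
  have e: "x4 = y4" using assms by (simp only: RX_def RY_def x1_def x2_def x3_def x4_def y1_def y2_def y3_def y4_def)
  have "RX (sc (- q) (kk 12 (kk 15 (ap 14 f))) + ap 12 (am 13 (ap 15 f))) = ap 15 (am 16 (A.E' x4)) + sc (- q) (kk 15 (ap 13 (am 16 (A.D1 x4)))) + sc (- q) (kk 16 (A.G3' x4))"
    by (simp only: RX_def xs0 xs1 xs2 xs3)
  also have "\<dots> = ap 12 (am 11 (D.E' y4)) + sc (- q) (kk 12 (ap 13 (am 11 (D.D3 y4)))) + sc (- q) (kk 11 (D.G1' y4))" unfolding e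
    by (rule ext) (simp add: words; simp add: algebra_simps)
  also have "\<dots> = RY (sc (- q) (kk 12 (kk 15 (ap 14 f))) + ap 12 (am 13 (ap 15 f)))"
    by (simp only: RY_def ys0 ys1 ys2 ys3)
  finally show ?thesis .
qed

lemma RX_RY_create_15:
  assumes "RX f = RY f"
  shows "RX (kk 13 (ap 15 f)) = RY (kk 13 (ap 15 f))"
proof -
  define x1 where "x1 = R3 14 15 16 f"
  have xs0: "R3 14 15 16 (kk 13 (ap 15 f)) = kk 13 (D.G2' x1)"
    by (rule stage[of _ "kk 13 (D.G2 f)" "R3 14 15 16"], rule ext, (simp add: words; simp add: algebra_simps), simp add: lin R3_pass Ds x1_def)
  define x2 where "x2 = R3 12 13 16 x1"
  have xs1: "R3 12 13 16 (kk 13 (D.G2' x1)) = ap 14 (C.G3' x2) + sc (- q) (kk 14 (ap 15 (kk 13 (kk 16 x2))))"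
    by (rule stage[of _ "ap 14 (C.G3 x1) + sc (- q) (kk 14 (ap 15 (kk 13 (kk 16 x1))))" "R3 12 13 16"], rule ext, (simp add: words; simp add: algebra_simps), simp add: lin R3_pass Cs x2_def)
  define x3 where "x3 = R3 11 13 15 x2"
  have xs2: "R3 11 13 15 (ap 14 (C.G3' x2) + sc (- q) (kk 14 (ap 15 (kk 13 (kk 16 x2))))) = kk 12 (ap 14 (ap 16 x3)) + kk 16 (ap 14 (am 12 (B.G2' x3))) + sc (- q) (kk 14 (kk 16 (B.G3' x3)))"
    by (rule stage[of _ "kk 12 (ap 14 (ap 16 x2)) + kk 16 (ap 14 (am 12 (B.G2 x2))) + sc (- q) (kk 14 (kk 16 (B.G3 x2)))" "R3 11 13 15"], rule ext, (simp add: words; simp add: algebra_simps), simp add: lin R3_pass Bs x3_def)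
  define x4 where "x4 = R3 11 12 14 x3"
  have xs3: "R3 11 12 14 (kk 12 (ap 14 (ap 16 x3)) + kk 16 (ap 14 (am 12 (B.G2' x3))) + sc (- q) (kk 14 (kk 16 (B.G3' x3)))) = ap 16 (A.G3' x4) + kk 16 (ap 15 (A.E' x4)) + sc (- q) (kk 15 (kk 16 (ap 13 (A.D1 x4))))"
    by (rule stage[of _ "ap 16 (A.G3 x3) + kk 16 (ap 15 (A.E x3)) + sc (- q) (kk 15 (kk 16 (ap 13 (A.D1' x3))))" "R3 11 12 14"], rule ext, (simp add: words; simp add: algebra_simps), simp add: lin R3_pass As x4_def)
  define y1 where "y1 = R3 11 12 14 f"
  have ys0: "R3 11 12 14 (kk 13 (ap 15 f)) = kk 13 (ap 15 y1)"
    by (simp add: lin R3_pass As y1_def)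
  define y2 where "y2 = R3 11 13 15 y1"
  have ys1: "R3 11 13 15 (kk 13 (ap 15 y1)) = B.G3' y2"
    by (rule stage[of _ "B.G3 y1" "R3 11 13 15"], rule ext, (simp add: words; simp add: algebra_simps), simp add: lin R3_pass Bs y2_def)
  define y3 where "y3 = R3 12 13 16 y2"
  have ys2: "R3 12 13 16 (B.G3' y2) = kk 11 (ap 15 y3) + kk 15 (am 11 (C.G2' y3))"
    by (rule stage[of _ "kk 11 (ap 15 y2) + kk 15 (am 11 (C.G2 y2))" "R3 12 13 16"], rule ext, (simp add: words; simp add: algebra_simps), simp add: lin R3_pass Cs y3_def)
  define y4 where "y4 = R3 14 15 16 y3"
  have ys3: "R3 14 15 16 (kk 11 (ap 15 y3) + kk 15 (am 11 (C.G2' y3))) = kk 11 (D.G2' y4) + ap 12 (am 11 (D.G3' y4)) + sc (- q) (kk 12 (ap 13 (am 11 (kk 15 (kk 16 y4)))))"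
    by (rule stage[of _ "kk 11 (D.G2 y3) + ap 12 (am 11 (D.G3 y3)) + sc (- q) (kk 12 (ap 13 (am 11 (kk 15 (kk 16 y3)))))" "R3 14 15 16"], rule ext, (simp add: words; simp add: algebra_simps), simp add: lin R3_pass Ds y4_def)
  have e: "x4 = y4" using assms by (simp only: RX_def RY_def x1_def x2_def x3_def x4_def y1_def y2_def y3_def y4_def)
  have "RX (kk 13 (ap 15 f)) = ap 16 (A.G3' x4) + kk 16 (ap 15 (A.E' x4)) + sc (- q) (kk 15 (kk 16 (ap 13 (A.D1 x4))))"
    by (simp only: RX_def xs0 xs1 xs2 xs3)
  also have "\<dots> = kk 11 (D.G2' y4) + ap 12 (am 11 (D.G3' y4)) + sc (- q) (kk 12 (ap 13 (am 11 (kk 15 (kk 16 y4)))))" unfolding e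
    by (rule ext) (simp add: words; simp add: algebra_simps)
  also have "\<dots> = RY (kk 13 (ap 15 f))"
    by (simp only: RY_def ys0 ys1 ys2 ys3)
  finally show ?thesis .
qed

lemma RX_RY_create_16:
  assumes "RX f = RY f"
  shows "RX (kk 13 (kk 15 (ap 16 f))) = RY (kk 13 (kk 15 (ap 16 f)))"
proof -
  define x1 where "x1 = R3 14 15 16 f"
  have xs0: "R3 14 15 16 (kk 13 (kk 15 (ap 16 f))) = kk 13 (D.G3' x1)"
    by (rule stage[of _ "kk 13 (D.G3 f)" "R3 14 15 16"], rule ext, (simp add: words; simp add: algebra_simps), simp add: lin R3_pass Ds x1_def)
  define x2 where "x2 = R3 12 13 16 x1"
  have xs1: "R3 12 13 16 (kk 13 (D.G3' x1)) = kk 14 (C.G3' x2) + ap 15 (am 14 (kk 13 (kk 16 x2)))"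
    by (rule stage[of _ "kk 14 (C.G3 x1) + ap 15 (am 14 (kk 13 (kk 16 x1)))" "R3 12 13 16"], rule ext, (simp add: words; simp add: algebra_simps), simp add: lin R3_pass Cs x2_def)
  define x3 where "x3 = R3 11 13 15 x2"
  have xs2: "R3 11 13 15 (kk 14 (C.G3' x2) + ap 15 (am 14 (kk 13 (kk 16 x2)))) = kk 12 (kk 14 (ap 16 x3)) + kk 14 (kk 16 (am 12 (B.G2' x3))) + kk 16 (am 14 (B.G3' x3))"
    by (rule stage[of _ "kk 12 (kk 14 (ap 16 x2)) + kk 14 (kk 16 (am 12 (B.G2 x2))) + kk 16 (am 14 (B.G3 x2))" "R3 11 13 15"], rule ext, (simp add: words; simp add: algebra_simps), simp add: lin R3_pass Bs x3_def)
  define x4 where "x4 = R3 11 12 14 x3"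
  have xs3: "R3 11 12 14 (kk 12 (kk 14 (ap 16 x3)) + kk 14 (kk 16 (am 12 (B.G2' x3))) + kk 16 (am 14 (B.G3' x3))) = ap 16 (kk 12 (kk 14 x4)) + kk 16 (ap 15 (A.D3 x4)) + kk 15 (kk 16 (ap 13 (A.D2 x4)))"
    by (rule stage[of _ "ap 16 (kk 12 (kk 14 x3)) + kk 16 (ap 15 (A.D3' x3)) + kk 15 (kk 16 (ap 13 (A.D2' x3)))" "R3 11 12 14"], rule ext, (simp add: words; simp add: algebra_simps), simp add: lin R3_pass As x4_def)
  define y1 where "y1 = R3 11 12 14 f"
  have ys0: "R3 11 12 14 (kk 13 (kk 15 (ap 16 f))) = kk 13 (kk 15 (ap 16 y1))"
    by (simp add: lin R3_pass As y1_def)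
  define y2 where "y2 = R3 11 13 15 y1"
  have ys1: "R3 11 13 15 (kk 13 (kk 15 (ap 16 y1))) = ap 16 (kk 13 (kk 15 y2))"
    by (rule stage[of _ "ap 16 (kk 13 (kk 15 y1))" "R3 11 13 15"], rule ext, (simp add: words; simp add: algebra_simps), simp add: lin R3_pass Bs y2_def)
  define y3 where "y3 = R3 12 13 16 y2"
  have ys2: "R3 12 13 16 (ap 16 (kk 13 (kk 15 y2))) = kk 15 (C.G3' y3)"
    by (rule stage[of _ "kk 15 (C.G3 y2)" "R3 12 13 16"], rule ext, (simp add: words; simp add: algebra_simps), simp add: lin R3_pass Cs y3_def)
  define y4 where "y4 = R3 14 15 16 y3"
  have ys3: "R3 14 15 16 (kk 15 (C.G3' y3)) = kk 12 (D.G3' y4) + ap 13 (am 12 (kk 15 (kk 16 y4)))"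
    by (rule stage[of _ "kk 12 (D.G3 y3) + ap 13 (am 12 (kk 15 (kk 16 y3)))" "R3 14 15 16"], rule ext, (simp add: words; simp add: algebra_simps), simp add: lin R3_pass Ds y4_def)
  have e: "x4 = y4" using assms by (simp only: RX_def RY_def x1_def x2_def x3_def x4_def y1_def y2_def y3_def y4_def)
  have "RX (kk 13 (kk 15 (ap 16 f))) = ap 16 (kk 12 (kk 14 x4)) + kk 16 (ap 15 (A.D3 x4)) + kk 15 (kk 16 (ap 13 (A.D2 x4)))"
    by (simp only: RX_def xs0 xs1 xs2 xs3)
  also have "\<dots> = kk 12 (D.G3' y4) + ap 13 (am 12 (kk 15 (kk 16 y4)))" unfolding e
    by (rule ext) (simp add: words; simp add: algebra_simps)
  also have "\<dots> = RY (kk 13 (kk 15 (ap 16 f)))"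
    by (simp only: RY_def ys0 ys1 ys2 ys3)
  finally show ?thesis .
qed

lemma RX_RY_cancel:
  assumes "RX (sc r f) = RY (sc r f)" "r \<noteq> 0"
  shows "RX f = RY f"
proof -
  have "sc r (RX f) = sc r (RY f)" using assms(1) by (simp only: RX_def RY_def R3_lin)
  then have "sc (1 / r) (sc r (RX f)) = sc (1 / r) (sc r (RY f))" by simp
  then show ?thesis using assms(2) by (simp add: lin)
qed

lemma row_fin_RXY: "row_fin RX" "row_fin RY"
  unfolding RX_def[abs_def] RY_def[abs_def] by (intro row_fin_intros row_fin_R3)+

text \<open>
  The six operators create every basis vector from the vacuum. Only the one for position 14 is
  not a creation operator in general: its second term annihilates at position 13, so
  it is used while that occupation number is zero.
\<close>
lemma RX_RY_delta: "RX (delta \<tau>) = RY (delta \<tau>)"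
proof (induction "\<tau> 11 + \<tau> 12 + \<tau> 13 + \<tau> 14 + \<tau> 15 + \<tau> 16" arbitrary: \<tau> rule: less_induct)
  case less
  have dec: "\<exists>\<rho>. \<tau> = \<rho>(p := Suc (\<rho> p)) \<and> RX (delta \<rho>) = RY (delta \<rho>) \<and> (\<forall>r. r \<noteq> p \<longrightarrow> \<rho> r = \<tau> r)"
    if pp: "p \<in> {11, 12, 13, 14, 15, 16}" "\<tau> p \<noteq> 0" for p
  proof -
    obtain m where m: "\<tau> p = Suc m" using pp(2) by (cases "\<tau> p") auto
    define \<rho> where "\<rho> = \<tau>(p := m)"
    have "RX (delta \<rho>) = RY (delta \<rho>)"
      by (rule less) (use pp(1) m in \<open>auto simp: \<rho>_def\<close>)
    then show ?thesis using m by (intro exI[of _ \<rho>]) (auto simp: \<rho>_def fun_upd_idem)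
  qed
  consider "\<tau> 11 \<noteq> 0" | "\<tau> 12 \<noteq> 0" | "\<tau> 13 \<noteq> 0" | "\<tau> 15 \<noteq> 0" | "\<tau> 16 \<noteq> 0" | "\<tau> 14 \<noteq> 0" "\<tau> 13 = 0"
    | "\<tau> 11 = 0" "\<tau> 12 = 0" "\<tau> 13 = 0" "\<tau> 14 = 0" "\<tau> 15 = 0" "\<tau> 16 = 0" by blast
  then show ?case
  proof cases
    case 1
    obtain \<rho> where \<rho>: "\<tau> = \<rho>(11 := Suc (\<rho> 11))" "RX (delta \<rho>) = RY (delta \<rho>)"
      using dec[OF _ 1] by blast
    have "kk 12 (kk 13 (ap 11 (delta \<rho>))) = sc (q ^ \<rho> 12 * q ^ \<rho> 13) (delta \<tau>)"
      unfolding \<rho>(1) by (simp add: ap_delta kk_delta lin mult_ac)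
    with RX_RY_create_11[OF \<rho>(2)] show ?thesis by - (rule RX_RY_cancel[of "q ^ \<rho> 12 * q ^ \<rho> 13"], simp_all)
  next
    case 2
    obtain \<rho> where \<rho>: "\<tau> = \<rho>(12 := Suc (\<rho> 12))" "RX (delta \<rho>) = RY (delta \<rho>)"
      using dec[OF _ 2] by blast
    have "kk 13 (ap 12 (delta \<rho>)) = sc (q ^ \<rho> 13) (delta \<tau>)"
      unfolding \<rho>(1) by (simp add: ap_delta kk_delta lin)
    with RX_RY_create_12[OF \<rho>(2)] show ?thesis by - (rule RX_RY_cancel[of "q ^ \<rho> 13"], simp_all)
  next
    case 3
    obtain \<rho> where \<rho>: "\<tau> = \<rho>(13 := Suc (\<rho> 13))" "RX (delta \<rho>) = RY (delta \<rho>)"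
      using dec[OF _ 3] by blast
    from RX_RY_create_13[OF \<rho>(2)] show ?thesis unfolding \<rho>(1) by (simp only: ap_delta)
  next
    case 4
    obtain \<rho> where \<rho>: "\<tau> = \<rho>(15 := Suc (\<rho> 15))" "RX (delta \<rho>) = RY (delta \<rho>)"
      using dec[OF _ 4] by blast
    have "kk 13 (ap 15 (delta \<rho>)) = sc (q ^ \<rho> 13) (delta \<tau>)"
      unfolding \<rho>(1) by (simp add: ap_delta kk_delta lin)
    with RX_RY_create_15[OF \<rho>(2)] show ?thesis by - (rule RX_RY_cancel[of "q ^ \<rho> 13"], simp_all)
  next
    case 5
    obtain \<rho> where \<rho>: "\<tau> = \<rho>(16 := Suc (\<rho> 16))" "RX (delta \<rho>) = RY (delta \<rho>)"
      using dec[OF _ 5] by blast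
    have "kk 13 (kk 15 (ap 16 (delta \<rho>))) = sc (q ^ \<rho> 13 * q ^ \<rho> 15) (delta \<tau>)"
      unfolding \<rho>(1) by (simp add: ap_delta kk_delta lin mult_ac)
    with RX_RY_create_16[OF \<rho>(2)] show ?thesis by - (rule RX_RY_cancel[of "q ^ \<rho> 13 * q ^ \<rho> 15"], simp_all)
  next
    case 6
    obtain \<rho> where \<rho>: "\<tau> = \<rho>(14 := Suc (\<rho> 14))" "RX (delta \<rho>) = RY (delta \<rho>)" "\<forall>r. r \<noteq> 14 \<longrightarrow> \<rho> r = \<tau> r"
      using dec[OF _ 6(1)] by blast
    have "\<rho> 13 = 0" using \<rho>(3) 6(2) by simp
    then have "sc (- q) (kk 12 (kk 15 (ap 14 (delta \<rho>)))) + ap 12 (am 13 (ap 15 (delta \<rho>)))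
        = sc (- q * (q ^ \<rho> 12 * q ^ \<rho> 15)) (delta \<tau>)"
      unfolding \<rho>(1) by (simp add: ap_delta kk_delta am_delta_0 lin mult_ac)
    with RX_RY_create_14[OF \<rho>(2)] show ?thesis
      by - (rule RX_RY_cancel[of "- q * (q ^ \<rho> 12 * q ^ \<rho> 15)"], simp_all)
  next
    case 7
    then show ?thesis by (simp add: RX_def RY_def A.R_vac B.R_vac C.R_vac D.R_vac)
  qed
qed

theorem RRRR: "RX f = RY f"
  by (rule row_fin_eqI[OF row_fin_RXY RX_RY_delta])

end

context q_fock begin

interpretation D: triple q 14 15 16 by (rule triple_I) auto

section \<open>One site\<close>

abbreviation "RD \<equiv> R3 14 15 16"

text \<open>
  A three-body weight with its four outer labels fixed, as an operator on the auxiliary oscillator at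
  position \<open>r\<close>.
\<close>
definition site_op :: "nat \<Rightarrow> nat \<Rightarrow> nat \<Rightarrow> nat \<Rightarrow> nat \<Rightarrow> nat \<Rightarrow> 'k vec \<Rightarrow> 'k vec" where
  "site_op e a b i j r g = (\<lambda>\<sigma>. if j \<le> b + \<sigma> r
     then scrS q e a b (\<sigma> r) i j (b + \<sigma> r - j) * g (\<sigma>(r := b + \<sigma> r - j)) else 0)"

lemma sum_vec_apply: "(\<Sum>x\<in>S. F x) \<sigma> = (\<Sum>x\<in>S. F x \<sigma>)" for F :: "'b \<Rightarrow> 'k vec"
  by (induction S rule: infinite_finite_induct) auto

lemma site_op_lin [lin]:
  "site_op e a b i j r (f + g) = site_op e a b i j r f + site_op e a b i j r g"
  "site_op e a b i j r (sc c f) = sc c (site_op e a b i j r f)" "site_op e a b i j r 0 = 0"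
  by (auto simp: site_op_def fun_eq_iff algebra_simps)

lemma site_op_sum: "site_op e a b i j r (\<Sum>x\<in>S. F x) = (\<Sum>x\<in>S. site_op e a b i j r (F x))"
  by (induction S rule: infinite_finite_induct) (simp_all only: sum.infinite sum.empty sum.insert lin simp_thms)

lemma site_op_comm: "r \<noteq> s \<Longrightarrow> site_op e a b i j r (site_op e' a' b' i' j' s g) = site_op e' a' b' i' j' s (site_op e a b i j r g)"
  by (rule ext) (simp add: site_op_def fun_upd_twist[of r s])

lemma site_op_eq_0: "a + b \<noteq> i + j \<Longrightarrow> site_op e a b i j r g = 0"
  using scrS_conservation(1) by (fastforce simp: site_op_def fun_eq_iff)

lemma site_op_cong: "(a + b = i + j \<Longrightarrow> X = Y) \<Longrightarrow> site_op e a b i j r X = site_op e a b i j r Y"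
  by (cases "a + b = i + j") (auto simp: site_op_eq_0)

text \<open>
  The two orders of the three weights at a site, with the intermediate labels summed up to a bound \<open>N\<close>
  that conservation makes harmless when it is large.
\<close>
definition site_left where
  "site_left N e a b c i j k g = (\<Sum>a'\<le>N. \<Sum>b'\<le>N. \<Sum>c'\<le>N.
     site_op e a b a' b' 14 (site_op e a' c i c' 15 (site_op e b' c' j k 16 g)))"

definition site_right where
  "site_right N e a b c i j k g = (\<Sum>a'\<le>N. \<Sum>b'\<le>N. \<Sum>c'\<le>N.
     site_op e b c b' c' 16 (site_op e a c' a' k 15 (site_op e a' b' i j 14 g)))"

lemma Aop1: "site_op (Suc 0) a b i j r g =
   (if (a, b, i, j) = (0, 0, 0, 0) then g
    else if (a, b, i, j) = (1, 1, 1, 1) then g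
    else if (a, b, i, j) = (0, 1, 0, 1) then sc (- q) (kk r g)
    else if (a, b, i, j) = (1, 0, 1, 0) then kk r g
    else if (a, b, i, j) = (0, 1, 1, 0) then am r g
    else if (a, b, i, j) = (1, 0, 0, 1) then ap r g else 0)"
  by (rule ext) (auto simp: site_op_def scrS_def scrS1_def kk_def am_def ap_def algebra_simps fun_upd_idem)

lemma Aop1_0: "\<not> (a \<le> 1 \<and> b \<le> 1 \<and> i \<le> 1 \<and> j \<le> 1) \<Longrightarrow> site_op (Suc 0) a b i j r g = 0"
  by (auto simp: Aop1)

lemma sum_01:
  assumes "N \<ge> 1" "\<And>x. x \<ge> 2 \<Longrightarrow> F x = 0"
  shows "(\<Sum>x\<le>N. F x) = F 0 + (F (Suc 0) :: 'k vec)"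
proof -
  have "(\<Sum>x\<le>N. F x) = (\<Sum>x\<in>{0, Suc 0}. F x)"
  proof (rule sum.mono_neutral_right)
    show "\<forall>i\<in>{..N} - {0, Suc 0}. F i = 0"
      by (auto intro!: assms(2))
  qed (use assms(1) in auto)
  then show ?thesis by simp
qed

lemma site_left_1: "N \<ge> 1 \<Longrightarrow> site_left N (Suc 0) a b c i j k g = (\<Sum>a'\<in>{0, Suc 0}. \<Sum>b'\<in>{0, Suc 0}. \<Sum>c'\<in>{0, Suc 0}.
     site_op (Suc 0) a b a' b' 14 (site_op (Suc 0) a' c i c' 15 (site_op (Suc 0) b' c' j k 16 g)))"
  unfolding site_left_def by (simp add: sum_01 Aop1_0 site_op_lin sum_vec_apply)

lemma site_right_1: "N \<ge> 1 \<Longrightarrow> site_right N (Suc 0) a b c i j k g = (\<Sum>a'\<in>{0, Suc 0}. \<Sum>b'\<in>{0, Suc 0}. \<Sum>c'\<in>{0, Suc 0}.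
     site_op (Suc 0) b c b' c' 16 (site_op (Suc 0) a c' a' k 15 (site_op (Suc 0) a' b' i j 14 g)))"
  unfolding site_right_def by (simp add: sum_01 Aop1_0 site_op_lin)

lemmas D_rel = D.R_G1 D.R_G2 D.R_G3 D.R_G1' D.R_G2' D.R_G3' D.R_D1 D.R_D2 D.R_D3 D.R_E D.R_D_primed D.R_K

text \<open>
  The intertwining relations, spelled out in the form in which they occur in the six-vertex
  tetrahedron equation.
\<close>
lemma RD_rel:
  "RD (kk 15 (ap 14 f)) = kk 16 (ap 14 (RD f)) + kk 14 (ap 15 (am 16 (RD f)))"
  "RD (ap 15 f) = ap 14 (ap 16 (RD f)) - sc q (kk 14 (kk 16 (ap 15 (RD f))))"
  "RD (kk 15 (ap 16 f)) = kk 14 (ap 16 (RD f)) + kk 16 (ap 15 (am 14 (RD f)))"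
  "RD (kk 15 (am 14 f)) = kk 16 (am 14 (RD f)) + kk 14 (ap 16 (am 15 (RD f)))"
  "RD (am 15 f) = am 14 (am 16 (RD f)) - sc q (kk 14 (kk 16 (am 15 (RD f))))"
  "RD (kk 15 (am 16 f)) = kk 14 (am 16 (RD f)) + kk 16 (ap 14 (am 15 (RD f)))"
  "RD (ap 15 (am 14 (am 16 f))) - sc q (RD (kk 14 (kk 16 f))) = ap 14 (ap 16 (am 15 (RD f))) - sc q (kk 14 (kk 16 (RD f)))"
  "RD (ap 14 (ap 16 (am 15 f))) - sc q (RD (kk 14 (kk 16 f))) = ap 15 (am 14 (am 16 (RD f))) - sc q (kk 14 (kk 16 (RD f)))"
  "RD (ap 14 (ap 16 f)) - sc q (RD (kk 14 (kk 16 (ap 15 f)))) = ap 15 (RD f)"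
  "RD (kk 16 (ap 14 f)) + RD (kk 14 (ap 15 (am 16 f))) = kk 15 (ap 14 (RD f))"
  "RD (kk 14 (ap 16 f)) + RD (kk 16 (ap 15 (am 14 f))) = kk 15 (ap 16 (RD f))"
  "RD (am 14 (am 16 f)) - sc q (RD (kk 14 (kk 16 (am 15 f)))) = am 15 (RD f)"
  "RD (kk 16 (am 14 f)) + RD (kk 14 (ap 16 (am 15 f))) = kk 15 (am 14 (RD f))"
  "RD (kk 14 (am 16 f)) + RD (kk 16 (ap 14 (am 15 f))) = kk 15 (am 16 (RD f))"
  using D_rel[of f] by (simp_all add: D.G_defs D.D_defs lin)

lemma sc_neg: "sc (- r) f = - sc r f"
  by (auto simp: fun_eq_iff)

lemma RD_rel_sc:
  "sc r (RD (kk 16 (ap 14 f))) + sc r (RD (kk 14 (ap 15 (am 16 f)))) = sc r (kk 15 (ap 14 (RD f)))"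
  "sc r (RD (kk 14 (ap 16 f))) + sc r (RD (kk 16 (ap 15 (am 14 f)))) = sc r (kk 15 (ap 16 (RD f)))"
  "sc r (RD (kk 16 (am 14 f))) + sc r (RD (kk 14 (ap 16 (am 15 f)))) = sc r (kk 15 (am 14 (RD f)))"
  "sc r (RD (kk 14 (am 16 f))) + sc r (RD (kk 16 (ap 14 (am 15 f)))) = sc r (kk 15 (am 16 (RD f)))"
  by (simp_all only: sc_lin(1)[symmetric] RD_rel)

lemma RD_rel_more:
  "ap 14 (ap 16 (RD (am 14 (am 16 f)))) - sc q (kk 14 (kk 16 (ap 15 (RD (am 14 (am 16 f)))))) - sc q (RD (kk 14 (kk 16 f)))
    = ap 14 (ap 16 (am 15 (RD f))) - sc q (kk 14 (kk 16 (RD f)))"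
  "- sc q (RD (kk 14 (ap 15 (am 16 f)))) - sc q (RD (kk 16 (ap 14 f))) = - sc q (kk 15 (ap 14 (RD f)))"
  "RD (kk 16 (ap 15 (am 14 f))) + RD (kk 14 (ap 16 f)) = kk 15 (ap 16 (RD f))"
proof -
  show "ap 14 (ap 16 (RD (am 14 (am 16 f)))) - sc q (kk 14 (kk 16 (ap 15 (RD (am 14 (am 16 f)))))) - sc q (RD (kk 14 (kk 16 f)))
    = ap 14 (ap 16 (am 15 (RD f))) - sc q (kk 14 (kk 16 (RD f)))"
    using RD_rel(7)[of f] by (simp only: RD_rel(2))
  show "- sc q (RD (kk 14 (ap 15 (am 16 f)))) - sc q (RD (kk 16 (ap 14 f))) = - sc q (kk 15 (ap 14 (RD f)))"
    unfolding RD_rel_sc(1)[of q f, symmetric] by (rule ext) simp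
  show "RD (kk 16 (ap 15 (am 14 f))) + RD (kk 14 (ap 16 f)) = kk 15 (ap 16 (RD f))"
    using RD_rel(11)[of f] by (simp only: add.commute)
qed

lemma Aop1s:
  "site_op (Suc 0) 0 0 0 0 r g = g"
  "site_op (Suc 0) 0 0 0 (Suc 0) r g = 0"
  "site_op (Suc 0) 0 0 (Suc 0) 0 r g = 0"
  "site_op (Suc 0) 0 0 (Suc 0) (Suc 0) r g = 0"
  "site_op (Suc 0) 0 (Suc 0) 0 0 r g = 0"
  "site_op (Suc 0) 0 (Suc 0) 0 (Suc 0) r g = sc (- q) (kk r g)"
  "site_op (Suc 0) 0 (Suc 0) (Suc 0) 0 r g = am r g"
  "site_op (Suc 0) 0 (Suc 0) (Suc 0) (Suc 0) r g = 0"
  "site_op (Suc 0) (Suc 0) 0 0 0 r g = 0"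
  "site_op (Suc 0) (Suc 0) 0 0 (Suc 0) r g = ap r g"
  "site_op (Suc 0) (Suc 0) 0 (Suc 0) 0 r g = kk r g"
  "site_op (Suc 0) (Suc 0) 0 (Suc 0) (Suc 0) r g = 0"
  "site_op (Suc 0) (Suc 0) (Suc 0) 0 0 r g = 0"
  "site_op (Suc 0) (Suc 0) (Suc 0) 0 (Suc 0) r g = 0"
  "site_op (Suc 0) (Suc 0) (Suc 0) (Suc 0) 0 r g = 0"
  "site_op (Suc 0) (Suc 0) (Suc 0) (Suc 0) (Suc 0) r g = g"
  by (simp_all add: Aop1)

text \<open>
  With six binary outer labels this is a finite list of relations. One particle among the three
  spaces gives the relations read in one direction, two particles (one hole) those read in the other.
\<close>
lemma site_1:
  assumes "N \<ge> 1"
  shows "site_left N (Suc 0) a b c i j k (RD g) = RD (site_right N (Suc 0) a b c i j k g)"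
proof (cases "a \<le> 1 \<and> b \<le> 1 \<and> c \<le> 1 \<and> i \<le> 1 \<and> j \<le> 1 \<and> k \<le> 1")
  case False
  then consider "\<not> a \<le> 1" | "\<not> b \<le> 1" | "\<not> c \<le> 1" | "\<not> i \<le> 1" | "\<not> j \<le> 1" | "\<not> k \<le> 1" by blast
  then have "site_left N (Suc 0) a b c i j k (RD g) = 0" "site_right N (Suc 0) a b c i j k g = 0"
    unfolding site_left_def site_right_def by (cases; simp add: Aop1_0 site_op_lin)+
  then show ?thesis by (simp add: R3_lin)
next
  case True
  then have "a \<in> {0, Suc 0}" "b \<in> {0, Suc 0}" "c \<in> {0, Suc 0}" "i \<in> {0, Suc 0}" "j \<in> {0, Suc 0}" "k \<in> {0, Suc 0}"
    by auto
  then show ?thesis unfolding site_left_1[OF assms] site_right_1[OF assms]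
    apply (elim insertE emptyE; simp add: Aop1s lin)
    apply (simp_all add: osc_comm RD_rel D.R_K)
    apply (simp_all add: osc_comm RD_rel D.R_K RD_rel_sc)
    apply (simp_all add: sc_neg)
    apply (simp_all add: lin)
    apply (simp_all add: RD_rel(8) RD_rel(9) RD_rel(12) RD_rel_more)
    done
qed

text \<open>
  The operator \<open>R\<close> is the family of site operators in which the labels of its first two factors are
  summed over.
\<close>
lemma R3_site_op:
  assumes d: "x \<noteq> y" "y \<noteq> z" "x \<noteq> z" and N: "\<sigma> x + \<sigma> y \<le> N"
  shows "R3 x y z f \<sigma> = (\<Sum>i\<le>N. \<Sum>j\<le>N. site_op 0 (\<sigma> x) (\<sigma> y) i j z (\<lambda>\<rho>. f (\<rho>(x := i, y := j))) \<sigma>)"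
proof -
  define T where "T j = scrS0 q (\<sigma> x) (\<sigma> y) (\<sigma> z) (\<sigma> x + \<sigma> y - j) j (\<sigma> y + \<sigma> z - j)
       * f (\<sigma>(x := \<sigma> x + \<sigma> y - j, y := j, z := \<sigma> y + \<sigma> z - j))" for j
  have A: "site_op 0 (\<sigma> x) (\<sigma> y) i j z (\<lambda>\<rho>. f (\<rho>(x := i, y := j))) \<sigma>
      = (if i = \<sigma> x + \<sigma> y - j then if j \<le> \<sigma> y + min (\<sigma> x) (\<sigma> z) then T j else 0 else 0)" if "j \<le> N" "i \<le> N" for i j
  proof (cases "\<sigma> x + \<sigma> y = i + j")
    case True
    then have "i = \<sigma> x + \<sigma> y - j" "j \<le> \<sigma> y + min (\<sigma> x) (\<sigma> z) \<longleftrightarrow> j \<le> \<sigma> y + \<sigma> z" by linarith+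
    moreover have "\<sigma>(z := c, x := i, y := j) = \<sigma>(x := i, y := j, z := c)" for c using d by auto
    ultimately show ?thesis by (simp add: site_op_def T_def scrS_def)
  next
    case False
    then have "site_op 0 (\<sigma> x) (\<sigma> y) i j z (\<lambda>\<rho>. f (\<rho>(x := i, y := j))) = 0" by (rule site_op_eq_0)
    moreover have "T j = 0" if "i = \<sigma> x + \<sigma> y - j" "j \<le> \<sigma> y + min (\<sigma> x) (\<sigma> z)"
      using False that unfolding T_def by (subst scrS0_eq_0) auto
    ultimately show ?thesis by simp
  qed
  have "(\<Sum>i\<le>N. \<Sum>j\<le>N. site_op 0 (\<sigma> x) (\<sigma> y) i j z (\<lambda>\<rho>. f (\<rho>(x := i, y := j))) \<sigma>)
      = (\<Sum>j\<le>N. \<Sum>i\<le>N. if i = \<sigma> x + \<sigma> y - j then if j \<le> \<sigma> y + min (\<sigma> x) (\<sigma> z) then T j else 0 else 0)"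
    by (subst sum.swap) (intro sum.cong refl, simp add: A)
  also have "\<dots> = (\<Sum>j\<le>N. if j \<le> \<sigma> y + min (\<sigma> x) (\<sigma> z) then T j else 0)"
  proof (intro sum.cong refl)
    fix j
    have "\<sigma> x + \<sigma> y - j \<le> N" using N by simp
    then show "(\<Sum>i\<le>N. if i = \<sigma> x + \<sigma> y - j then if j \<le> \<sigma> y + min (\<sigma> x) (\<sigma> z) then T j else 0 else 0)
        = (if j \<le> \<sigma> y + min (\<sigma> x) (\<sigma> z) then T j else 0)"
      by simp
  qed
  also have "\<dots> = (\<Sum>j\<in>{..\<sigma> y + min (\<sigma> x) (\<sigma> z)}. T j)"
    using N by (intro sum.mono_neutral_cong_right) auto
  finally show ?thesis by (simp add: R3_def T_def)
qed

definition pin :: "nat \<Rightarrow> nat \<Rightarrow> nat \<Rightarrow> 'k vec \<Rightarrow> 'k vec" where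
  "pin a b c f = (\<lambda>\<sigma>. f (\<sigma>(11 := a, 12 := b, 13 := c)))"

lemma pin_site_op: "r \<notin> {11, 12, 13} \<Longrightarrow> pin u v w (site_op e a b i j r f) = site_op e a b i j r (pin u v w f)"
proof (rule ext)
  fix \<sigma> :: "nat \<Rightarrow> nat"
  assume r: "r \<notin> {11, 12, 13}"
  then have "\<sigma>(11 := u, 12 := v, 13 := w, r := d) = \<sigma>(r := d, 11 := u, 12 := v, 13 := w)" for d
    by auto
  then show "pin u v w (site_op e a b i j r f) \<sigma> = site_op e a b i j r (pin u v w f) \<sigma>"
    using r by (simp add: pin_def site_op_def)
qed

lemma pin_RD: "pin u v w (RD f) = RD (pin u v w f)"
proof (rule ext)
  fix \<sigma> :: "nat \<Rightarrow> nat"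
  have "\<sigma>(11 := u, 12 := v, 13 := w, 14 := d, 15 := d', 16 := d'') = \<sigma>(14 := d, 15 := d', 16 := d'', 11 := u, 12 := v, 13 := w)" for d d' d''
    by auto
  then show "pin u v w (RD f) \<sigma> = RD (pin u v w f) \<sigma>"
    by (simp add: pin_def R3_def)
qed

lemma pin_sum: "pin u v w (\<Sum>x\<in>S. F x) = (\<Sum>x\<in>S. pin u v w (F x))"
  by (rule ext) (simp add: pin_def sum_vec_apply)

lemma pin_R124: "a + b \<le> N \<Longrightarrow> pin a b c (R3 11 12 14 f) = (\<Sum>a'\<le>N. \<Sum>b'\<le>N. site_op 0 a b a' b' 14 (pin a' b' c f))"
proof (rule ext)
  fix \<sigma> :: "nat \<Rightarrow> nat"
  assume N: "a + b \<le> N"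
  let ?s = "\<sigma>(11 := a, 12 := b, 13 := c)"
  have "pin a b c (R3 11 12 14 f) \<sigma> = R3 11 12 14 f ?s" by (simp add: pin_def)
  also have "\<dots> = (\<Sum>a'\<le>N. \<Sum>b'\<le>N. site_op 0 (?s 11) (?s 12) a' b' 14 (\<lambda>\<rho>. f (\<rho>(11 := a', 12 := b'))) ?s)"
    by (rule R3_site_op) (use N in auto)
  also have "\<dots> = (\<Sum>a'\<le>N. \<Sum>b'\<le>N. site_op 0 a b a' b' 14 (pin a' b' c f)) \<sigma>"
  proof -
    have "?s(14 := d, 11 := a', 12 := b') = \<sigma>(14 := d, 11 := a', 12 := b', 13 := c)" for d a' b' by auto
    then show ?thesis by (simp add: sum_vec_apply site_op_def pin_def cong: if_cong)
  qed
  finally show "pin a b c (R3 11 12 14 f) \<sigma> = (\<Sum>a'\<le>N. \<Sum>b'\<le>N. site_op 0 a b a' b' 14 (pin a' b' c f)) \<sigma>" .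
qed

lemma pin_R135: "a + c \<le> N \<Longrightarrow> pin a b c (R3 11 13 15 f) = (\<Sum>a'\<le>N. \<Sum>c'\<le>N. site_op 0 a c a' c' 15 (pin a' b c' f))"
proof (rule ext)
  fix \<sigma> :: "nat \<Rightarrow> nat"
  assume N: "a + c \<le> N"
  let ?s = "\<sigma>(11 := a, 12 := b, 13 := c)"
  have "pin a b c (R3 11 13 15 f) \<sigma> = R3 11 13 15 f ?s" by (simp add: pin_def)
  also have "\<dots> = (\<Sum>a'\<le>N. \<Sum>c'\<le>N. site_op 0 (?s 11) (?s 13) a' c' 15 (\<lambda>\<rho>. f (\<rho>(11 := a', 13 := c'))) ?s)"
    by (rule R3_site_op) (use N in auto)
  also have "\<dots> = (\<Sum>a'\<le>N. \<Sum>c'\<le>N. site_op 0 a c a' c' 15 (pin a' b c' f)) \<sigma>"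
  proof -
    have "?s(15 := d, 11 := a', 13 := c') = \<sigma>(15 := d, 11 := a', 12 := b, 13 := c')" for d a' c' by auto
    then show ?thesis by (simp add: sum_vec_apply site_op_def pin_def cong: if_cong)
  qed
  finally show "pin a b c (R3 11 13 15 f) \<sigma> = (\<Sum>a'\<le>N. \<Sum>c'\<le>N. site_op 0 a c a' c' 15 (pin a' b c' f)) \<sigma>" .
qed

lemma pin_R236: "b + c \<le> N \<Longrightarrow> pin a b c (R3 12 13 16 f) = (\<Sum>b'\<le>N. \<Sum>c'\<le>N. site_op 0 b c b' c' 16 (pin a b' c' f))"
proof (rule ext)
  fix \<sigma> :: "nat \<Rightarrow> nat"
  assume N: "b + c \<le> N"
  let ?s = "\<sigma>(11 := a, 12 := b, 13 := c)"
  have "pin a b c (R3 12 13 16 f) \<sigma> = R3 12 13 16 f ?s" by (simp add: pin_def)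
  also have "\<dots> = (\<Sum>b'\<le>N. \<Sum>c'\<le>N. site_op 0 (?s 12) (?s 13) b' c' 16 (\<lambda>\<rho>. f (\<rho>(12 := b', 13 := c'))) ?s)"
    by (rule R3_site_op) (use N in auto)
  also have "\<dots> = (\<Sum>b'\<le>N. \<Sum>c'\<le>N. site_op 0 b c b' c' 16 (pin a b' c' f)) \<sigma>"
  proof -
    have "?s(16 := d, 12 := b', 13 := c') = \<sigma>(16 := d, 11 := a, 12 := b', 13 := c')" for d b' c' by auto
    then show ?thesis by (simp add: sum_vec_apply site_op_def pin_def cong: if_cong)
  qed
  finally show "pin a b c (R3 12 13 16 f) \<sigma> = (\<Sum>b'\<le>N. \<Sum>c'\<le>N. site_op 0 b c b' c' 16 (pin a b' c' f)) \<sigma>" .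
qed

text \<open>
  The tetrahedron equation \<open>RRRR\<close> is applied to a vector that is concentrated on the lower labels
  \<open>i, j, k\<close>, and the result is read off at the upper labels \<open>a, b, c\<close>.
\<close>
lemma site_0:
  assumes N: "a + b + c \<le> N" and ijk: "i \<le> N" "j \<le> N" "k \<le> N"
  shows "site_left N 0 a b c i j k (RD g) = RD (site_right N 0 a b c i j k g)"
proof (rule ext)
  fix \<sigma> :: "nat \<Rightarrow> nat"
  define u v w where "u = \<sigma> 11" "v = \<sigma> 12" "w = \<sigma> 13"
  \<comment> \<open>pinning g to the labels of the evaluation point makes it independent of them\<close>
  define h where "h = pin u v w g"
  define f where "f = (\<lambda>\<rho>. if \<rho> 11 = i \<and> \<rho> 12 = j \<and> \<rho> 13 = k then h \<rho> else 0)"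
  have h: "pin a' b' c' h = h" for a' b' c' by (simp add: h_def pin_def)
  have pf: "pin a' b' c' f = (if a' = i then if b' = j then if c' = k then h else 0 else 0 else 0)" for a' b' c'
    using h[of a' b' c'] by (auto simp: f_def pin_def fun_eq_iff)
  have pRf: "pin a' b' c' (RD f) = (if a' = i then if b' = j then if c' = k then RD h else 0 else 0 else 0)" for a' b' c'
    unfolding pin_RD pf by (simp add: R3_lin)
  have iff: "(\<Sum>x\<le>N. \<Sum>y\<le>N. site_op e b1 b2 x y r (if x = x0 then if y = y0 then G else 0 else 0)) = site_op e b1 b2 x0 y0 r G"
    if "x0 \<le> N" "y0 \<le> N" for e b1 b2 r x0 y0 G
  proof -
    have "site_op e b1 b2 x y r (if P then G' else 0) = (if P then site_op e b1 b2 x y r G' else 0)" for x y P G'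
      by (simp add: site_op_lin)
    moreover have "(\<Sum>y\<le>N. if P then F y else 0) = (if P then \<Sum>y\<le>N. F y else 0)" for P and F :: "nat \<Rightarrow> 'k vec"
      by simp
    ultimately show ?thesis using that by simp
  qed
  have "pin a b c (RX f) = (\<Sum>a'\<le>N. \<Sum>b'\<le>N. site_op 0 a b a' b' 14 (pin a' b' c (R3 11 13 15 (R3 12 13 16 (RD f)))))"
    unfolding RX_def by (rule pin_R124) (use N in simp)
  also have "\<dots> = (\<Sum>a'\<le>N. \<Sum>b'\<le>N. site_op 0 a b a' b' 14 (\<Sum>c'\<le>N. site_op 0 a' c i c' 15 (site_op 0 b' c' j k 16 (RD h))))"
  proof (intro sum.cong refl site_op_cong)
    fix a' b' assume e: "a + b = a' + b'"
    have "pin a' b' c (R3 11 13 15 (R3 12 13 16 (RD f)))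
        = (\<Sum>i'\<le>N. \<Sum>c'\<le>N. site_op 0 a' c i' c' 15 (pin i' b' c' (R3 12 13 16 (RD f))))"
      by (rule pin_R135) (use N e in simp)
    also have "\<dots> = (\<Sum>i'\<le>N. \<Sum>c'\<le>N. site_op 0 a' c i' c' 15 (if i' = i then site_op 0 b' c' j k 16 (RD h) else 0))"
    proof (intro sum.cong refl site_op_cong)
      fix i' c' assume e': "a' + c = i' + c'"
      have "pin i' b' c' (R3 12 13 16 (RD f)) = (\<Sum>j'\<le>N. \<Sum>k'\<le>N. site_op 0 b' c' j' k' 16 (pin i' j' k' (RD f)))"
        by (rule pin_R236) (use N e e' in simp)
      then show "pin i' b' c' (R3 12 13 16 (RD f)) = (if i' = i then site_op 0 b' c' j k 16 (RD h) else 0)"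
        unfolding pRf using iff[OF ijk(2,3)] by (simp add: site_op_lin)
    qed
    also have "\<dots> = (\<Sum>i'\<le>N. if i' = i then (\<Sum>c'\<le>N. site_op 0 a' c i' c' 15 (site_op 0 b' c' j k 16 (RD h))) else 0)"
      by (intro sum.cong refl) (auto simp: site_op_lin)
    finally show "pin a' b' c (R3 11 13 15 (R3 12 13 16 (RD f))) = (\<Sum>c'\<le>N. site_op 0 a' c i c' 15 (site_op 0 b' c' j k 16 (RD h)))"
      using ijk by simp
  qed
  also have "\<dots> = site_left N 0 a b c i j k (RD h)" by (simp add: site_left_def site_op_sum)
  finally have L: "pin a b c (RX f) = site_left N 0 a b c i j k (RD h)" .
  have "pin a b c (R3 12 13 16 (R3 11 13 15 (R3 11 12 14 f)))
      = (\<Sum>b'\<le>N. \<Sum>c'\<le>N. site_op 0 b c b' c' 16 (pin a b' c' (R3 11 13 15 (R3 11 12 14 f))))"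
    by (rule pin_R236) (use N in simp)
  also have "\<dots> = (\<Sum>b'\<le>N. \<Sum>c'\<le>N. site_op 0 b c b' c' 16 (\<Sum>a'\<le>N. site_op 0 a c' a' k 15 (site_op 0 a' b' i j 14 h)))"
  proof (intro sum.cong refl site_op_cong)
    fix b' c' assume e: "b + c = b' + c'"
    have "pin a b' c' (R3 11 13 15 (R3 11 12 14 f))
        = (\<Sum>a'\<le>N. \<Sum>k'\<le>N. site_op 0 a c' a' k' 15 (pin a' b' k' (R3 11 12 14 f)))"
      by (rule pin_R135) (use N e in simp)
    also have "\<dots> = (\<Sum>a'\<le>N. \<Sum>k'\<le>N. site_op 0 a c' a' k' 15 (if k' = k then site_op 0 a' b' i j 14 h else 0))"
    proof (intro sum.cong refl site_op_cong)
      fix a' k' assume e': "a + c' = a' + k'"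
      have "pin a' b' k' (R3 11 12 14 f) = (\<Sum>i'\<le>N. \<Sum>j'\<le>N. site_op 0 a' b' i' j' 14 (pin i' j' k' f))"
        by (rule pin_R124) (use N e e' in simp)
      then show "pin a' b' k' (R3 11 12 14 f) = (if k' = k then site_op 0 a' b' i j 14 h else 0)"
        unfolding pf using iff[OF ijk(1,2)] by (simp add: site_op_lin)
    qed
    also have "\<dots> = (\<Sum>a'\<le>N. \<Sum>k'\<le>N. if k' = k then site_op 0 a c' a' k' 15 (site_op 0 a' b' i j 14 h) else 0)"
      by (intro sum.cong refl) (auto simp: site_op_lin)
    finally show "pin a b' c' (R3 11 13 15 (R3 11 12 14 f)) = (\<Sum>a'\<le>N. site_op 0 a c' a' k 15 (site_op 0 a' b' i j 14 h))"
      using ijk by simp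
  qed
  also have "\<dots> = (\<Sum>b'\<le>N. \<Sum>c'\<le>N. \<Sum>a'\<le>N. site_op 0 b c b' c' 16 (site_op 0 a c' a' k 15 (site_op 0 a' b' i j 14 h)))"
    by (simp add: site_op_sum)
  also have "\<dots> = (\<Sum>b'\<le>N. \<Sum>a'\<le>N. \<Sum>c'\<le>N. site_op 0 b c b' c' 16 (site_op 0 a c' a' k 15 (site_op 0 a' b' i j 14 h)))"
    by (intro sum.cong refl sum.swap)
  also have "\<dots> = site_right N 0 a b c i j k h" unfolding site_right_def by (rule sum.swap)
  finally have R: "pin a b c (RY f) = RD (site_right N 0 a b c i j k h)"
    unfolding RY_def pin_RD by simp
  have "site_left N 0 a b c i j k (RD h) = RD (site_right N 0 a b c i j k h)" using L R RRRR by simp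
  moreover have "site_left N 0 a b c i j k (RD h) = pin u v w (site_left N 0 a b c i j k (RD g))"
    by (simp add: site_left_def h_def pin_RD pin_sum pin_site_op)
  moreover have "RD (site_right N 0 a b c i j k h) = pin u v w (RD (site_right N 0 a b c i j k g))"
    by (simp add: site_right_def h_def pin_RD pin_sum pin_site_op)
  moreover have "pin u v w F \<sigma> = F \<sigma>" for F by (simp add: pin_def u_v_w_def)
  ultimately show "site_left N 0 a b c i j k (RD g) \<sigma> = RD (site_right N 0 a b c i j k g) \<sigma>" by metis
qed

lemma site:
  assumes "a + b + c \<le> N" "i \<le> N" "j \<le> N" "k \<le> N" "e \<le> 1" "N \<ge> 1"
  shows "site_left N e a b c i j k (RD g) = RD (site_right N e a b c i j k g)"
proof (cases e)
  case 0
  then show ?thesis using site_0 assms by simp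
next
  case (Suc m)
  then show ?thesis using site_1[of N] assms by simp
qed

end

section \<open>All sites\<close>

definition tuples :: "nat \<Rightarrow> nat \<Rightarrow> nat list set" where
  "tuples n N = {l. set l \<subseteq> {..N} \<and> length l = n}"

lemma finite_tuples: "finite (tuples n N)"
  unfolding tuples_def by (rule finite_lists_length_eq) simp

lemma tuples_0: "tuples 0 N = {[]}"
  by (auto simp: tuples_def)

lemma sum_tuples_Suc: "(\<Sum>l\<in>tuples (Suc n) N. F l) = (\<Sum>x\<le>N. \<Sum>l\<in>tuples n N. F (x # l))"
  for F :: "nat list \<Rightarrow> 'b::comm_monoid_add"
proof -
  have "tuples (Suc n) N = (\<lambda>(x, l). x # l) ` ({..N} \<times> tuples n N)"
    by (auto simp: tuples_def length_Suc_conv image_iff)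
  moreover have "inj_on (\<lambda>(x, l). x # l) ({..N} \<times> tuples n N)"
    by (auto simp: inj_on_def)
  ultimately have "(\<Sum>l\<in>tuples (Suc n) N. F l) = (\<Sum>(x, l)\<in>{..N} \<times> tuples n N. F (x # l))"
    by (simp add: sum.reindex case_prod_unfold)
  then show ?thesis by (simp add: sum.cartesian_product)
qed

context q_fock begin

primrec chain_op :: "nat list \<Rightarrow> label \<Rightarrow> label \<Rightarrow> label \<Rightarrow> label \<Rightarrow> nat \<Rightarrow> 'k vec \<Rightarrow> 'k vec" where
  "chain_op [] a b i j r g = g"
| "chain_op (e # es) a b i j r g = site_op e (hd a) (hd b) (hd i) (hd j) r (chain_op es (tl a) (tl b) (tl i) (tl j) r g)"

lemma chain_op_site_op: "r \<noteq> s \<Longrightarrow> chain_op es a b i j r (site_op e' a' b' i' j' s g) = site_op e' a' b' i' j' s (chain_op es a b i j r g)"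
  by (induction es arbitrary: a b i j) (simp_all add: site_op_comm[of r s])

definition chain_left where
  "chain_left N es a b c i j k g = (\<Sum>a'\<in>tuples (length es) N. \<Sum>b'\<in>tuples (length es) N. \<Sum>c'\<in>tuples (length es) N.
     chain_op es a b a' b' 14 (chain_op es a' c i c' 15 (chain_op es b' c' j k 16 g)))"

definition chain_right where
  "chain_right N es a b c i j k g = (\<Sum>a'\<in>tuples (length es) N. \<Sum>b'\<in>tuples (length es) N. \<Sum>c'\<in>tuples (length es) N.
     chain_op es b c b' c' 16 (chain_op es a c' a' k 15 (chain_op es a' b' i j 14 g)))"

lemma sum_swap3:
  fixes F :: "'b \<Rightarrow> 'c \<Rightarrow> 'b \<Rightarrow> 'c \<Rightarrow> 'b \<Rightarrow> 'c \<Rightarrow> 'k vec"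
  shows "(\<Sum>x\<in>A. \<Sum>l\<in>B. \<Sum>x'\<in>A. \<Sum>l'\<in>B. \<Sum>x''\<in>A. \<Sum>l''\<in>B. F x l x' l' x'' l'')
   = (\<Sum>x\<in>A. \<Sum>x'\<in>A. \<Sum>x''\<in>A. \<Sum>l\<in>B. \<Sum>l'\<in>B. \<Sum>l''\<in>B. F x l x' l' x'' l'')"
proof -
  have "(\<Sum>l\<in>B. \<Sum>x'\<in>A. \<Sum>l'\<in>B. \<Sum>x''\<in>A. \<Sum>l''\<in>B. F x l x' l' x'' l'')
      = (\<Sum>x'\<in>A. \<Sum>x''\<in>A. \<Sum>l\<in>B. \<Sum>l'\<in>B. \<Sum>l''\<in>B. F x l x' l' x'' l'')" for x
  proof -
    have "(\<Sum>l\<in>B. \<Sum>x'\<in>A. \<Sum>l'\<in>B. \<Sum>x''\<in>A. \<Sum>l''\<in>B. F x l x' l' x'' l'')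
      = (\<Sum>x'\<in>A. \<Sum>l\<in>B. \<Sum>l'\<in>B. \<Sum>x''\<in>A. \<Sum>l''\<in>B. F x l x' l' x'' l'')" by (rule sum.swap)
    also have "\<dots> = (\<Sum>x'\<in>A. \<Sum>l\<in>B. \<Sum>x''\<in>A. \<Sum>l'\<in>B. \<Sum>l''\<in>B. F x l x' l' x'' l'')"
      by (intro sum.cong refl sum.swap)
    also have "\<dots> = (\<Sum>x'\<in>A. \<Sum>x''\<in>A. \<Sum>l\<in>B. \<Sum>l'\<in>B. \<Sum>l''\<in>B. F x l x' l' x'' l'')"
      by (intro sum.cong refl sum.swap)
    finally show ?thesis .
  qed
  then show ?thesis by simp
qed

lemma chain_left_Nil: "chain_left N [] a b c i j k g = g" and chain_right_Nil: "chain_right N [] a b c i j k g = g"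
  by (simp_all add: chain_left_def chain_right_def tuples_0)

lemma chain_left_Cons: "chain_left N (e # es) a b c i j k g
  = site_left N e (hd a) (hd b) (hd c) (hd i) (hd j) (hd k) (chain_left N es (tl a) (tl b) (tl c) (tl i) (tl j) (tl k) g)"
  unfolding chain_left_def site_left_def by (simp only: list.size(4) One_nat_def add_Suc_right add_0_right sum_tuples_Suc sum_swap3)
    (simp add: chain_op_site_op site_op_sum)

lemma chain_right_Cons: "chain_right N (e # es) a b c i j k g
  = site_right N e (hd a) (hd b) (hd c) (hd i) (hd j) (hd k) (chain_right N es (tl a) (tl b) (tl c) (tl i) (tl j) (tl k) g)"
  unfolding chain_right_def site_right_def by (simp only: list.size(4) One_nat_def add_Suc_right add_0_right sum_tuples_Suc sum_swap3)
    (simp add: chain_op_site_op site_op_sum)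

text \<open>
  \<open>R_456\<close> passes one site at a time.
\<close>
theorem chain_left_RD:
  assumes "set es \<subseteq> {0, 1}" "N \<ge> 1"
    and "length a = length es" "length b = length es" "length c = length es"
    and "\<And>t. t < length es \<Longrightarrow> a ! t + b ! t + c ! t \<le> N"
    and "i \<in> tuples (length es) N" "j \<in> tuples (length es) N" "k \<in> tuples (length es) N"
  shows "chain_left N es a b c i j k (R3 14 15 16 g) = R3 14 15 16 (chain_right N es a b c i j k g)"
  using assms
proof (induction es arbitrary: a b c i j k)
  case Nil
  then show ?case by (simp add: chain_left_Nil chain_right_Nil)
next
  case (Cons e es)
  obtain a0 a' b0 b' c0 c' where abc: "a = a0 # a'" "b = b0 # b'" "c = c0 # c'"
    using Cons.prems(3-5) by (auto simp: length_Suc_conv)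
  obtain i0 i' j0 j' k0 k' where ijk: "i = i0 # i'" "j = j0 # j'" "k = k0 # k'"
    using Cons.prems(7-9) by (auto simp: length_Suc_conv tuples_def)
  have IH: "chain_left N es a' b' c' i' j' k' (R3 14 15 16 g) = R3 14 15 16 (chain_right N es a' b' c' i' j' k' g)"
  proof (rule Cons.IH)
    show "a' ! t + b' ! t + c' ! t \<le> N" if "t < length es" for t
      using Cons.prems(6)[of "Suc t"] that by (simp add: abc)
  qed (use Cons.prems in \<open>auto simp: abc ijk tuples_def\<close>)
  have "a0 + b0 + c0 \<le> N" using Cons.prems(6)[of 0] by (simp add: abc)
  then show ?case using Cons.prems unfolding chain_left_Cons chain_right_Cons abc ijk list.sel IH
    by (intro site) (auto simp: tuples_def ijk)
qed

text \<open>
  By conservation the auxiliary occupation numbers along the chain are determined by the first one and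
  the outer labels, so the sums over the \<open>c\<close> in the definition of the matrix elements have at most one
  nonzero term. The truncated subtraction does no harm: where it takes effect the weight vanishes.
\<close>
primrec path :: "label \<Rightarrow> label \<Rightarrow> nat \<Rightarrow> nat \<Rightarrow> nat" where
  "path b j m 0 = m"
| "path b j m (Suc t) = b ! t + path b j m t - j ! t"

lemma path_Cons: "path (b # bs) (j # js) m (Suc t) = path bs js (b + m - j) t"
  by (induction t) simp_all

definition pweight where
  "pweight es a b i j P = (\<Prod>t<length es. scrS q (es ! t) (a ! t) (b ! t) (P t) (i ! t) (j ! t) (P (Suc t)))"

lemma site_op_alt: "site_op e a b i j r g \<sigma> = scrS q e a b (\<sigma> r) i j (b + \<sigma> r - j) * g (\<sigma>(r := b + \<sigma> r - j))"
proof (cases "j \<le> b + \<sigma> r")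
  case False
  then have "scrS q e a b (\<sigma> r) i j (b + \<sigma> r - j) = 0"
    using scrS_conservation(2)[of q e a b "\<sigma> r" i j "b + \<sigma> r - j"] by linarith
  then show ?thesis by (simp add: site_op_def)
qed (simp add: site_op_def)

lemma chain_op_path:
  assumes "length a = length es" "length b = length es" "length i = length es" "length j = length es"
  shows "chain_op es a b i j r g \<sigma> = pweight es a b i j (path b j (\<sigma> r)) * g (\<sigma>(r := path b j (\<sigma> r) (length es)))"
  using assms
proof (induction es arbitrary: a b i j \<sigma>)
  case Nil
  then show ?case by (simp add: pweight_def)
next
  case (Cons e es)
  obtain a0 a' b0 b' i0 i' j0 j' where l: "a = a0 # a'" "b = b0 # b'" "i = i0 # i'" "j = j0 # j'"
    using Cons.prems by (auto simp: length_Suc_conv)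
  let ?m = "b0 + \<sigma> r - j0"
  have "chain_op (e # es) a b i j r g \<sigma> = scrS q e a0 b0 (\<sigma> r) i0 j0 ?m * chain_op es a' b' i' j' r g (\<sigma>(r := ?m))"
    by (simp add: l site_op_alt)
  also have "chain_op es a' b' i' j' r g (\<sigma>(r := ?m)) = pweight es a' b' i' j' (path b' j' ?m) * g (\<sigma>(r := path b' j' ?m (length es)))"
    using Cons.prems by (subst Cons.IH) (auto simp: l)
  also have "pweight (e # es) a b i j (path b j (\<sigma> r)) = scrS q e a0 b0 (\<sigma> r) i0 j0 ?m * pweight es a' b' i' j' (path b' j' ?m)"
    unfolding pweight_def l list.size(4) One_nat_def add_Suc_right add_0_right
    by (subst prod.lessThan_Suc_shift) (simp only: path_Cons path.simps(1) nth_Cons_0 nth_Cons_Suc)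
  moreover have "path b j (\<sigma> r) (length (e # es)) = path b' j' ?m (length es)"
    by (simp add: l path_Cons del: path.simps(2))
  ultimately show ?case by (simp only: fun_upd_upd mult.assoc)
qed

lemma pweight_cong: "(\<And>t. t \<le> length es \<Longrightarrow> P t = Q t) \<Longrightarrow> pweight es a b i j P = pweight es a b i j Q"
  unfolding pweight_def by (intro prod.cong) simp_all

text \<open>
  A nonzero factor at each site forces the conservation law there.
\<close>
lemma pweight_path:
  "pweight es a b i j P = (if \<forall>t\<le>length es. P t = path b j (P 0) t then pweight es a b i j (path b j (P 0)) else 0)"
proof (cases "\<forall>t\<le>length es. P t = path b j (P 0) t")
  case True
  then have "pweight es a b i j P = pweight es a b i j (path b j (P 0))"
    by (intro pweight_cong) blast
  then show ?thesis unfolding if_P[OF True] .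
next
  case False
  have "pweight es a b i j P = 0"
  proof (rule ccontr)
    assume nz: "pweight es a b i j P \<noteq> 0"
    have "P t = path b j (P 0) t" if "t \<le> length es" for t
      using that
    proof (induction t)
      case (Suc t)
      have "scrS q (es ! t) (a ! t) (b ! t) (P t) (i ! t) (j ! t) (P (Suc t)) \<noteq> 0"
        using nz Suc.prems by (auto simp: pweight_def)
      from scrS_conservation(2)[OF this] have "P (Suc t) = b ! t + P t - j ! t" by simp
      then show ?case using Suc.IH Suc.prems by (simp only: path.simps(2))
    qed simp
    then show False using False by blast
  qed
  then show ?thesis unfolding if_not_P[OF False] .
qed

lemma Sum_any_single:
  assumes "\<And>c. c \<noteq> c0 \<Longrightarrow> F c = 0"
  shows "Sum_any F = (F c0 :: 'k)"
proof -
  define v where "v = F c0"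
  have "F = (\<lambda>c. v when c = c0)" using assms by (auto simp: fun_eq_iff when_def v_def)
  then have "Sum_any F = Sum_any (\<lambda>c. v when c = c0)" by (rule arg_cong)
  also have "\<dots> = v" by (rule Sum_any_when_equal)
  finally show ?thesis by (simp only: v_def)
qed

lemma sum_weight_tr:
  assumes "es \<noteq> []"
  shows "Sum_any (\<lambda>c. weight_tr q es a b i j c when length c = length es \<and> c ! 0 = m)
    = pweight es a b i j (path b j m) * (if path b j m (length es) = m then 1 else 0)"
proof -
  let ?n = "length es" and ?p = "path b j m"
  define c0 where "c0 = map ?p [0..<?n]"
  have n: "?n > 0" using assms by simp
  have w: "weight_tr q es a b i j c = pweight es a b i j (\<lambda>t. c ! (t mod ?n))" for c
    unfolding weight_tr_def pweight_def Let_def by (rule prod.cong) auto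
  have "weight_tr q es a b i j c = 0" if "length c = ?n" "c ! 0 = m" "c \<noteq> c0" for c
  proof (rule ccontr)
    assume "weight_tr q es a b i j c \<noteq> 0"
    then have "\<forall>t\<le>?n. c ! (t mod ?n) = ?p t"
      using pweight_path[of es a b i j "\<lambda>t. c ! (t mod ?n)"] that(2) by (auto simp: w split: if_splits)
    then have "c ! t = ?p t" if "t < ?n" for t using that by (metis less_imp_le mod_less)
    then have "c = c0" using \<open>length c = ?n\<close> by (auto simp: c0_def intro!: nth_equalityI)
    then show False using that by simp
  qed
  then have "Sum_any (\<lambda>c. weight_tr q es a b i j c when length c = ?n \<and> c ! 0 = m)
     = (weight_tr q es a b i j c0 when length c0 = ?n \<and> c0 ! 0 = m)"
    by (intro Sum_any_single) (auto simp: when_def)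
  also have "\<dots> = weight_tr q es a b i j c0" using n by (simp add: c0_def when_def)
  also have "\<dots> = (if \<forall>t\<le>?n. c0 ! (t mod ?n) = ?p t then pweight es a b i j ?p else 0)"
  proof -
    have "c0 ! (0 mod ?n) = m" using n by (simp add: c0_def)
    then show ?thesis using pweight_path[of es a b i j "\<lambda>t. c0 ! (t mod ?n)"] by (simp only: w)
  qed
  also have "(\<forall>t\<le>?n. c0 ! (t mod ?n) = ?p t) \<longleftrightarrow> ?p ?n = m"
  proof -
    have "c0 ! (t mod ?n) = ?p t" if "t < ?n" for t using that by (simp add: c0_def)
    moreover have "c0 ! (?n mod ?n) = m" using n by (simp add: c0_def)
    ultimately show ?thesis by (metis le_neq_implies_less order_refl)
  qed
  finally show ?thesis by simp
qed

lemma sum_weight_st: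
  assumes "es \<noteq> []" "t > 0"
  shows "Sum_any (\<lambda>c. weight_st q s t es a b i j c when length c = length es + 1 \<and> c ! 0 = m)
    = qpoch q 2 (s * m) / qpoch q (s\<^sup>2) m * (pweight es a b i j (path b j (s * m)) * chi t (path b j (s * m) (length es)))"
proof -
  let ?n = "length es" and ?p = "path b j (s * m)"
  let ?w = "qpoch q 2 (s * m) / qpoch q (s\<^sup>2) m * (pweight es a b i j ?p * chi t (?p ?n))"
  define P where "P c k = (if k = 0 then s * c ! 0 else if k = ?n then t * c ! ?n else c ! k)" for c :: "nat list" and k
  define c0 where "c0 = map (\<lambda>k. if k = 0 then m else if k = ?n then ?p ?n div t else ?p k) [0..<?n + 1]"
  have n: "?n > 0" using assms by simp
  have w: "weight_st q s t es a b i j c = qpoch q 2 (s * c ! 0) / (qpoch q (s\<^sup>2) (c ! 0) * qpoch q (t\<^sup>2) (c ! ?n)) * pweight es a b i j (P c)" for c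
    unfolding weight_st_def pweight_def Let_def P_def
    by (intro arg_cong2[where f = "(*)"] prod.cong refl) auto
  have P0: "P c 0 = s * m" if "c ! 0 = m" for c using that by (simp add: P_def)
  have z: "weight_st q s t es a b i j c = (?w when c = c0)" if c: "length c = ?n + 1" "c ! 0 = m" for c
  proof (cases "\<forall>k\<le>?n. P c k = ?p k")
    case True
    then have tn: "t * c ! ?n = ?p ?n" using n by (auto simp: P_def)
    have "c = c0"
    proof (rule nth_equalityI)
      fix k assume "k < length c"
      then have k: "k \<le> ?n" using c by simp
      show "c ! k = c0 ! k" using True[rule_format, OF k] k c(2) tn assms(2) n
        by (auto simp: c0_def P_def nth_append simp flip: tn)
    qed (use c in \<open>simp add: c0_def\<close>)
    moreover have "chi t (?p ?n) = 1 / qpoch q (t\<^sup>2) (c ! ?n)"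
      unfolding chi_def tn[symmetric] using assms(2) by simp
    moreover have "pweight es a b i j (P c) = pweight es a b i j ?p"
      using pweight_path[of es a b i j "P c"] True by (simp add: P0[OF c(2)])
    ultimately show ?thesis unfolding w c(2) by (simp add: when_def)
  next
    case False
    from pweight_path[of es a b i j "P c", unfolded P0[OF c(2)] if_not_P[OF False]]
    have 0: "weight_st q s t es a b i j c = 0" by (simp add: w)
    have "chi t (?p ?n) = 0 \<or> pweight es a b i j ?p = 0" if "c = c0"
    proof (rule ccontr)
      assume "\<not> ?thesis"
      then have "t dvd ?p ?n" by (auto simp: chi_def split: if_splits)
      then have "P c k = ?p k" if "k \<le> ?n" for k
        using that n \<open>c = c0\<close> by (auto simp: P_def c0_def nth_append)
      then show False using False by blast
    qed
    then show ?thesis using 0 by (auto simp: when_def)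
  qed
  have "Sum_any (\<lambda>c. weight_st q s t es a b i j c when length c = ?n + 1 \<and> c ! 0 = m)
     = (weight_st q s t es a b i j c0 when length c0 = ?n + 1 \<and> c0 ! 0 = m)"
    by (rule Sum_any_single) (auto simp: when_def z)
  moreover have "length c0 = ?n + 1" "c0 ! 0 = m" using n by (simp_all add: c0_def nth_append del: upt_Suc)
  ultimately show ?thesis using z[of c0] by (simp add: when_def)
qed

end

context q_fock begin

interpretation D: triple q 14 15 16 by (rule triple_I) auto

section \<open>Closing the auxiliary spaces\<close>

text \<open>
  The points and product vectors at which the auxiliary spaces \<open>14, 15, 16\<close> are closed up.
\<close>
definition point :: "nat \<Rightarrow> nat \<Rightarrow> nat \<Rightarrow> nat \<Rightarrow> nat" where
  "point a b c = (\<lambda>_. 0)(14 := a, 15 := b, 16 := c)"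

lemma point_simps [simp]: "point a b c 14 = a" "point a b c 15 = b" "point a b c 16 = c"
  by (simp_all add: point_def)

definition prod_vec :: "(nat \<Rightarrow> 'k) \<Rightarrow> (nat \<Rightarrow> 'k) \<Rightarrow> (nat \<Rightarrow> 'k) \<Rightarrow> 'k vec" where
  "prod_vec f g h = (\<lambda>\<sigma>. f (\<sigma> 14) * g (\<sigma> 15) * h (\<sigma> 16))"

definition chain_elt :: "nat list \<Rightarrow> label \<Rightarrow> label \<Rightarrow> label \<Rightarrow> label \<Rightarrow> nat \<Rightarrow> (nat \<Rightarrow> 'k) \<Rightarrow> 'k" where
  "chain_elt es a b i j u \<phi> = pweight es a b i j (path b j u) * \<phi> (path b j u (length es))"

lemma chain_left_point:
  assumes "length a = length es" "length b = length es" "length c = length es"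
    "length i = length es" "length j = length es" "length k = length es"
  shows "chain_left N es a b c i j k (prod_vec f g h) (point u v w) =
    (\<Sum>a'\<in>tuples (length es) N. \<Sum>b'\<in>tuples (length es) N. \<Sum>c'\<in>tuples (length es) N.
      chain_elt es a b a' b' u f * chain_elt es a' c i c' v g * chain_elt es b' c' j k w h)"
  unfolding chain_left_def sum_vec_apply
proof (intro sum.cong refl)
  fix a' b' c' assume "a' \<in> tuples (length es) N" "b' \<in> tuples (length es) N" "c' \<in> tuples (length es) N"
  then show "chain_op es a b a' b' 14 (chain_op es a' c i c' 15 (chain_op es b' c' j k 16 (prod_vec f g h))) (point u v w)
     = chain_elt es a b a' b' u f * chain_elt es a' c i c' v g * chain_elt es b' c' j k w h"
    using assms by (simp add: tuples_def chain_op_path chain_elt_def prod_vec_def mult_ac)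
qed

lemma chain_right_point:
  assumes "length a = length es" "length b = length es" "length c = length es"
    "length i = length es" "length j = length es" "length k = length es"
  shows "chain_right N es a b c i j k (prod_vec f g h) (point u v w) =
    (\<Sum>a'\<in>tuples (length es) N. \<Sum>b'\<in>tuples (length es) N. \<Sum>c'\<in>tuples (length es) N.
      chain_elt es a' b' i j u f * chain_elt es a c' a' k v g * chain_elt es b c b' c' w h)"
  unfolding chain_right_def sum_vec_apply
proof (intro sum.cong refl)
  fix a' b' c' assume "a' \<in> tuples (length es) N" "b' \<in> tuples (length es) N" "c' \<in> tuples (length es) N"
  then show "chain_op es b c b' c' 16 (chain_op es a c' a' k 15 (chain_op es a' b' i j 14 (prod_vec f g h))) (point u v w)
     = chain_elt es a' b' i j u f * chain_elt es a c' a' k v g * chain_elt es b c b' c' w h"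
    using assms by (simp add: tuples_def chain_op_path chain_elt_def prod_vec_def mult_ac)
qed

lemma chain_op_lin:
  "chain_op es a b i j r (f + g) = chain_op es a b i j r f + chain_op es a b i j r g"
  "chain_op es a b i j r (sc c f) = sc c (chain_op es a b i j r f)"
  by (induction es arbitrary: a b i j) (simp_all add: site_op_lin)

lemma sc_sum: "sc c (\<Sum>x\<in>S. F x) = (\<Sum>x\<in>S. sc c (F x))"
  by (rule ext) (simp add: sum_vec_apply sum_distrib_left)

lemma chain_right_lin:
  "chain_right N es a b c i j k (f + g) = chain_right N es a b c i j k f + chain_right N es a b c i j k g"
  "chain_right N es a b c i j k (sc r f) = sc r (chain_right N es a b c i j k f)"
  unfolding chain_right_def by (simp_all only: chain_op_lin sum.distrib sc_sum)

text \<open>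
  Matrix elements of \<open>R\<close> on the finite-dimensional space with \<open>c4 + c5 = M\<close> and \<open>c5 + c6 = L\<close>, indexed
  by \<open>c5\<close>.
\<close>
definition R_elt :: "nat \<Rightarrow> nat \<Rightarrow> nat \<Rightarrow> nat \<Rightarrow> 'k" where
  "R_elt M L p j = scrS0 q (M - p) p (L - p) (M - j) j (L - j)"

lemma RD_point:
  assumes "p \<le> min M L"
  shows "R3 14 15 16 f (point (M - p) p (L - p)) = (\<Sum>j\<le>min M L. R_elt M L p j * f (point (M - j) j (L - j)))"
proof -
  have 1: "p + min (M - p) (L - p) = min M L" "M - p + p = M" "p + (L - p) = L" using assms by auto
  have 2: "(point (M - p) p (L - p))(14 := M - j, 15 := j, 16 := L - j) = point (M - j) j (L - j)" for j
    by (auto simp: point_def)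
  show ?thesis unfolding R3_def point_simps 1 2 R_elt_def ..
qed

lemma R_elt_R_elt:
  assumes "p \<le> min M L" "j \<le> min M L"
  shows "(\<Sum>r\<le>min M L. R_elt M L p r * R_elt M L r j) = (if p = j then 1 else 0)"
proof -
  define f where "f = prod_vec (\<lambda>u. if u = M - j then 1 else 0) (\<lambda>u. if u = j then 1 else 0) (\<lambda>u. if u = L - j then 1 else 0)"
  have f: "f (point (M - r) r (L - r)) = (if r = j then 1 else 0)" for r
    by (simp add: f_def prod_vec_def)
  have "R3 14 15 16 f (point (M - r) r (L - r)) = R_elt M L r j" if "r \<le> min M L" for r
    using assms that unfolding RD_point[OF that] f by (simp add: if_distrib[of "(*) _"] cong: if_cong)
  then have "R3 14 15 16 (R3 14 15 16 f) (point (M - p) p (L - p)) = (\<Sum>r\<le>min M L. R_elt M L p r * R_elt M L r j)"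
    unfolding RD_point[OF assms(1)] by (intro sum.cong) auto
  then show ?thesis unfolding D.R_R f by simp
qed

lemma R_elt_sym:
  assumes "p \<le> min M L" "j \<le> min M L"
  shows "qpoch q 2 (M - p) * qpoch q 2 p * qpoch q 2 (L - p) * R_elt M L p j
    = qpoch q 2 (M - j) * qpoch q 2 j * qpoch q 2 (L - j) * R_elt M L j p"
proof -
  have off: "\<forall>r. r \<notin> {14, 15, 16} \<longrightarrow> point a b c r = point a' b' c' r" for a b c a' b' c'
    by (auto simp: point_def)
  show ?thesis
    using D.R_sym[of "point (M - p) p (L - p)" "point (M - j) j (L - j)"]
    unfolding D.R_delta if_P[OF off] D.weight_def point_simps R_elt_def .
qed

text \<open>
  The coefficient of \<open>x^M y^L\<close> in a closed-up operator does not change when the operator is conjugated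
  by \<open>R_456\<close>. The closing is given by a weight \<open>w\<close> on the left, by the occupation number \<open>u m\<close> that belongs
  to the power \<open>m\<close> of the spectral parameter, and by the vector \<open>\<phi> m\<close> on the right; the trace has \<open>u m = m\<close>
  and the basis vector \<open>\<phi> m\<close>.
\<close>
definition invariant :: "(nat \<Rightarrow> 'k) \<Rightarrow> (nat \<Rightarrow> nat) \<Rightarrow> (nat \<Rightarrow> nat \<Rightarrow> 'k) \<Rightarrow> bool" where
  "invariant w u \<phi> \<longleftrightarrow> (\<forall>F G M L. (\<forall>g. F (R3 14 15 16 g) = R3 14 15 16 (G g)) \<longrightarrow>
     (\<forall>f g. G (f + g) = G f + G g) \<longrightarrow> (\<forall>r f. G (sc r f) = sc r (G f)) \<longrightarrow>
     (\<Sum>p\<le>min M L. w (M - p) * w p * w (L - p) * F (prod_vec (\<phi> (M - p)) (\<phi> p) (\<phi> (L - p))) (point (u (M - p)) (u p) (u (L - p))))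
     = (\<Sum>p\<le>min M L. w (M - p) * w p * w (L - p) * G (prod_vec (\<phi> (M - p)) (\<phi> p) (\<phi> (L - p))) (point (u (M - p)) (u p) (u (L - p)))))"

definition kron :: "nat \<Rightarrow> nat \<Rightarrow> 'k" where
  "kron m u = (if u = m then 1 else 0)"

lemma RD_kron:
  assumes "p \<le> min M L"
  shows "R3 14 15 16 (prod_vec (kron (M - p)) (kron p) (kron (L - p)))
    = (\<Sum>r\<le>min M L. sc (R_elt M L r p) (prod_vec (kron (M - r)) (kron r) (kron (L - r))))"
proof (rule ext)
  fix \<sigma> :: "nat \<Rightarrow> nat"
  let ?v = "\<lambda>p. prod_vec (kron (M - p)) (kron p) (kron (L - p))"
  let ?s = "\<lambda>j. \<sigma>(14 := \<sigma> 14 + \<sigma> 15 - j, 15 := j, 16 := \<sigma> 15 + \<sigma> 16 - j)"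
  show "R3 14 15 16 (?v p) \<sigma> = (\<Sum>r\<le>min M L. sc (R_elt M L r p) (?v r)) \<sigma>"
  proof (cases "\<sigma> 14 + \<sigma> 15 = M \<and> \<sigma> 15 + \<sigma> 16 = L")
    case True
    then have "?v p (?s j) = (if j = p then 1 else 0)" for j by (simp add: prod_vec_def kron_def)
    moreover have "\<sigma> 15 + min (\<sigma> 14) (\<sigma> 16) = min M L" using True by auto
    ultimately have "R3 14 15 16 (?v p) \<sigma> = scrS0 q (\<sigma> 14) (\<sigma> 15) (\<sigma> 16) (M - p) p (L - p)"
      unfolding R3_def using True assms by (simp add: if_distrib[of "(*) _"] cong: if_cong)
    also have "\<dots> = R_elt M L (\<sigma> 15) p" using True by (auto simp: R_elt_def)
    also have "\<dots> = (\<Sum>r\<le>min M L. if r = \<sigma> 15 then R_elt M L r p else 0)"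
      using True by simp
    also have "\<dots> = (\<Sum>r\<le>min M L. R_elt M L r p * ?v r \<sigma>)"
      by (rule sum.cong) (use True in \<open>auto simp: prod_vec_def kron_def\<close>)
    finally show ?thesis by (simp add: sum_vec_apply)
  next
    case False
    have "?v p (?s j) = 0" if "j \<le> \<sigma> 15 + min (\<sigma> 14) (\<sigma> 16)" for j
      using False that assms by (auto simp: prod_vec_def kron_def)
    then have "R3 14 15 16 (?v p) \<sigma> = 0" unfolding R3_def by (intro sum.neutral) auto
    moreover have "?v r \<sigma> = 0" if "r \<le> min M L" for r
      using False that by (auto simp: prod_vec_def kron_def)
    then have "(\<Sum>r\<le>min M L. sc (R_elt M L r p) (?v r)) \<sigma> = 0"
      unfolding sum_vec_apply by (intro sum.neutral) auto
    ultimately show ?thesis by simp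
  qed
qed

lemma lin_sum:
  assumes "\<forall>f g. G (f + g) = G f + G g" "\<forall>r f. G (sc r f) = sc r (G f)" "finite S"
  shows "G (\<Sum>x\<in>S. sc (c x) (F x)) = (\<Sum>x\<in>S. sc (c x) (G (F x) :: 'k vec))"
  using assms(3)
proof (induction S rule: finite_induct)
  case empty
  have z: "sc 0 f = 0" for f by (simp add: fun_eq_iff sc_def)
  have "G (sc 0 0) = sc 0 (G 0)" using assms(2) by blast
  then show ?case unfolding sum.empty z .
next
  case (insert x S)
  have "G (\<Sum>x\<in>insert x S. sc (c x) (F x)) = G (sc (c x) (F x) + (\<Sum>x\<in>S. sc (c x) (F x)))"
    by (simp only: sum.insert[OF insert(1,2)])
  also have "\<dots> = sc (c x) (G (F x)) + (\<Sum>x\<in>S. sc (c x) (G (F x)))"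
    by (simp only: assms(1,2)[rule_format] insert)
  also have "\<dots> = (\<Sum>x\<in>insert x S. sc (c x) (G (F x)))"
    by (simp only: sum.insert[OF insert(1,2)])
  finally show ?case .
qed

text \<open>
  The trace over each weight space is cyclic, and \<open>R\<close> is its own inverse there.
\<close>
lemma invariant_tr: "invariant (\<lambda>_. 1) (\<lambda>m. m) kron"
  unfolding invariant_def
proof (intro allI impI)
  fix F G :: "'k vec \<Rightarrow> 'k vec" and M L
  assume FG: "\<forall>g. F (R3 14 15 16 g) = R3 14 15 16 (G g)"
    and G: "\<forall>f g. G (f + g) = G f + G g" "\<forall>r f. G (sc r f) = sc r (G f)"
  let ?I = "{..min M L}" and ?v = "\<lambda>p. prod_vec (kron (M - p)) (kron p) (kron (L - p))" and ?s = "\<lambda>p. point (M - p) p (L - p)"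
  have "F (?v p) (?s p) = (\<Sum>j\<in>?I. \<Sum>r\<in>?I. R_elt M L r p * R_elt M L p j * G (?v r) (?s j))" if p: "p \<in> ?I" for p
  proof -
    have "F (?v p) = R3 14 15 16 (G (R3 14 15 16 (?v p)))"
      using FG[rule_format, of "R3 14 15 16 (?v p)"] by (simp add: D.R_R)
    also have "R3 14 15 16 (?v p) = (\<Sum>r\<in>?I. sc (R_elt M L r p) (?v r))" by (rule RD_kron) (use p in simp)
    also have "G \<dots> = (\<Sum>r\<in>?I. sc (R_elt M L r p) (G (?v r)))" by (rule lin_sum[OF G]) simp
    finally have "F (?v p) (?s p) = R3 14 15 16 (\<Sum>r\<in>?I. sc (R_elt M L r p) (G (?v r))) (?s p)" by simp
    also have "\<dots> = (\<Sum>j\<in>?I. R_elt M L p j * (\<Sum>r\<in>?I. R_elt M L r p * G (?v r) (?s j)))"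
      using p by (subst RD_point) (simp_all add: sum_vec_apply)
    also have "\<dots> = (\<Sum>j\<in>?I. \<Sum>r\<in>?I. R_elt M L r p * R_elt M L p j * G (?v r) (?s j))"
      by (simp add: sum_distrib_left mult_ac)
    finally show ?thesis .
  qed
  then have "(\<Sum>p\<in>?I. F (?v p) (?s p)) = (\<Sum>p\<in>?I. \<Sum>j\<in>?I. \<Sum>r\<in>?I. R_elt M L r p * R_elt M L p j * G (?v r) (?s j))"
    by (intro sum.cong) auto
  also have "\<dots> = (\<Sum>j\<in>?I. \<Sum>p\<in>?I. \<Sum>r\<in>?I. R_elt M L r p * R_elt M L p j * G (?v r) (?s j))" by (rule sum.swap)
  also have "\<dots> = (\<Sum>j\<in>?I. \<Sum>r\<in>?I. \<Sum>p\<in>?I. R_elt M L r p * R_elt M L p j * G (?v r) (?s j))"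
    by (intro sum.cong refl sum.swap)
  also have "\<dots> = (\<Sum>j\<in>?I. \<Sum>r\<in>?I. (if r = j then G (?v r) (?s j) else 0))"
    unfolding sum_distrib_right[symmetric] by (intro sum.cong refl) (auto simp: R_elt_R_elt)
  also have "\<dots> = (\<Sum>j\<in>?I. G (?v j) (?s j))"
    by (rule sum.cong) auto
  finally show "(\<Sum>p\<le>min M L. 1 * 1 * 1 * F (?v p) (?s p)) = (\<Sum>p\<le>min M L. 1 * 1 * 1 * G (?v p) (?s p))" by simp
qed

lemma chi3_prod_vec: "D.chi3 t = prod_vec (chi t) (chi t) (chi t)"
  by (rule ext) (simp add: D.chi3_def prod_vec_def)

text \<open>
  By \<open>R_sym\<close> the left eigenvector property is the transpose of \<open>R_chi3\<close>.
\<close>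
lemma bra_RD:
  assumes "s \<in> {1, 2}"
  shows "(\<Sum>p\<le>min M L. prod_vec (chi s) (chi s) (chi s) (point (M - p) p (L - p)) * (qpoch q 2 (M - p) * qpoch q 2 p * qpoch q 2 (L - p)) *
      R3 14 15 16 h (point (M - p) p (L - p)))
   = (\<Sum>p\<le>min M L. prod_vec (chi s) (chi s) (chi s) (point (M - p) p (L - p)) * (qpoch q 2 (M - p) * qpoch q 2 p * qpoch q 2 (L - p)) *
      h (point (M - p) p (L - p)))"
proof -
  let ?I = "{..min M L}" and ?s = "\<lambda>p. point (M - p) p (L - p)" and ?X = "prod_vec (chi s) (chi s) (chi s)"
  let ?Q = "\<lambda>p. qpoch q 2 (M - p) * qpoch q 2 p * qpoch q 2 (L - p)"
  have "(\<Sum>p\<in>?I. ?X (?s p) * ?Q p * R3 14 15 16 h (?s p))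
      = (\<Sum>p\<in>?I. \<Sum>j\<in>?I. ?X (?s p) * (?Q p * R_elt M L p j) * h (?s j))"
    by (intro sum.cong refl) (simp add: RD_point sum_distrib_left mult.assoc)
  also have "\<dots> = (\<Sum>p\<in>?I. \<Sum>j\<in>?I. ?X (?s p) * (?Q j * R_elt M L j p) * h (?s j))"
    by (intro sum.cong refl) (simp add: R_elt_sym)
  also have "\<dots> = (\<Sum>j\<in>?I. \<Sum>p\<in>?I. ?X (?s p) * (?Q j * R_elt M L j p) * h (?s j))" by (rule sum.swap)
  also have "\<dots> = (\<Sum>j\<in>?I. R3 14 15 16 ?X (?s j) * ?Q j * h (?s j))"
    by (intro sum.cong refl) (simp add: RD_point sum_distrib_left sum_distrib_right mult_ac)
  also have "R3 14 15 16 ?X = ?X" using D.R_chi3[OF assms] by (simp add: chi3_prod_vec)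
  finally show ?thesis .
qed

text \<open>
  On the left the sum over \<open>c5\<close> is extended from multiples of \<open>s\<close> to all values, where \<open>chi s\<close> vanishes;
  then \<open>bra_RD\<close> removes \<open>R\<close> there, and \<open>R_chi3\<close> inserts it on the right.
\<close>
lemma invariant_st:
  assumes s: "s \<in> {1, 2}" and t: "t \<in> {1, 2}"
  shows "invariant (\<lambda>m. qpoch q 2 (s * m) / qpoch q (s\<^sup>2) m) (\<lambda>m. s * m) (\<lambda>_. chi t)"
  unfolding invariant_def
proof (intro allI impI)
  fix F G :: "'k vec \<Rightarrow> 'k vec" and M L
  assume FG: "\<forall>g. F (R3 14 15 16 g) = R3 14 15 16 (G g)"
  let ?w = "\<lambda>m. qpoch q 2 (s * m) / qpoch q (s\<^sup>2) m" and ?X = "prod_vec (chi t) (chi t) (chi t)"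
  have s0: "s > 0" using s by auto
  define B where "B h = (\<Sum>p\<le>min M L. ?w (M - p) * ?w p * ?w (L - p) * h (point (s * (M - p)) (s * p) (s * (L - p))))" for h :: "'k vec"
  define T where "T h P = prod_vec (chi s) (chi s) (chi s) (point (s * M - P) P (s * L - P))
      * (qpoch q 2 (s * M - P) * qpoch q 2 P * qpoch q 2 (s * L - P)) * h (point (s * M - P) P (s * L - P))" for h :: "'k vec" and P
  have wch: "?w m = chi s (s * m) * qpoch q 2 (s * m)" for m using s0 by (simp add: chi_def)
  have B: "B h = (\<Sum>P\<le>min (s * M) (s * L). T h P)" for h
  proof -
    have "B h = (\<Sum>p\<le>min M L. T h (s * p))"
      unfolding B_def T_def wch prod_vec_def point_simps diff_mult_distrib2[symmetric] by (intro sum.cong refl) (simp add: mult_ac)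
    also have "\<dots> = (\<Sum>P\<in>(*) s ` {..min M L}. T h P)"
      using s0 by (subst sum.reindex) (auto simp: inj_on_def)
    also have "\<dots> = (\<Sum>P\<le>min (s * M) (s * L). T h P)"
    proof (rule sum.mono_neutral_left)
      show "(*) s ` {..min M L} \<subseteq> {..min (s * M) (s * L)}" by auto
      show "\<forall>P\<in>{..min (s * M) (s * L)} - (*) s ` {..min M L}. T h P = 0"
      proof
        fix P assume P: "P \<in> {..min (s * M) (s * L)} - (*) s ` {..min M L}"
        have "\<not> s dvd P"
        proof
          assume "s dvd P"
          then obtain p where "P = s * p" by blast
          then show False using P s0 by auto
        qed
        then show "T h P = 0" by (simp add: T_def prod_vec_def chi_def)
      qed
    qed simp
    finally show ?thesis .
  qed
  have "F ?X = R3 14 15 16 (G ?X)"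
    using FG[rule_format, of ?X] D.R_chi3[OF t] by (simp add: chi3_prod_vec)
  then have "B (F ?X) = B (G ?X)"
    using bra_RD[OF s, of "s * M" "s * L" "G ?X"] by (simp add: B T_def)
  then show "(\<Sum>p\<le>min M L. ?w (M - p) * ?w p * ?w (L - p) * F ?X (point (s * (M - p)) (s * p) (s * (L - p))))
     = (\<Sum>p\<le>min M L. ?w (M - p) * ?w p * ?w (L - p) * G ?X (point (s * (M - p)) (s * p) (s * (L - p))))"
    by (simp only: B_def)
qed

end

section \<open>Power series and the Yang--Baxter equation for matrix elements\<close>

lemma at_x_mult: "at_x (f * g) = at_x f * at_x g"
  by (intro fps_ext) (simp add: at_x_def fps_mult_nth fps_sum_nth sum.neutral)

lemma at_y_mult: "at_y (f * g) = at_y f * at_y g"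
  by (simp add: at_y_def)

lemma at_xy_mult: "at_xy (f * g) = at_xy f * at_xy g"
proof (rule fps_ext)
  fix n
  have c: "fps_const (\<Sum>i\<in>A. h i) = (\<Sum>i\<in>A. fps_const (h i))" for h :: "nat \<Rightarrow> 'a" and A
    by (rule fps_ext) (simp add: fps_sum_nth)
  have "fps_nth (at_xy f * at_xy g) n
      = (\<Sum>i=0..n. (fps_const (fps_nth f i) * fps_const (fps_nth g (n - i))) * (fps_X ^ i * fps_X ^ (n - i)))"
    unfolding at_xy_def fps_mult_nth by (simp add: mult_ac)
  also have "\<dots> = (\<Sum>i=0..n. fps_const (fps_nth f i * fps_nth g (n - i)) * fps_X ^ n)"
    by (intro sum.cong refl) (simp add: power_add[symmetric])
  also have "\<dots> = fps_nth (at_xy (f * g)) n"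
    unfolding at_xy_def fps_mult_nth by (simp add: c sum_distrib_right fps_mult_nth)
  finally show "fps_nth (at_xy (f * g)) n = fps_nth (at_xy f * at_xy g) n" ..
qed

lemma at_0 [simp]: "at_x 0 = 0" "at_xy 0 = 0" "at_y 0 = 0"
  by (rule fps_ext, simp add: at_x_def at_xy_def at_y_def)+

lemma coeff3:
  "fps_nth (fps_nth (at_x f * at_xy g * at_y h) M) L
    = (\<Sum>p\<le>min M L. fps_nth f (M - p) * fps_nth g p * fps_nth h (L - p))"
proof -
  have "fps_nth (at_x f * at_xy g * at_y h) M = (\<Sum>i=0..M. fps_const (fps_nth f i) * (fps_const (fps_nth g (M - i)) * fps_X ^ (M - i))) * h"
    by (simp add: at_y_def at_x_def at_xy_def fps_mult_nth[of "Abs_fps _"])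
  also have "\<dots> = (\<Sum>i=0..M. fps_const (fps_nth f i * fps_nth g (M - i)) * (fps_X ^ (M - i) * h))"
    unfolding sum_distrib_right by (intro sum.cong refl) (simp add: mult.assoc[symmetric])
  finally have "fps_nth (fps_nth (at_x f * at_xy g * at_y h) M) L
      = (\<Sum>i=0..M. fps_nth f i * fps_nth g (M - i) * (if L < M - i then 0 else fps_nth h (L - (M - i))))"
    by (simp add: fps_sum_nth fps_X_power_mult_nth)
  also have "\<dots> = (\<Sum>p=0..M. fps_nth f (M - p) * fps_nth g p * (if L < p then 0 else fps_nth h (L - p)))"
    by (subst sum.atLeastAtMost_rev) (intro sum.cong, auto)
  also have "\<dots> = (\<Sum>p\<le>min M L. fps_nth f (M - p) * fps_nth g p * fps_nth h (L - p))"
    by (intro sum.mono_neutral_cong_right) auto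
  finally show ?thesis .
qed

lemma sum_rot: "(\<Sum>a\<in>A. \<Sum>b\<in>B. \<Sum>c\<in>C. F a b c) = (\<Sum>c\<in>C. \<Sum>a\<in>A. \<Sum>b\<in>B. F a b c)"
  for F :: "'x \<Rightarrow> 'y \<Rightarrow> 'z \<Rightarrow> 'w::comm_monoid_add"
proof -
  have "(\<Sum>a\<in>A. \<Sum>b\<in>B. \<Sum>c\<in>C. F a b c) = (\<Sum>a\<in>A. \<Sum>c\<in>C. \<Sum>b\<in>B. F a b c)"
    by (intro sum.cong refl sum.swap)
  also have "\<dots> = (\<Sum>c\<in>C. \<Sum>a\<in>A. \<Sum>b\<in>B. F a b c)" by (rule sum.swap)
  finally show ?thesis .
qed

lemma sum_rot4: "(\<Sum>a\<in>A. \<Sum>b\<in>B. \<Sum>c\<in>C. \<Sum>d\<in>D. F a b c d) = (\<Sum>d\<in>D. \<Sum>a\<in>A. \<Sum>b\<in>B. \<Sum>c\<in>C. F a b c d)"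
  for F :: "'x \<Rightarrow> 'y \<Rightarrow> 'z \<Rightarrow> 'v \<Rightarrow> 'w::comm_monoid_add"
proof -
  have "(\<Sum>a\<in>A. \<Sum>b\<in>B. \<Sum>c\<in>C. \<Sum>d\<in>D. F a b c d) = (\<Sum>a\<in>A. \<Sum>d\<in>D. \<Sum>b\<in>B. \<Sum>c\<in>C. F a b c d)"
    by (intro sum.cong refl sum_rot)
  also have "\<dots> = (\<Sum>d\<in>D. \<Sum>a\<in>A. \<Sum>b\<in>B. \<Sum>c\<in>C. F a b c d)" by (rule sum.swap)
  finally show ?thesis .
qed

lemma sum_swap22: "(\<Sum>a\<in>A. \<Sum>b\<in>B. \<Sum>c\<in>C. \<Sum>d\<in>D. F a b c d) = (\<Sum>c\<in>C. \<Sum>d\<in>D. \<Sum>a\<in>A. \<Sum>b\<in>B. F a b c d)"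
  for F :: "'x \<Rightarrow> 'y \<Rightarrow> 'z \<Rightarrow> 'v \<Rightarrow> 'w::comm_monoid_add"
proof -
  have "(\<Sum>a\<in>A. \<Sum>b\<in>B. \<Sum>c\<in>C. \<Sum>d\<in>D. F a b c d) = (\<Sum>c\<in>C. \<Sum>a\<in>A. \<Sum>b\<in>B. \<Sum>d\<in>D. F a b c d)"
    by (rule sum_rot)
  also have "\<dots> = (\<Sum>c\<in>C. \<Sum>d\<in>D. \<Sum>a\<in>A. \<Sum>b\<in>B. F a b c d)"
    by (intro sum.cong refl sum_rot)
  finally show ?thesis .
qed

context q_fock begin

text \<open>
  Matrix elements of \<open>S\<close> without the normalization factor, for both ways of closing.
\<close>
definition elt_series where
  "elt_series w u \<phi> es a b i j = Abs_fps (\<lambda>m. w m * chain_elt es a b i j (u m) (\<phi> m))"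

lemma ybe_T:
  assumes inv: "invariant w u \<phi>"
    and es: "set es \<subseteq> {0, 1}" "N \<ge> 1"
    and abc: "length a = length es" "length b = length es" "length c = length es"
      "\<And>t. t < length es \<Longrightarrow> a ! t + b ! t + c ! t \<le> N"
    and ijk: "i \<in> tuples (length es) N" "j \<in> tuples (length es) N" "k \<in> tuples (length es) N"
  shows "(\<Sum>a'\<in>tuples (length es) N. \<Sum>b'\<in>tuples (length es) N. \<Sum>c'\<in>tuples (length es) N.
      at_x (elt_series w u \<phi> es a b a' b') * at_xy (elt_series w u \<phi> es a' c i c') * at_y (elt_series w u \<phi> es b' c' j k))
    = (\<Sum>a'\<in>tuples (length es) N. \<Sum>b'\<in>tuples (length es) N. \<Sum>c'\<in>tuples (length es) N.
      at_x (elt_series w u \<phi> es a' b' i j) * at_xy (elt_series w u \<phi> es a c' a' k) * at_y (elt_series w u \<phi> es b c b' c'))"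
    (is "?l = ?r")
proof (intro fps_ext)
  fix M L
  let ?I = "tuples (length es) N"
  let ?w = "\<lambda>p. w (M - p) * w p * w (L - p)"
  let ?X = "\<lambda>p. prod_vec (\<phi> (M - p)) (\<phi> p) (\<phi> (L - p))" and ?s = "\<lambda>p. point (u (M - p)) (u p) (u (L - p))"
  have len: "length i = length es" "length j = length es" "length k = length es"
    using ijk by (auto simp: tuples_def)
  have "fps_nth (fps_nth ?l M) L = (\<Sum>p\<le>min M L. ?w p * chain_left N es a b c i j k (?X p) (?s p))"
    unfolding fps_sum_nth coeff3 elt_series_def chain_left_point[OF abc(1,2,3) len] fps_nth_Abs_fps sum_distrib_left
    by (subst sum_rot4) (intro sum.cong refl, simp add: mult_ac)
  also have "\<dots> = (\<Sum>p\<le>min M L. ?w p * chain_right N es a b c i j k (?X p) (?s p))"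
    by (rule inv[unfolded invariant_def, rule_format])
      (rule chain_left_RD[OF es abc ijk] chain_right_lin | assumption)+
  also have "\<dots> = fps_nth (fps_nth ?r M) L"
    unfolding fps_sum_nth coeff3 elt_series_def chain_right_point[OF abc(1,2,3) len] fps_nth_Abs_fps sum_distrib_left
    by (subst (2) sum_rot4) (intro sum.cong refl, simp add: mult_ac)
  finally show "fps_nth (fps_nth ?l M) L = fps_nth (fps_nth ?r M) L" .
qed

lemma elt_series_nonzero:
  assumes "elt_series w u \<phi> es a b i j \<noteq> 0" "t < length es"
  shows "a ! t + b ! t = i ! t + j ! t" "es ! t = 1 \<Longrightarrow> i ! t \<le> 1 \<and> j ! t \<le> 1"
proof -
  obtain m where "pweight es a b i j (path b j (u m)) \<noteq> 0"
    using assms(1) by (auto simp: elt_series_def chain_elt_def fps_eq_iff)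
  then obtain c c' where nz: "scrS q (es ! t) (a ! t) (b ! t) c (i ! t) (j ! t) c' \<noteq> 0"
    using assms(2) by (auto simp: pweight_def)
  then show "a ! t + b ! t = i ! t + j ! t" by (rule scrS_conservation)
  show "i ! t \<le> 1 \<and> j ! t \<le> 1" if "es ! t = 1"
    using nz that by (auto simp: scrS_def scrS1_def split: if_splits)
qed

lemma S_tr_T: "es \<noteq> [] \<Longrightarrow> S_tr q r es a b i j = r * elt_series (\<lambda>_. 1) (\<lambda>m. m) kron es a b i j"
  by (simp add: S_tr_def elt_series_def chain_elt_def kron_def sum_weight_tr)

lemma S_st_T: "es \<noteq> [] \<Longrightarrow> t > 0 \<Longrightarrow> S_st q r s t es a b i j
    = r * elt_series (\<lambda>m. qpoch q 2 (s * m) / qpoch q (s\<^sup>2) m) (\<lambda>m. s * m) (\<lambda>_. chi t) es a b i j"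
  using sum_weight_st[of es t s a b i j] by (simp only: S_st_def elt_series_def chain_elt_def sum_weight_st simp_thms)

end

section \<open>From matrix elements to linear maps\<close>

abbreviation "lookup \<equiv> Poly_Mapping.lookup"

lemma lookup_linext: "lookup (linext T v) x = (\<Sum>b\<in>Poly_Mapping.keys v. lookup v b * lookup (T b) x)"
  unfolding linext_def lookup_sum by (intro sum.cong refl) (simp add: map.rep_eq when_def)

text \<open>
  The two properties of a matrix that make its action on basis labels a finite sum and keep it inside
  the labels of \<open>W\<close>: conservation at every site, and lower labels at most one at the six-vertex sites.
\<close>
definition local_mat :: "nat list \<Rightarrow> 'r::comm_ring_1 mat \<Rightarrow> bool" where
  "local_mat es M \<longleftrightarrow> (\<forall>a b i j. M a b i j \<noteq> 0 \<longrightarrow> (\<forall>t<length es. a ! t + b ! t = i ! t + j ! t \<and>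
     (es ! t = 1 \<longrightarrow> i ! t \<le> 1 \<and> j ! t \<le> 1)))"

lemma lookup_column:
  assumes M: "local_mat es M" and inj: "\<And>a b a' b'. f a b = f a' b' \<Longrightarrow> a = a' \<and> b = b'"
  shows "a \<in> labels es \<Longrightarrow> b \<in> labels es \<Longrightarrow> lookup (column es M i j f) (f a b) = M a b i j"
    and "(\<And>a b. x \<noteq> f a b) \<Longrightarrow> lookup (column es M i j f) x = 0"
proof -
  let ?S = "{(a, b). a \<in> labels es \<and> b \<in> labels es \<and> (\<forall>t<length es. a ! t + b ! t = i ! t + j ! t)}"
  have fin: "finite ?S" by (rule finite_label_pairs)
  have z: "M a b i j = 0" if "a ! t + b ! t \<noteq> i ! t + j ! t" "t < length es" for a b t
    using M that unfolding local_mat_def by blast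
  have "column es M i j f = (\<Sum>(a, b)\<in>?S. Poly_Mapping.single (f a b) (M a b i j) when a \<in> labels es \<and> b \<in> labels es)"
    unfolding column_def
  proof (rule Sum_any.expand_superset[OF fin])
    show "{p. (case p of (a, b) \<Rightarrow> Poly_Mapping.single (f a b) (M a b i j) when a \<in> labels es \<and> b \<in> labels es) \<noteq> 0} \<subseteq> ?S"
      using z by (auto simp: when_def split: if_splits) (metis single_zero)
  qed
  then have *: "lookup (column es M i j f) x = (\<Sum>p\<in>?S. if x = f (fst p) (snd p) then M (fst p) (snd p) i j else 0)" for x
    by (auto simp: lookup_sum lookup_single when_def split_def intro!: sum.cong)
  show "lookup (column es M i j f) (f a b) = M a b i j" if ab: "a \<in> labels es" "b \<in> labels es"
  proof -
    have eq: "f a b = f (fst p) (snd p) \<longleftrightarrow> p = (a, b)" for p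
      using inj[of a b "fst p" "snd p"] by auto
    have "M a b i j = 0" if "(a, b) \<notin> ?S" using that z ab by auto
    then show ?thesis unfolding * eq using fin by (simp add: sum.delta)
  qed
  show "lookup (column es M i j f) x = 0" if "\<And>a b. x \<noteq> f a b"
    unfolding * using that by simp
qed

text \<open>
  The map \<open>place\<close> puts two labels into the tensor factors on which the matrix acts and the third into
  the spectator, so that the three embeddings are treated at once.
\<close>
lemma lookup_act:
  fixes M :: "'r::comm_ring_1 mat" and place :: "label \<Rightarrow> label \<Rightarrow> label \<Rightarrow> label \<times> label \<times> label"
  assumes M: "local_mat es M" and v: "v \<in> WWW es"
    and inj: "\<And>i j k i' j' k'. place i j k = place i' j' k' \<Longrightarrow> i = i' \<and> j = j' \<and> k = k'"
    and surj: "\<And>x. x \<in> labels es \<times> labels es \<times> labels es \<Longrightarrow> \<exists>i j k. x = place i j k \<and> i \<in> labels es \<and> j \<in> labels es"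
    and T: "\<And>i j k. T (place i j k) = column es M i j (\<lambda>a b. place a b k)"
    and ab: "a \<in> labels es" "b \<in> labels es" "\<And>t. t < length es \<Longrightarrow> a ! t + b ! t \<le> N"
  shows "lookup (linext T v) (place a b c)
    = (\<Sum>i\<in>tuples (length es) N. \<Sum>j\<in>tuples (length es) N. M a b i j * lookup v (place i j c))"
proof -
  let ?I = "tuples (length es) N"
  define G where "G x = lookup v x * lookup (T x) (place a b c)" for x
  have col: "lookup (T (place i j k)) (place a b c) = (if k = c then M a b i j else 0)" for i j k
  proof (cases "k = c")
    case True
    then show ?thesis unfolding T
      using lookup_column(1)[OF M _ ab(1,2), of "\<lambda>a b. place a b c"] inj by auto
  next
    case False
    have "place a b c \<noteq> place a' b' k" for a' b' using inj False by blast
    then show ?thesis unfolding T using False inj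
      lookup_column(2)[OF M, of "\<lambda>a b. place a b k" "place a b c"] by auto
  qed
  let ?J = "(\<lambda>(i, j). place i j c) ` (?I \<times> ?I)"
  have "lookup (linext T v) (place a b c) = (\<Sum>x\<in>Poly_Mapping.keys v. G x)"
    by (simp add: lookup_linext G_def)
  also have "\<dots> = (\<Sum>x\<in>Poly_Mapping.keys v \<inter> ?J. G x)"
  proof (rule sum.mono_neutral_right)
    show "\<forall>x\<in>Poly_Mapping.keys v - Poly_Mapping.keys v \<inter> ?J. G x = 0"
    proof
      fix x assume x: "x \<in> Poly_Mapping.keys v - Poly_Mapping.keys v \<inter> ?J"
      then have "x \<in> labels es \<times> labels es \<times> labels es" using v by (auto simp: WWW_def)
      then obtain i j k where p: "x = place i j k" "i \<in> labels es" "j \<in> labels es" using surj by blast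
      have "M a b i j = 0" if k: "k = c"
      proof (rule ccontr)
        assume nz: "M a b i j \<noteq> 0"
        have "i ! t \<le> N \<and> j ! t \<le> N" if t: "t < length es" for t
        proof -
          have "a ! t + b ! t = i ! t + j ! t" using M nz t unfolding local_mat_def by blast
          then show ?thesis using ab(3)[OF t] by linarith
        qed
        then have "i \<in> ?I" "j \<in> ?I" using p by (auto simp: tuples_def labels_def in_set_conv_nth)
        then show False using x p k by auto
      qed
      then show "G x = 0" unfolding G_def p(1) col by auto
    qed
  qed auto
  also have "\<dots> = (\<Sum>x\<in>?J. G x)"
    by (rule sum.mono_neutral_left) (auto simp: G_def in_keys_iff finite_tuples)
  also have "\<dots> = (\<Sum>(i, j)\<in>?I \<times> ?I. G (place i j c))"
    by (subst sum.reindex) (use inj in \<open>auto simp: inj_on_def split_def\<close>)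
  also have "\<dots> = (\<Sum>i\<in>?I. \<Sum>j\<in>?I. G (place i j c))" by (simp add: sum.cartesian_product)
  finally show ?thesis by (simp add: G_def col mult.commute)
qed

lemma lookup_act12:
  assumes "local_mat es M" "v \<in> WWW es" "a \<in> labels es" "b \<in> labels es" "\<And>t. t < length es \<Longrightarrow> a ! t + b ! t \<le> N"
  shows "lookup (act12 es M v) (a, b, c)
    = (\<Sum>i\<in>tuples (length es) N. \<Sum>j\<in>tuples (length es) N. M a b i j * lookup v (i, j, c))"
  unfolding act12_def by (rule lookup_act[where place = "\<lambda>i j k. (i, j, k)"]) (use assms in auto)

lemma lookup_act13:
  assumes "local_mat es M" "v \<in> WWW es" "a \<in> labels es" "c \<in> labels es" "\<And>t. t < length es \<Longrightarrow> a ! t + c ! t \<le> N"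
  shows "lookup (act13 es M v) (a, b, c)
    = (\<Sum>i\<in>tuples (length es) N. \<Sum>k\<in>tuples (length es) N. M a c i k * lookup v (i, b, k))"
  unfolding act13_def by (rule lookup_act[where place = "\<lambda>i j k. (i, k, j)"]) (use assms in auto)

lemma lookup_act23:
  assumes "local_mat es M" "v \<in> WWW es" "b \<in> labels es" "c \<in> labels es" "\<And>t. t < length es \<Longrightarrow> b ! t + c ! t \<le> N"
  shows "lookup (act23 es M v) (a, b, c)
    = (\<Sum>j\<in>tuples (length es) N. \<Sum>k\<in>tuples (length es) N. M b c j k * lookup v (a, j, k))"
  unfolding act23_def by (rule lookup_act[where place = "\<lambda>i j k. (k, i, j)"]) (use assms in auto)

lemma local_mat_labels:
  assumes "local_mat es M" "M a b i j \<noteq> 0" "i \<in> tuples (length es) N" "j \<in> tuples (length es) N"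
  shows "i \<in> labels es" "j \<in> labels es" "\<And>t. t < length es \<Longrightarrow> a ! t + b ! t = i ! t + j ! t"
  using assms by (auto simp: local_mat_def labels_def tuples_def)

lemma mult_cong0: "(x \<noteq> 0 \<Longrightarrow> y = z) \<Longrightarrow> x * y = x * (z :: 'b::mult_zero)"
  by (cases "x = 0") auto

lemma acts_agree:
  fixes X Y Z :: "'r::comm_ring_1 mat"
  assumes loc: "local_mat es X" "local_mat es Y" "local_mat es Z" and v: "v \<in> WWW es"
    and ybe: "\<And>N a b c i j k. \<lbrakk>N \<ge> 1; length a = length es; length b = length es; length c = length es;
        \<And>t. t < length es \<Longrightarrow> a ! t + b ! t + c ! t \<le> N;
        i \<in> tuples (length es) N; j \<in> tuples (length es) N; k \<in> tuples (length es) N\<rbrakk> \<Longrightarrow>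
      (\<Sum>a'\<in>tuples (length es) N. \<Sum>b'\<in>tuples (length es) N. \<Sum>c'\<in>tuples (length es) N. X a b a' b' * Y a' c i c' * Z b' c' j k)
      = (\<Sum>a'\<in>tuples (length es) N. \<Sum>b'\<in>tuples (length es) N. \<Sum>c'\<in>tuples (length es) N. X a' b' i j * Y a c' a' k * Z b c b' c')"
  shows "act12 es X (act13 es Y (act23 es Z v)) = act23 es Z (act13 es Y (act12 es X v))"
proof (rule poly_mapping_eqI)
  fix x :: "label \<times> label \<times> label"
  obtain a b c where x: "x = (a, b, c)" by (cases x)
  let ?l = "act12 es X (act13 es Y (act23 es Z v))" and ?r = "act23 es Z (act13 es Y (act12 es X v))"
  show "lookup ?l x = lookup ?r x"
  proof (cases "a \<in> labels es \<and> b \<in> labels es \<and> c \<in> labels es")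
    case False
    have "?l \<in> WWW es" "?r \<in> WWW es" using v by (simp_all add: act_in_WWW)
    then have "x \<notin> Poly_Mapping.keys ?l" "x \<notin> Poly_Mapping.keys ?r" using False by (auto simp: WWW_def x)
    then show ?thesis by (simp add: in_keys_iff)
  next
    case True
    then have lab: "a \<in> labels es" "b \<in> labels es" "c \<in> labels es" by auto
    \<comment> \<open>bounds every label that can occur in a nonzero term, at any of the three stages\<close>
    define N where "N = (\<Sum>t<length es. a ! t + b ! t + c ! t) + 1"
    have N: "a ! t + b ! t + c ! t \<le> N" if "t < length es" for t
      using member_le_sum[of t "{..<length es}" "\<lambda>t. a ! t + b ! t + c ! t"] that by (simp add: N_def)
    let ?I = "tuples (length es) N" and ?V = "\<lambda>i j k. lookup v (i, j, k)"
    have "lookup ?l (a, b, c)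
        = (\<Sum>a'\<in>?I. \<Sum>b'\<in>?I. X a b a' b' * lookup (act13 es Y (act23 es Z v)) (a', b', c))"
      by (rule lookup_act12) (use loc v lab N in \<open>auto intro!: act_in_WWW intro: add_leD1\<close>)
    also have "\<dots> = (\<Sum>a'\<in>?I. \<Sum>b'\<in>?I. X a b a' b' * (\<Sum>i\<in>?I. \<Sum>c'\<in>?I. Y a' c i c' * (\<Sum>j\<in>?I. \<Sum>k\<in>?I. Z b' c' j k * ?V i j k)))"
    proof (intro sum.cong refl mult_cong0)
      fix a' b' assume ab: "a' \<in> ?I" "b' \<in> ?I" "X a b a' b' \<noteq> 0"
      note X = local_mat_labels[OF loc(1) ab(3,1,2)]
      have le: "a' ! t + c ! t \<le> N" if "t < length es" for t using N[OF that] X(3)[OF that] by linarith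
      have "lookup (act13 es Y (act23 es Z v)) (a', b', c)
          = (\<Sum>i\<in>?I. \<Sum>c'\<in>?I. Y a' c i c' * lookup (act23 es Z v) (i, b', c'))"
        by (rule lookup_act13) (use loc v lab X le in \<open>auto intro!: act_in_WWW\<close>)
      also have "\<dots> = (\<Sum>i\<in>?I. \<Sum>c'\<in>?I. Y a' c i c' * (\<Sum>j\<in>?I. \<Sum>k\<in>?I. Z b' c' j k * ?V i j k))"
      proof (intro sum.cong refl mult_cong0)
        fix i c' assume ic: "i \<in> ?I" "c' \<in> ?I" "Y a' c i c' \<noteq> 0"
        note Y = local_mat_labels[OF loc(2) ic(3,1,2)]
        have le: "b' ! t + c' ! t \<le> N" if "t < length es" for t
          using N[OF that] X(3)[OF that] Y(3)[OF that] by linarith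
        show "lookup (act23 es Z v) (i, b', c') = (\<Sum>j\<in>?I. \<Sum>k\<in>?I. Z b' c' j k * ?V i j k)"
          by (rule lookup_act23) (use loc v X Y le in auto)
      qed
      finally show "lookup (act13 es Y (act23 es Z v)) (a', b', c)
          = (\<Sum>i\<in>?I. \<Sum>c'\<in>?I. Y a' c i c' * (\<Sum>j\<in>?I. \<Sum>k\<in>?I. Z b' c' j k * ?V i j k))" .
    qed
    also have "\<dots> = (\<Sum>a'\<in>?I. \<Sum>b'\<in>?I. \<Sum>i\<in>?I. \<Sum>c'\<in>?I. \<Sum>j\<in>?I. \<Sum>k\<in>?I. X a b a' b' * Y a' c i c' * Z b' c' j k * ?V i j k)"
      by (simp add: sum_distrib_left mult.assoc)
    also have "\<dots> = (\<Sum>i\<in>?I. \<Sum>a'\<in>?I. \<Sum>b'\<in>?I. \<Sum>c'\<in>?I. \<Sum>j\<in>?I. \<Sum>k\<in>?I. X a b a' b' * Y a' c i c' * Z b' c' j k * ?V i j k)"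
      by (rule sum_rot)
    also have "\<dots> = (\<Sum>i\<in>?I. \<Sum>j\<in>?I. \<Sum>a'\<in>?I. \<Sum>b'\<in>?I. \<Sum>c'\<in>?I. \<Sum>k\<in>?I. X a b a' b' * Y a' c i c' * Z b' c' j k * ?V i j k)"
      by (intro sum.cong refl sum_rot4)
    also have "\<dots> = (\<Sum>i\<in>?I. \<Sum>j\<in>?I. \<Sum>k\<in>?I. \<Sum>a'\<in>?I. \<Sum>b'\<in>?I. \<Sum>c'\<in>?I. X a b a' b' * Y a' c i c' * Z b' c' j k * ?V i j k)"
      by (intro sum.cong refl sum_rot4)
    also have "\<dots> = (\<Sum>i\<in>?I. \<Sum>j\<in>?I. \<Sum>k\<in>?I. \<Sum>a'\<in>?I. \<Sum>b'\<in>?I. \<Sum>c'\<in>?I. X a' b' i j * Y a c' a' k * Z b c b' c' * ?V i j k)"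
    proof (rule sum.cong[OF refl], rule sum.cong[OF refl], rule sum.cong[OF refl])
      fix i j k assume ijk: "i \<in> ?I" "j \<in> ?I" "k \<in> ?I"
      have "(\<Sum>a'\<in>?I. \<Sum>b'\<in>?I. \<Sum>c'\<in>?I. X a b a' b' * Y a' c i c' * Z b' c' j k)
        = (\<Sum>a'\<in>?I. \<Sum>b'\<in>?I. \<Sum>c'\<in>?I. X a' b' i j * Y a c' a' k * Z b c b' c')"
        by (rule ybe[OF _ _ _ _ N ijk]) (use lab in \<open>auto simp: N_def labels_def\<close>)
      then show "(\<Sum>a'\<in>?I. \<Sum>b'\<in>?I. \<Sum>c'\<in>?I. X a b a' b' * Y a' c i c' * Z b' c' j k * ?V i j k)
        = (\<Sum>a'\<in>?I. \<Sum>b'\<in>?I. \<Sum>c'\<in>?I. X a' b' i j * Y a c' a' k * Z b c b' c' * ?V i j k)"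
        by (simp only: sum_distrib_right[symmetric])
    qed
    also have "\<dots> = (\<Sum>i\<in>?I. \<Sum>j\<in>?I. \<Sum>k\<in>?I. \<Sum>b'\<in>?I. \<Sum>c'\<in>?I. \<Sum>a'\<in>?I. X a' b' i j * Y a c' a' k * Z b c b' c' * ?V i j k)"
      by (intro sum.cong refl sum_rot[symmetric])
    also have "\<dots> = (\<Sum>i\<in>?I. \<Sum>j\<in>?I. \<Sum>b'\<in>?I. \<Sum>c'\<in>?I. \<Sum>a'\<in>?I. \<Sum>k\<in>?I. X a' b' i j * Y a c' a' k * Z b c b' c' * ?V i j k)"
      by (intro sum.cong refl sum_rot4[symmetric])
    also have "\<dots> = (\<Sum>b'\<in>?I. \<Sum>c'\<in>?I. \<Sum>i\<in>?I. \<Sum>j\<in>?I. \<Sum>a'\<in>?I. \<Sum>k\<in>?I. X a' b' i j * Y a c' a' k * Z b c b' c' * ?V i j k)"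
      by (rule sum_swap22)
    also have "\<dots> = (\<Sum>b'\<in>?I. \<Sum>c'\<in>?I. \<Sum>a'\<in>?I. \<Sum>k\<in>?I. \<Sum>i\<in>?I. \<Sum>j\<in>?I. X a' b' i j * Y a c' a' k * Z b c b' c' * ?V i j k)"
      by (intro sum.cong refl sum_swap22)
    also have "\<dots> = (\<Sum>b'\<in>?I. \<Sum>c'\<in>?I. Z b c b' c' * (\<Sum>a'\<in>?I. \<Sum>k\<in>?I. Y a c' a' k * (\<Sum>i\<in>?I. \<Sum>j\<in>?I. X a' b' i j * ?V i j k)))"
      by (simp add: sum_distrib_left mult_ac)
    also have "\<dots> = (\<Sum>b'\<in>?I. \<Sum>c'\<in>?I. Z b c b' c' * lookup (act13 es Y (act12 es X v)) (a, b', c'))"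
    proof (intro sum.cong refl mult_cong0)
      fix b' c' assume bc: "b' \<in> ?I" "c' \<in> ?I" "Z b c b' c' \<noteq> 0"
      note Z = local_mat_labels[OF loc(3) bc(3,1,2)]
      have le: "a ! t + c' ! t \<le> N" if "t < length es" for t using N[OF that] Z(3)[OF that] by linarith
      have "lookup (act13 es Y (act12 es X v)) (a, b', c')
          = (\<Sum>a'\<in>?I. \<Sum>k\<in>?I. Y a c' a' k * lookup (act12 es X v) (a', b', k))"
        by (rule lookup_act13) (use loc v lab Z le in \<open>auto intro!: act_in_WWW\<close>)
      also have "\<dots> = (\<Sum>a'\<in>?I. \<Sum>k\<in>?I. Y a c' a' k * (\<Sum>i\<in>?I. \<Sum>j\<in>?I. X a' b' i j * ?V i j k))"
      proof (intro sum.cong refl mult_cong0)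
        fix a' k assume ak: "a' \<in> ?I" "k \<in> ?I" "Y a c' a' k \<noteq> 0"
        note Y = local_mat_labels[OF loc(2) ak(3,1,2)]
        have le: "a' ! t + b' ! t \<le> N" if "t < length es" for t
          using N[OF that] Z(3)[OF that] Y(3)[OF that] by linarith
        show "lookup (act12 es X v) (a', b', k) = (\<Sum>i\<in>?I. \<Sum>j\<in>?I. X a' b' i j * ?V i j k)"
          by (rule lookup_act12) (use loc v Z Y le in auto)
      qed
      finally show "(\<Sum>a'\<in>?I. \<Sum>k\<in>?I. Y a c' a' k * (\<Sum>i\<in>?I. \<Sum>j\<in>?I. X a' b' i j * ?V i j k))
          = lookup (act13 es Y (act12 es X v)) (a, b', c')" ..
    qed
    also have "\<dots> = lookup ?r (a, b, c)"
    proof (rule lookup_act23[symmetric])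
      show "b ! t + c ! t \<le> N" if "t < length es" for t using N[OF that] by linarith
    qed (use loc v lab in \<open>auto intro!: act_in_WWW\<close>)
    finally show ?thesis unfolding x .
  qed
qed

theorem mainTheorem2:
  fixes q :: "'k::field_char_0" and rho :: "'k fps"
    and n :: nat and eps :: "nat list" and S :: "'k fps mat"
  assumes "generic q"
    and "n \<ge> 1" and "length eps = n" and "set eps \<subseteq> {0, 1}"
    and "S = S_tr q rho eps \<or> (\<exists>s\<in>{1, 2}. \<exists>t\<in>{1, 2}. S = S_st q rho s t eps)"
  shows "\<forall>v\<in>WWW eps.
    (act12 eps (subst_mat at_x S) \<circ> act13 eps (subst_mat at_xy S) \<circ> act23 eps (subst_mat at_y S)) v
    = (act23 eps (subst_mat at_y S) \<circ> act13 eps (subst_mat at_xy S) \<circ> act12 eps (subst_mat at_x S)) v"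
proof
  interpret q_fock q by unfold_locales (rule assms(1))
  have ne: "eps \<noteq> []" using assms(2,3) by auto
  have "\<exists>w u \<phi>. invariant w u \<phi> \<and> (\<forall>a b i j. S a b i j = rho * elt_series w u \<phi> eps a b i j)"
    using assms(5)
  proof
    assume "S = S_tr q rho eps"
    then show ?thesis using invariant_tr S_tr_T[OF ne] by blast
  next
    assume "\<exists>s\<in>{1, 2}. \<exists>t\<in>{1, 2}. S = S_st q rho s t eps"
    then obtain s t where st: "s \<in> {1, 2}" "t \<in> {1, 2}" "S = S_st q rho s t eps" by blast
    have "t > 0" using st(2) by auto
    then have "\<forall>a b i j. S a b i j = rho * elt_series (\<lambda>m. qpoch q 2 (s * m) / qpoch q (s\<^sup>2) m) (\<lambda>m. s * m) (\<lambda>_. chi t) eps a b i j"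
      unfolding st(3) by (intro allI S_st_T ne)
    with invariant_st[OF st(1,2)] show ?thesis by (intro exI conjI)
  qed
  then obtain w u \<phi> where inv: "invariant w u \<phi>" and S: "\<And>a b i j. S a b i j = rho * elt_series w u \<phi> eps a b i j"
    by blast
  have "local_mat eps S"
    unfolding local_mat_def
  proof (intro allI impI)
    fix a b i j t assume "S a b i j \<noteq> 0" "t < length eps"
    then show "a ! t + b ! t = i ! t + j ! t \<and> (eps ! t = 1 \<longrightarrow> i ! t \<le> 1 \<and> j ! t \<le> 1)"
      using elt_series_nonzero[of w u \<phi> eps a b i j t] by (simp add: S)
  qed
  then have loc: "local_mat eps (subst_mat h S)" if "h 0 = 0" for h :: "'k fps \<Rightarrow> 'k fps fps"
    using that by (auto simp: local_mat_def subst_mat_def) metis+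
  fix v :: "'k fps fps vec3"
  assume v: "v \<in> WWW eps"
  show "(act12 eps (subst_mat at_x S) \<circ> act13 eps (subst_mat at_xy S) \<circ> act23 eps (subst_mat at_y S)) v
    = (act23 eps (subst_mat at_y S) \<circ> act13 eps (subst_mat at_xy S) \<circ> act12 eps (subst_mat at_x S)) v"
    unfolding o_apply
  proof (rule acts_agree[OF _ _ _ v])
    fix N and a b c i j k :: label
    assume N: "N \<ge> 1" and abc: "length a = length eps" "length b = length eps" "length c = length eps"
        "\<And>t. t < length eps \<Longrightarrow> a ! t + b ! t + c ! t \<le> N"
      and ijk: "i \<in> tuples (length eps) N" "j \<in> tuples (length eps) N" "k \<in> tuples (length eps) N"
    let ?I = "tuples (length eps) N" and ?T = "elt_series w u \<phi> eps"
    let ?\<rho> = "at_x rho * at_xy rho * at_y rho"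
    have "(\<Sum>a'\<in>?I. \<Sum>b'\<in>?I. \<Sum>c'\<in>?I. subst_mat at_x S a b a' b' * subst_mat at_xy S a' c i c' * subst_mat at_y S b' c' j k)
       = ?\<rho> * (\<Sum>a'\<in>?I. \<Sum>b'\<in>?I. \<Sum>c'\<in>?I. at_x (?T a b a' b') * at_xy (?T a' c i c') * at_y (?T b' c' j k))"
      by (simp add: subst_mat_def S at_x_mult at_xy_mult at_y_mult sum_distrib_left mult_ac)
    also have "\<dots> = ?\<rho> * (\<Sum>a'\<in>?I. \<Sum>b'\<in>?I. \<Sum>c'\<in>?I. at_x (?T a' b' i j) * at_xy (?T a c' a' k) * at_y (?T b c b' c'))"
      by (simp only: ybe_T[OF inv assms(4) N abc ijk])
    also have "\<dots> = (\<Sum>a'\<in>?I. \<Sum>b'\<in>?I. \<Sum>c'\<in>?I. subst_mat at_x S a' b' i j * subst_mat at_xy S a c' a' k * subst_mat at_y S b c b' c')"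
      by (simp add: subst_mat_def S at_x_mult at_xy_mult at_y_mult sum_distrib_left mult_ac)
    finally show "(\<Sum>a'\<in>?I. \<Sum>b'\<in>?I. \<Sum>c'\<in>?I. subst_mat at_x S a b a' b' * subst_mat at_xy S a' c i c' * subst_mat at_y S b' c' j k)
       = (\<Sum>a'\<in>?I. \<Sum>b'\<in>?I. \<Sum>c'\<in>?I. subst_mat at_x S a' b' i j * subst_mat at_xy S a c' a' k * subst_mat at_y S b c b' c')" .
  qed (simp_all add: loc)
qed

end
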